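(* Let $\mathscr{M}$ be a cofibrantly generated monoidal model category satisfying the very strong unit axiom for a certain cofibrant resolution $q\colon\tilde{\mathbf{1}}\to\mathbf{1}$ of the tensor unit. Let $$\tilde{\mathbf{1}}\amalg\mathbf{1}\xrightarrow{\ j\ }C\xrightarrow{\ p\ }\mathbf{1}$$ be a factorization of $(q,\mathrm{id}_{\mathbf{1}})\colon\tilde{\mathbf{1}}\amalg\mathbf{1}\to\mathbf{1}$ into a cofibration $j$ followed by a weak equivalence $p$ in $\mathscr{M}$, and let $i_1\colon\tilde{\mathbf{1}}\to\tilde{\mathbf{1}}\amalg\mathbf{1}$ be the inclusion of the first factor. Assume that $\mathscr{M}$ has sets $I$ and $J$ of generating cofibrations and generating trivial cofibrations, respectively, such that, setting $\tilde I=I\cup\{\varnothing\to\mathbf{1}\}$ and $\tilde J=J\cup\{ji_1\colon\tilde{\mathbf{1}}\to C\}$, the domains of $I$ are small relative to $\tilde I$-cell, and $\tilde{\mathbf{1}}$ and the domains of $J$ are small relative to $\tilde J$-cell. Then there is a cofibrantly generated monoidal model category $\tilde{\mathscr{M}}$ with the same underlying (monoidal) category and the same weak equivalences as $\mathscr{M}$, with set of generating cofibrations $\tilde I$ and set of generating trivial cofibrations $\tilde J$. If $\mathscr{M}$ is right proper (resp. left proper), then so is $\tilde{\mathscr{M}}$. If $\mathscr{M}$ is symmetric and satisfies the monoid axiom, then so does $\tilde{\mathscr{M}}$.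
   Context: A monoidal model category is a model category $\mathscr{M}$ with a closed monoidal structure (tensor product $\otimes$, unit $\mathbf{1}$, tensoring preserves colimits in each variable) satisfying the following two axioms. (Push-out product axiom) Given cofibrations $f\colon X\to Y$ and $g\colon U\to V$, the push-out product $f\odot g\colon X\otimes V\cup_{X\otimes U}Y\otimes U\to Y\otimes V$ is a cofibration; if moreover $f$ or $g$ is a trivial cofibration, then so is $f\odot g$. (Unit axiom) There is a cofibrant resolution $q\colon\tilde{\mathbf{1}}\to\mathbf{1}$ of the tensor unit (a weak equivalence with cofibrant source) such that $q\otimes X$ and $X\otimes q$ are weak equivalences for every cofibrant object $X$. $\mathscr{M}$ satisfies the very strong unit axiom for a cofibrant resolution $q\colon\tilde{\mathbf{1}}\to\mathbf{1}$ if $q\otimes X$ and $X\otimes q$ are weak equivalences for every object $X$ of $\mathscr{M}$. Monoid axiom (symmetric case): every transfinite composition of push-outs of maps of the form $f\otimes X$, with $f$ a trivial cofibration and $X$ any object, is a weak equivalence. $\varnothing$ denotes the initial object. For a set $K$ of maps, $K$-cell is the class of relative $K$-cell complexes, i.e. transfinite compositions of push-outs of maps in $K$. Smallness relative to a class of maps is in the usual sense of Hovey's book on model categories. *)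

theory Defs
  imports Main
begin

unbundle cardinal_syntax

section \<open>Universes\<close>

text \<open>
  Size conditions refer to a strongly inaccessible cardinal \<open>\<Theta>\<close>: a collection is a (small) set
  if its cardinality is less than \<open>\<Theta>\<close>. Objects and morphisms of a category live in arbitrary types,
  and may form proper classes in this sense. As every small set can be embedded into \<open>Field \<Theta>\<close>,
  it is no restriction to take small index categories, ordinals and cardinals on the type \<open>'u\<close>.
\<close>

definition universe :: "'u rel \<Rightarrow> bool" where
  "universe \<Theta> \<longleftrightarrow> Card_order \<Theta> \<and> natLeq <o \<Theta> \<and> regularCard \<Theta> \<and>
     (\<forall>A :: 'u set. |A| <o \<Theta> \<longrightarrow> |Pow A| <o \<Theta>)"

definition small :: "'u rel \<Rightarrow> 'a set \<Rightarrow> bool" where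
  "small \<Theta> A \<longleftrightarrow> |A| <o \<Theta>"


section \<open>Categories\<close>

record ('o, 'm) precat =
  Obj :: "'o set"
  Arr :: "'m set"
  Dom :: "'m \<Rightarrow> 'o"
  Cod :: "'m \<Rightarrow> 'o"
  Ident :: "'o \<Rightarrow> 'm"
  Cmp :: "'m \<Rightarrow> 'm \<Rightarrow> 'm" (infixl "\<cdot>\<index>" 65)

definition hom :: "('o, 'm, 'x) precat_scheme \<Rightarrow> 'o \<Rightarrow> 'o \<Rightarrow> 'm set" where
  "hom C A B = {f \<in> Arr C. Dom C f = A \<and> Cod C f = B}"

locale category =
  fixes C :: "('o, 'm, 'x) precat_scheme" (structure)
  assumes Dom_Obj: "f \<in> Arr C \<Longrightarrow> Dom C f \<in> Obj C"
    and Cod_Obj: "f \<in> Arr C \<Longrightarrow> Cod C f \<in> Obj C"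
    and Ident_hom: "A \<in> Obj C \<Longrightarrow> Ident C A \<in> hom C A A"
    and Cmp_hom: "f \<in> hom C A B \<Longrightarrow> g \<in> hom C B D \<Longrightarrow> g \<cdot> f \<in> hom C A D"
    and Cmp_Ident_left: "f \<in> hom C A B \<Longrightarrow> Ident C B \<cdot> f = f"
    and Cmp_Ident_right: "f \<in> hom C A B \<Longrightarrow> f \<cdot> Ident C A = f"
    and Cmp_assoc: "f \<in> hom C A B \<Longrightarrow> g \<in> hom C B D \<Longrightarrow> h \<in> hom C D E \<Longrightarrow>
      (h \<cdot> g) \<cdot> f = h \<cdot> (g \<cdot> f)"

definition iso_arr :: "('o, 'm, 'x) precat_scheme \<Rightarrow> 'm \<Rightarrow> bool" where
  "iso_arr C f \<longleftrightarrow> f \<in> Arr C \<and> (\<exists>g \<in> hom C (Cod C f) (Dom C f).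
     g \<cdot>\<^bsub>C\<^esub> f = Ident C (Dom C f) \<and> f \<cdot>\<^bsub>C\<^esub> g = Ident C (Cod C f))"

definition locally_small :: "'u rel \<Rightarrow> ('o, 'm, 'x) precat_scheme \<Rightarrow> bool" where
  "locally_small \<Theta> C \<longleftrightarrow> (\<forall>A \<in> Obj C. \<forall>B \<in> Obj C. small \<Theta> (hom C A B))"

definition is_functor ::
  "('i, 'j, 'y) precat_scheme \<Rightarrow> ('o, 'm, 'x) precat_scheme \<Rightarrow> ('i \<Rightarrow> 'o) \<Rightarrow> ('j \<Rightarrow> 'm) \<Rightarrow> bool"
where
  "is_functor D C X \<phi> \<longleftrightarrow>
     (\<forall>d \<in> Obj D. X d \<in> Obj C) \<and>
     (\<forall>u \<in> Arr D. \<phi> u \<in> hom C (X (Dom D u)) (X (Cod D u))) \<and>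
     (\<forall>d \<in> Obj D. \<phi> (Ident D d) = Ident C (X d)) \<and>
     (\<forall>u \<in> Arr D. \<forall>v \<in> Arr D. Cod D u = Dom D v \<longrightarrow> \<phi> (v \<cdot>\<^bsub>D\<^esub> u) = \<phi> v \<cdot>\<^bsub>C\<^esub> \<phi> u)"

definition is_cocone ::
  "('i, 'j, 'y) precat_scheme \<Rightarrow> ('o, 'm, 'x) precat_scheme \<Rightarrow> ('i \<Rightarrow> 'o) \<Rightarrow> ('j \<Rightarrow> 'm) \<Rightarrow>
    'o \<Rightarrow> ('i \<Rightarrow> 'm) \<Rightarrow> bool"
where
  "is_cocone D C X \<phi> Z \<iota> \<longleftrightarrow> Z \<in> Obj C \<and>
     (\<forall>d \<in> Obj D. \<iota> d \<in> hom C (X d) Z) \<and>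
     (\<forall>u \<in> Arr D. \<iota> (Cod D u) \<cdot>\<^bsub>C\<^esub> \<phi> u = \<iota> (Dom D u))"

definition is_colimit ::
  "('i, 'j, 'y) precat_scheme \<Rightarrow> ('o, 'm, 'x) precat_scheme \<Rightarrow> ('i \<Rightarrow> 'o) \<Rightarrow> ('j \<Rightarrow> 'm) \<Rightarrow>
    'o \<Rightarrow> ('i \<Rightarrow> 'm) \<Rightarrow> bool"
where
  "is_colimit D C X \<phi> Z \<iota> \<longleftrightarrow> is_cocone D C X \<phi> Z \<iota> \<and>
     (\<forall>Z' \<iota>'. is_cocone D C X \<phi> Z' \<iota>' \<longrightarrow>
       (\<exists>!h. h \<in> hom C Z Z' \<and> (\<forall>d \<in> Obj D. h \<cdot>\<^bsub>C\<^esub> \<iota> d = \<iota>' d)))"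

definition is_cone ::
  "('i, 'j, 'y) precat_scheme \<Rightarrow> ('o, 'm, 'x) precat_scheme \<Rightarrow> ('i \<Rightarrow> 'o) \<Rightarrow> ('j \<Rightarrow> 'm) \<Rightarrow>
    'o \<Rightarrow> ('i \<Rightarrow> 'm) \<Rightarrow> bool"
where
  "is_cone D C X \<phi> Z \<pi> \<longleftrightarrow> Z \<in> Obj C \<and>
     (\<forall>d \<in> Obj D. \<pi> d \<in> hom C Z (X d)) \<and>
     (\<forall>u \<in> Arr D. \<phi> u \<cdot>\<^bsub>C\<^esub> \<pi> (Dom D u) = \<pi> (Cod D u))"

definition is_limit ::
  "('i, 'j, 'y) precat_scheme \<Rightarrow> ('o, 'm, 'x) precat_scheme \<Rightarrow> ('i \<Rightarrow> 'o) \<Rightarrow> ('j \<Rightarrow> 'm) \<Rightarrow>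
    'o \<Rightarrow> ('i \<Rightarrow> 'm) \<Rightarrow> bool"
where
  "is_limit D C X \<phi> Z \<pi> \<longleftrightarrow> is_cone D C X \<phi> Z \<pi> \<and>
     (\<forall>Z' \<pi>'. is_cone D C X \<phi> Z' \<pi>' \<longrightarrow>
       (\<exists>!h. h \<in> hom C Z' Z \<and> (\<forall>d \<in> Obj D. \<pi> d \<cdot>\<^bsub>C\<^esub> h = \<pi>' d)))"

definition cocomplete :: "'u rel \<Rightarrow> ('o, 'm, 'x) precat_scheme \<Rightarrow> bool" where
  "cocomplete \<Theta> C \<longleftrightarrow> (\<forall>(D :: ('u, 'u) precat) X \<phi>.
     category D \<and> small \<Theta> (Obj D) \<and> small \<Theta> (Arr D) \<and> is_functor D C X \<phi> \<longrightarrow>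
     (\<exists>Z \<iota>. is_colimit D C X \<phi> Z \<iota>))"

definition complete :: "'u rel \<Rightarrow> ('o, 'm, 'x) precat_scheme \<Rightarrow> bool" where
  "complete \<Theta> C \<longleftrightarrow> (\<forall>(D :: ('u, 'u) precat) X \<phi>.
     category D \<and> small \<Theta> (Obj D) \<and> small \<Theta> (Arr D) \<and> is_functor D C X \<phi> \<longrightarrow>
     (\<exists>Z \<pi>. is_limit D C X \<phi> Z \<pi>))"

definition is_initial :: "('o, 'm, 'x) precat_scheme \<Rightarrow> 'o \<Rightarrow> bool" where
  "is_initial C E \<longleftrightarrow> E \<in> Obj C \<and> (\<forall>X \<in> Obj C. \<exists>!h. h \<in> hom C E X)"

definition is_coproduct ::
  "('o, 'm, 'x) precat_scheme \<Rightarrow> 'o \<Rightarrow> 'o \<Rightarrow> 'o \<Rightarrow> 'm \<Rightarrow> 'm \<Rightarrow> bool"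
where
  "is_coproduct C A B S i1 i2 \<longleftrightarrow> i1 \<in> hom C A S \<and> i2 \<in> hom C B S \<and>
     (\<forall>Z \<in> Obj C. \<forall>a \<in> hom C A Z. \<forall>b \<in> hom C B Z.
       \<exists>!h. h \<in> hom C S Z \<and> h \<cdot>\<^bsub>C\<^esub> i1 = a \<and> h \<cdot>\<^bsub>C\<^esub> i2 = b)"

text \<open>
  \<open>is_pushout C f g g' f'\<close>: \<open>g'\<close> goes out of the codomain of \<open>f\<close>, and \<open>f'\<close>, the push-out of \<open>f\<close>
  along \<open>g\<close>, goes out of the codomain of \<open>g\<close>. The convention for pull-backs is dual.
\<close>

definition is_pushout :: "('o, 'm, 'x) precat_scheme \<Rightarrow> 'm \<Rightarrow> 'm \<Rightarrow> 'm \<Rightarrow> 'm \<Rightarrow> bool" where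
  "is_pushout C f g g' f' \<longleftrightarrow>
     f \<in> Arr C \<and> g \<in> Arr C \<and> g' \<in> Arr C \<and> f' \<in> Arr C \<and>
     Dom C f = Dom C g \<and> Dom C g' = Cod C f \<and> Dom C f' = Cod C g \<and> Cod C g' = Cod C f' \<and>
     g' \<cdot>\<^bsub>C\<^esub> f = f' \<cdot>\<^bsub>C\<^esub> g \<and>
     (\<forall>Z \<in> Obj C. \<forall>a \<in> hom C (Cod C f) Z. \<forall>b \<in> hom C (Cod C g) Z. a \<cdot>\<^bsub>C\<^esub> f = b \<cdot>\<^bsub>C\<^esub> g \<longrightarrow>
       (\<exists>!h. h \<in> hom C (Cod C f') Z \<and> h \<cdot>\<^bsub>C\<^esub> g' = a \<and> h \<cdot>\<^bsub>C\<^esub> f' = b))"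

definition is_pullback :: "('o, 'm, 'x) precat_scheme \<Rightarrow> 'm \<Rightarrow> 'm \<Rightarrow> 'm \<Rightarrow> 'm \<Rightarrow> bool" where
  "is_pullback C f g g' f' \<longleftrightarrow>
     f \<in> Arr C \<and> g \<in> Arr C \<and> g' \<in> Arr C \<and> f' \<in> Arr C \<and>
     Cod C f = Cod C g \<and> Cod C g' = Dom C f \<and> Cod C f' = Dom C g \<and> Dom C g' = Dom C f' \<and>
     f \<cdot>\<^bsub>C\<^esub> g' = g \<cdot>\<^bsub>C\<^esub> f' \<and>
     (\<forall>Z \<in> Obj C. \<forall>a \<in> hom C Z (Dom C f). \<forall>b \<in> hom C Z (Dom C g). f \<cdot>\<^bsub>C\<^esub> a = g \<cdot>\<^bsub>C\<^esub> b \<longrightarrow>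
       (\<exists>!h. h \<in> hom C Z (Dom C f') \<and> g' \<cdot>\<^bsub>C\<^esub> h = a \<and> f' \<cdot>\<^bsub>C\<^esub> h = b))"

definition pushouts_of :: "('o, 'm, 'x) precat_scheme \<Rightarrow> 'm set \<Rightarrow> 'm set" where
  "pushouts_of C K = {f'. \<exists>f \<in> K. \<exists>g g'. is_pushout C f g g' f'}"


section \<open>Transfinite compositions and smallness\<close>

text \<open>
  A small ordinal is represented by a well-order \<open>r\<close> with small field, its elements being the
  elements of \<open>Field r\<close>; the initial segment below \<open>c\<close> is \<open>Restr r (underS r c)\<close>.
\<close>

definition order_category :: "'u rel \<Rightarrow> ('u, 'u \<times> 'u) precat" where
  "order_category r = \<lparr>Obj = Field r, Arr = r, Dom = fst, Cod = snd, Ident = (\<lambda>a. (a, a)),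
     Cmp = (\<lambda>v u. (fst u, snd v))\<rparr>"

definition least_elem :: "'u rel \<Rightarrow> 'u \<Rightarrow> bool" where
  "least_elem r a \<longleftrightarrow> a \<in> Field r \<and> underS r a = {}"

definition succ_elem :: "'u rel \<Rightarrow> 'u \<Rightarrow> 'u \<Rightarrow> bool" where
  "succ_elem r a b \<longleftrightarrow> a \<in> Field r \<and> b \<in> Field r \<and> underS r b = under r a"

definition limit_elem :: "'u rel \<Rightarrow> 'u \<Rightarrow> bool" where
  "limit_elem r c \<longleftrightarrow> c \<in> Field r \<and> \<not> least_elem r c \<and> \<not> (\<exists>a. succ_elem r a c)"

definition is_sequence ::
  "'u rel \<Rightarrow> ('o, 'm, 'x) precat_scheme \<Rightarrow> 'u rel \<Rightarrow> ('u \<Rightarrow> 'o) \<Rightarrow> ('u \<times> 'u \<Rightarrow> 'm) \<Rightarrow> bool"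
where
  "is_sequence \<Theta> C r X \<phi> \<longleftrightarrow> Well_order r \<and> small \<Theta> (Field r) \<and>
     is_functor (order_category r) C X \<phi> \<and>
     (\<forall>c. limit_elem r c \<longrightarrow>
       is_colimit (order_category (Restr r (underS r c))) C X \<phi> (X c) (\<lambda>b. \<phi> (b, c)))"

definition steps_in :: "'u rel \<Rightarrow> ('u \<times> 'u \<Rightarrow> 'm) \<Rightarrow> 'm set \<Rightarrow> bool" where
  "steps_in r \<phi> S \<longleftrightarrow> (\<forall>a b. succ_elem r a b \<longrightarrow> \<phi> (a, b) \<in> S)"

definition transfinite_compositions ::
  "'u rel \<Rightarrow> ('o, 'm, 'x) precat_scheme \<Rightarrow> 'm set \<Rightarrow> 'm set"
where
  "transfinite_compositions \<Theta> C S =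
     {f. \<exists>r X \<phi> Z \<iota> a. is_sequence \<Theta> C r X \<phi> \<and> steps_in r \<phi> S \<and>
        is_colimit (order_category r) C X \<phi> Z \<iota> \<and> least_elem r a \<and> f = \<iota> a}"

definition cell :: "'u rel \<Rightarrow> ('o, 'm, 'x) precat_scheme \<Rightarrow> 'm set \<Rightarrow> 'm set" where
  "cell \<Theta> C K = transfinite_compositions \<Theta> C (pushouts_of C K)"

definition filtered_ordinal :: "'u rel \<Rightarrow> 'u rel \<Rightarrow> bool" where
  "filtered_ordinal \<kappa> r \<longleftrightarrow> Well_order r \<and> Field r \<noteq> {} \<and>
     (\<forall>a \<in> Field r. \<exists>b. succ_elem r a b) \<and>
     (\<forall>A \<subseteq> Field r. |A| \<le>o \<kappa> \<longrightarrow> (\<exists>b \<in> Field r. \<forall>a \<in> A. (a, b) \<in> r))"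

text \<open>
  The last two conjuncts are surjectivity and injectivity of the canonical map from the filtered
  colimit of the sets \<open>hom C A (X b)\<close> to \<open>hom C A Z\<close>, where \<open>Z\<close> is the colimit of the sequence.
\<close>

definition cardinal_small_relative ::
  "'u rel \<Rightarrow> ('o, 'm, 'x) precat_scheme \<Rightarrow> 'u rel \<Rightarrow> 'o \<Rightarrow> 'm set \<Rightarrow> bool"
where
  "cardinal_small_relative \<Theta> C \<kappa> A S \<longleftrightarrow> A \<in> Obj C \<and>
     (\<forall>r X \<phi> Z \<iota>. filtered_ordinal \<kappa> r \<and> is_sequence \<Theta> C r X \<phi> \<and> steps_in r \<phi> S \<and>
        is_colimit (order_category r) C X \<phi> Z \<iota> \<longrightarrow>
        (\<forall>h \<in> hom C A Z. \<exists>b \<in> Field r. \<exists>g \<in> hom C A (X b). h = \<iota> b \<cdot>\<^bsub>C\<^esub> g) \<and>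
        (\<forall>b \<in> Field r. \<forall>b' \<in> Field r. \<forall>g \<in> hom C A (X b). \<forall>g' \<in> hom C A (X b').
           \<iota> b \<cdot>\<^bsub>C\<^esub> g = \<iota> b' \<cdot>\<^bsub>C\<^esub> g' \<longrightarrow>
           (\<exists>c. (b, c) \<in> r \<and> (b', c) \<in> r \<and> \<phi> (b, c) \<cdot>\<^bsub>C\<^esub> g = \<phi> (b', c) \<cdot>\<^bsub>C\<^esub> g')))"

definition small_relative ::
  "'u rel \<Rightarrow> ('o, 'm, 'x) precat_scheme \<Rightarrow> 'o \<Rightarrow> 'm set \<Rightarrow> bool"
where
  "small_relative \<Theta> C A S \<longleftrightarrow>
     (\<exists>\<kappa>. Card_order \<kappa> \<and> \<kappa> <o \<Theta> \<and> cardinal_small_relative \<Theta> C \<kappa> A S)"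


section \<open>Model categories\<close>

definition has_lift :: "('o, 'm, 'x) precat_scheme \<Rightarrow> 'm \<Rightarrow> 'm \<Rightarrow> bool" where
  "has_lift C i p \<longleftrightarrow> (\<forall>u \<in> hom C (Dom C i) (Dom C p). \<forall>v \<in> hom C (Cod C i) (Cod C p).
     p \<cdot>\<^bsub>C\<^esub> u = v \<cdot>\<^bsub>C\<^esub> i \<longrightarrow>
     (\<exists>h \<in> hom C (Cod C i) (Dom C p). h \<cdot>\<^bsub>C\<^esub> i = u \<and> p \<cdot>\<^bsub>C\<^esub> h = v))"

definition inj_class :: "('o, 'm, 'x) precat_scheme \<Rightarrow> 'm set \<Rightarrow> 'm set" where
  "inj_class C K = {p \<in> Arr C. \<forall>i \<in> K. has_lift C i p}"

definition wide_subcategory :: "('o, 'm, 'x) precat_scheme \<Rightarrow> 'm set \<Rightarrow> bool" where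
  "wide_subcategory C S \<longleftrightarrow> S \<subseteq> Arr C \<and> (\<forall>A \<in> Obj C. Ident C A \<in> S) \<and>
     (\<forall>f \<in> S. \<forall>g \<in> S. Cod C f = Dom C g \<longrightarrow> g \<cdot>\<^bsub>C\<^esub> f \<in> S)"

definition retract_of :: "('o, 'm, 'x) precat_scheme \<Rightarrow> 'm \<Rightarrow> 'm \<Rightarrow> bool" where
  "retract_of C f g \<longleftrightarrow> f \<in> Arr C \<and> g \<in> Arr C \<and>
     (\<exists>s \<in> hom C (Dom C f) (Dom C g). \<exists>r \<in> hom C (Dom C g) (Dom C f).
      \<exists>s' \<in> hom C (Cod C f) (Cod C g). \<exists>r' \<in> hom C (Cod C g) (Cod C f).
        r \<cdot>\<^bsub>C\<^esub> s = Ident C (Dom C f) \<and> r' \<cdot>\<^bsub>C\<^esub> s' = Ident C (Cod C f) \<and>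
        g \<cdot>\<^bsub>C\<^esub> s = s' \<cdot>\<^bsub>C\<^esub> f \<and> f \<cdot>\<^bsub>C\<^esub> r = r' \<cdot>\<^bsub>C\<^esub> g)"

definition retract_closed :: "('o, 'm, 'x) precat_scheme \<Rightarrow> 'm set \<Rightarrow> bool" where
  "retract_closed C S \<longleftrightarrow> (\<forall>f g. retract_of C f g \<and> g \<in> S \<longrightarrow> f \<in> S)"

locale model_category = category C
  for C :: "('o, 'm, 'x) precat_scheme" (structure) +
  fixes \<Theta> :: "'u rel" and W Cof Fib :: "'m set"
  assumes locally_small: "locally_small \<Theta> C"
    and complete: "complete \<Theta> C"
    and cocomplete: "cocomplete \<Theta> C"
    and W_subcategory: "wide_subcategory C W"
    and Cof_subcategory: "wide_subcategory C Cof"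
    and Fib_subcategory: "wide_subcategory C Fib"
    and two_of_three: "f \<in> Arr C \<Longrightarrow> g \<in> Arr C \<Longrightarrow> Cod C f = Dom C g \<Longrightarrow>
      f \<in> W \<and> g \<in> W \<or> f \<in> W \<and> g \<cdot> f \<in> W \<or> g \<in> W \<and> g \<cdot> f \<in> W \<Longrightarrow>
      f \<in> W \<and> g \<in> W \<and> g \<cdot> f \<in> W"
    and W_retract: "retract_closed C W"
    and Cof_retract: "retract_closed C Cof"
    and Fib_retract: "retract_closed C Fib"
    and lift_Cof: "i \<in> Cof \<Longrightarrow> p \<in> Fib \<inter> W \<Longrightarrow> has_lift C i p"
    and lift_Fib: "i \<in> Cof \<inter> W \<Longrightarrow> p \<in> Fib \<Longrightarrow> has_lift C i p"
    and factor_Cof: "f \<in> Arr C \<Longrightarrow>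
      \<exists>i \<in> Cof. \<exists>p \<in> Fib \<inter> W. Cod C i = Dom C p \<and> f = p \<cdot> i"
    and factor_Fib: "f \<in> Arr C \<Longrightarrow>
      \<exists>i \<in> Cof \<inter> W. \<exists>p \<in> Fib. Cod C i = Dom C p \<and> f = p \<cdot> i"

definition cofibrantly_generated ::
  "'u rel \<Rightarrow> ('o, 'm, 'x) precat_scheme \<Rightarrow> 'm set \<Rightarrow> 'm set \<Rightarrow> 'm set \<Rightarrow> 'm set \<Rightarrow> 'm set \<Rightarrow> bool"
where
  "cofibrantly_generated \<Theta> C W Cof Fib I J \<longleftrightarrow>
     I \<subseteq> Arr C \<and> J \<subseteq> Arr C \<and> small \<Theta> I \<and> small \<Theta> J \<and>
     (\<forall>f \<in> I. small_relative \<Theta> C (Dom C f) (cell \<Theta> C I)) \<and>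
     (\<forall>f \<in> J. small_relative \<Theta> C (Dom C f) (cell \<Theta> C J)) \<and>
     Fib = inj_class C J \<and> Fib \<inter> W = inj_class C I"

definition cofibrant :: "('o, 'm, 'x) precat_scheme \<Rightarrow> 'm set \<Rightarrow> 'o \<Rightarrow> bool" where
  "cofibrant C Cof X \<longleftrightarrow> X \<in> Obj C \<and> (\<exists>E. is_initial C E \<and> (\<exists>e \<in> hom C E X. e \<in> Cof))"

definition left_proper ::
  "('o, 'm, 'x) precat_scheme \<Rightarrow> 'm set \<Rightarrow> 'm set \<Rightarrow> bool"
where
  "left_proper C W Cof \<longleftrightarrow>
     (\<forall>w \<in> W. \<forall>i \<in> Cof. \<forall>i' w'. is_pushout C w i i' w' \<longrightarrow> w' \<in> W)"

definition right_proper ::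
  "('o, 'm, 'x) precat_scheme \<Rightarrow> 'm set \<Rightarrow> 'm set \<Rightarrow> bool"
where
  "right_proper C W Fib \<longleftrightarrow>
     (\<forall>w \<in> W. \<forall>p \<in> Fib. \<forall>p' w'. is_pullback C w p p' w' \<longrightarrow> w' \<in> W)"


section \<open>Monoidal model categories\<close>

record ('o, 'm) premoncat = "('o, 'm) precat" +
  Tobj :: "'o \<Rightarrow> 'o \<Rightarrow> 'o" (infixl "\<odot>\<index>" 70)
  Tarr :: "'m \<Rightarrow> 'm \<Rightarrow> 'm" (infixl "\<otimes>\<index>" 70)
  Unit :: 'o
  Assoc :: "'o \<Rightarrow> 'o \<Rightarrow> 'o \<Rightarrow> 'm"
  Lunit :: "'o \<Rightarrow> 'm"
  Runit :: "'o \<Rightarrow> 'm"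

locale monoidal_category = category M
  for M :: "('o, 'm, 'x) premoncat_scheme" (structure) +
  assumes Unit_Obj: "Unit M \<in> Obj M"
    and Tobj_Obj: "A \<in> Obj M \<Longrightarrow> B \<in> Obj M \<Longrightarrow> A \<odot> B \<in> Obj M"
    and Tarr_hom: "f \<in> hom M A B \<Longrightarrow> g \<in> hom M A' B' \<Longrightarrow> f \<otimes> g \<in> hom M (A \<odot> A') (B \<odot> B')"
    and Tarr_Ident: "A \<in> Obj M \<Longrightarrow> B \<in> Obj M \<Longrightarrow> Ident M A \<otimes> Ident M B = Ident M (A \<odot> B)"
    and Tarr_Cmp: "f \<in> hom M A B \<Longrightarrow> g \<in> hom M B D \<Longrightarrow> f' \<in> hom M A' B' \<Longrightarrow> g' \<in> hom M B' D' \<Longrightarrow>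
      (g \<cdot> f) \<otimes> (g' \<cdot> f') = (g \<otimes> g') \<cdot> (f \<otimes> f')"
    and Assoc_hom: "A \<in> Obj M \<Longrightarrow> B \<in> Obj M \<Longrightarrow> D \<in> Obj M \<Longrightarrow>
      Assoc M A B D \<in> hom M ((A \<odot> B) \<odot> D) (A \<odot> (B \<odot> D))"
    and Assoc_iso: "A \<in> Obj M \<Longrightarrow> B \<in> Obj M \<Longrightarrow> D \<in> Obj M \<Longrightarrow> iso_arr M (Assoc M A B D)"
    and Assoc_natural: "f \<in> hom M A A' \<Longrightarrow> g \<in> hom M B B' \<Longrightarrow> h \<in> hom M D D' \<Longrightarrow>
      Assoc M A' B' D' \<cdot> ((f \<otimes> g) \<otimes> h) = (f \<otimes> (g \<otimes> h)) \<cdot> Assoc M A B D"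
    and Lunit_hom: "A \<in> Obj M \<Longrightarrow> Lunit M A \<in> hom M (Unit M \<odot> A) A"
    and Lunit_iso: "A \<in> Obj M \<Longrightarrow> iso_arr M (Lunit M A)"
    and Lunit_natural: "f \<in> hom M A B \<Longrightarrow>
      Lunit M B \<cdot> (Ident M (Unit M) \<otimes> f) = f \<cdot> Lunit M A"
    and Runit_hom: "A \<in> Obj M \<Longrightarrow> Runit M A \<in> hom M (A \<odot> Unit M) A"
    and Runit_iso: "A \<in> Obj M \<Longrightarrow> iso_arr M (Runit M A)"
    and Runit_natural: "f \<in> hom M A B \<Longrightarrow>
      Runit M B \<cdot> (f \<otimes> Ident M (Unit M)) = f \<cdot> Runit M A"
    and pentagon: "A \<in> Obj M \<Longrightarrow> B \<in> Obj M \<Longrightarrow> D \<in> Obj M \<Longrightarrow> E \<in> Obj M \<Longrightarrow>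
      Assoc M A B (D \<odot> E) \<cdot> Assoc M (A \<odot> B) D E =
      (Ident M A \<otimes> Assoc M B D E) \<cdot> Assoc M A (B \<odot> D) E \<cdot> (Assoc M A B D \<otimes> Ident M E)"
    and triangle: "A \<in> Obj M \<Longrightarrow> B \<in> Obj M \<Longrightarrow>
      (Ident M A \<otimes> Lunit M B) \<cdot> Assoc M A (Unit M) B = Runit M A \<otimes> Ident M B"

text \<open>
  Closed (on both sides, as no symmetry is assumed): the functors \<open>- \<otimes> A\<close> and \<open>A \<otimes> -\<close> have right
  adjoints, expressed through universal evaluation morphisms. Hence they preserve colimits.
\<close>

locale closed_monoidal_category = monoidal_category M
  for M :: "('o, 'm, 'x) premoncat_scheme" (structure) +
  assumes closed_left: "A \<in> Obj M \<Longrightarrow> Z \<in> Obj M \<Longrightarrow>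
      \<exists>H \<in> Obj M. \<exists>ev \<in> hom M (H \<odot> A) Z. \<forall>B \<in> Obj M. \<forall>f \<in> hom M (B \<odot> A) Z.
        \<exists>!h. h \<in> hom M B H \<and> ev \<cdot> (h \<otimes> Ident M A) = f"
    and closed_right: "A \<in> Obj M \<Longrightarrow> Z \<in> Obj M \<Longrightarrow>
      \<exists>H \<in> Obj M. \<exists>ev \<in> hom M (A \<odot> H) Z. \<forall>B \<in> Obj M. \<forall>f \<in> hom M (A \<odot> B) Z.
        \<exists>!h. h \<in> hom M B H \<and> ev \<cdot> (Ident M A \<otimes> h) = f"

locale symmetric_monoidal_category = monoidal_category M
  for M :: "('o, 'm, 'x) premoncat_scheme" (structure) +
  fixes \<sigma> :: "'o \<Rightarrow> 'o \<Rightarrow> 'm"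
  assumes Sym_hom: "A \<in> Obj M \<Longrightarrow> B \<in> Obj M \<Longrightarrow> \<sigma> A B \<in> hom M (A \<odot> B) (B \<odot> A)"
    and Sym_natural: "f \<in> hom M A A' \<Longrightarrow> g \<in> hom M B B' \<Longrightarrow>
      \<sigma> A' B' \<cdot> (f \<otimes> g) = (g \<otimes> f) \<cdot> \<sigma> A B"
    and Sym_inverse: "A \<in> Obj M \<Longrightarrow> B \<in> Obj M \<Longrightarrow> \<sigma> B A \<cdot> \<sigma> A B = Ident M (A \<odot> B)"
    and hexagon: "A \<in> Obj M \<Longrightarrow> B \<in> Obj M \<Longrightarrow> D \<in> Obj M \<Longrightarrow>
      Assoc M B D A \<cdot> \<sigma> A (B \<odot> D) \<cdot> Assoc M A B D =
      (Ident M B \<otimes> \<sigma> A D) \<cdot> Assoc M B A D \<cdot> (\<sigma> A B \<otimes> Ident M D)"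

text \<open>
  For \<open>f : X \<rightarrow> Y\<close> and \<open>g : U \<rightarrow> V\<close>, \<open>is_pushout_product M f g h\<close> says that \<open>h\<close> is the morphism to
  \<open>Y \<odot> V\<close> induced by \<open>f \<otimes> V\<close> and \<open>Y \<otimes> g\<close> on some push-out of \<open>X \<odot> V \<leftarrow> X \<odot> U \<rightarrow> Y \<odot> U\<close>.
\<close>

definition is_pushout_product ::
  "('o, 'm, 'x) premoncat_scheme \<Rightarrow> 'm \<Rightarrow> 'm \<Rightarrow> 'm \<Rightarrow> bool"
where
  "is_pushout_product M f g h \<longleftrightarrow>
     (\<exists>k l. is_pushout M (Ident M (Dom M f) \<otimes>\<^bsub>M\<^esub> g) (f \<otimes>\<^bsub>M\<^esub> Ident M (Dom M g)) k l \<and>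
        h \<in> hom M (Cod M k) (Cod M f \<odot>\<^bsub>M\<^esub> Cod M g) \<and>
        h \<cdot>\<^bsub>M\<^esub> k = f \<otimes>\<^bsub>M\<^esub> Ident M (Cod M g) \<and>
        h \<cdot>\<^bsub>M\<^esub> l = Ident M (Cod M f) \<otimes>\<^bsub>M\<^esub> g)"

definition unit_resolution ::
  "('o, 'm, 'x) premoncat_scheme \<Rightarrow> 'm set \<Rightarrow> 'm set \<Rightarrow> 'm \<Rightarrow> bool"
where
  "unit_resolution M W Cof q \<longleftrightarrow> q \<in> W \<and> Cod M q = Unit M \<and> cofibrant M Cof (Dom M q)"

definition very_strong_unit_axiom ::
  "('o, 'm, 'x) premoncat_scheme \<Rightarrow> 'm set \<Rightarrow> 'm set \<Rightarrow> 'm \<Rightarrow> bool"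
where
  "very_strong_unit_axiom M W Cof q \<longleftrightarrow> unit_resolution M W Cof q \<and>
     (\<forall>X \<in> Obj M. q \<otimes>\<^bsub>M\<^esub> Ident M X \<in> W \<and> Ident M X \<otimes>\<^bsub>M\<^esub> q \<in> W)"

locale monoidal_model_category =
  closed_monoidal_category M + model_category M \<Theta> W Cof Fib
  for M :: "('o, 'm, 'x) premoncat_scheme" (structure)
    and \<Theta> :: "'u rel" and W Cof Fib :: "'m set" +
  assumes pushout_product: "f \<in> Cof \<Longrightarrow> g \<in> Cof \<Longrightarrow> is_pushout_product M f g h \<Longrightarrow>
      h \<in> Cof \<and> (f \<in> W \<or> g \<in> W \<longrightarrow> h \<in> W)"
    and unit_axiom: "\<exists>q. unit_resolution M W Cof q \<and>
      (\<forall>X. cofibrant M Cof X \<longrightarrow> q \<otimes> Ident M X \<in> W \<and> Ident M X \<otimes> q \<in> W)"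

definition monoid_axiom ::
  "'u rel \<Rightarrow> ('o, 'm, 'x) premoncat_scheme \<Rightarrow> 'm set \<Rightarrow> 'm set \<Rightarrow> bool"
where
  "monoid_axiom \<Theta> M W Cof \<longleftrightarrow>
     cell \<Theta> M {f \<otimes>\<^bsub>M\<^esub> Ident M X | f X. f \<in> Cof \<inter> W \<and> X \<in> Obj M} \<subseteq> W"

end

theory Submission
  imports Defs
begin

text \<open>
  Write \<open>T\<close> for the domain of \<open>q\<close>, \<open>1\<close> for the unit and \<open>k = j \<cdot> i1 : T \<rightarrow> C\<close>. The new fibrations \<open>Fib'\<close>
  are the arrows with the right lifting property against \<open>J \<union> {k}\<close>, and the new cofibrations \<open>Cof'\<close>
  are the arrows with the left lifting property against all arrows that have the right lifting
  property against \<open>I \<union> {e}\<close>. Two ideas make this a model structure.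

  First, the functor \<open>Q = T \<otimes> -\<close> compares the new structure with the old one. Since \<open>q \<otimes> A\<close> and
  \<open>q \<otimes> B\<close> are weak equivalences, an arrow \<open>f : A \<rightarrow> B\<close> is a weak equivalence if and only if
  \<open>Q f\<close> is one. As \<open>T\<close> is cofibrant, \<open>Q\<close> preserves cofibrations, and \<open>Q 1\<close>, being isomorphic to
  \<open>T\<close>, is cofibrant. So \<open>Q\<close> sends \<open>I \<union> {e}\<close> to cofibrations and \<open>J \<union> {k}\<close> to trivial cofibrations,
  and because it is a left adjoint the same holds for everything in \<open>Cof'\<close> and, respectively, for
  everything with the left lifting property against \<open>Fib'\<close> (\<open>resolving_Cof'\<close>,
  \<open>resolving_trivial_Cof'\<close>). In particular the latter arrows are weak equivalences, which is the
  crucial point for the existence of the structure. Every further assertion about weak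
  equivalences is reduced to the old structure in the same way: left properness, because \<open>Q\<close>
  preserves push-outs; the monoid axiom, because \<open>Q\<close> preserves relative cell complexes; and the
  push-out product axiom, because \<open>T \<otimes> h \<otimes> T\<close>, for \<open>h\<close> the push-out product of \<open>f\<close> and \<open>g\<close>, is the
  push-out product of \<open>T \<otimes> f\<close> and \<open>g \<otimes> T\<close> (\<open>tensor_pushout_product\<close>).

  Second, the factorizations are built from the old ones by attaching a single layer of cells.
  To factor \<open>X \<rightarrow> Y\<close> into a new cofibration and a new trivial fibration, adjoin to \<open>X\<close> one copy of
  \<open>1\<close> for every arrow \<open>1 \<rightarrow> Y\<close>, and then factor in the old structure (\<open>factor_Cof'\<close>). For the other
  factorization, factor \<open>X \<rightarrow> Z \<rightarrow> Y\<close> in the old structure, attach \<open>k\<close> to \<open>Z\<close> along all squares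
  from \<open>k\<close> to \<open>Z \<rightarrow> Y\<close>, and factor the result over \<open>Y\<close> once more as \<open>Z' \<rightarrow> Z'' \<rightarrow> Y\<close>
  (\<open>factor_Fib'\<close>). Here \<open>Z \<rightarrow> Z''\<close> is a weak equivalence between fibrations over \<open>Y\<close>, so that every
  arrow \<open>T \<rightarrow> Z''\<close> is homotopic over \<open>Y\<close> to one through \<open>Z\<close>; the lifts attached for the latter are
  moved along the homotopy, which is extended constantly over \<open>1\<close> because \<open>j : T \<amalg> 1 \<rightarrow> C\<close> is a
  cofibration (\<open>homotopy_lift\<close>).

  That \<open>Cof'\<close> is closed under push-out products follows from the adjunction between push-out
  products and pull-back powers (\<open>corner_lift_transpose\<close>), which allows to pass to
  \<open>Cof \<union> {e}\<close> in one variable after the other; the push-out product of \<open>e\<close> with \<open>g\<close> is isomorphic to \<open>g\<close>.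
\<close>

section \<open>Composition and lifting\<close>

context category
begin

lemma hom_iff: "f \<in> hom C A B \<longleftrightarrow> f \<in> Arr C \<and> Dom C f = A \<and> Cod C f = B"
  by (auto simp: hom_def)

lemma Cmp_typing [simp]:
  assumes "f \<in> Arr C" "g \<in> Arr C" "Cod C f = Dom C g"
  shows "g \<cdot> f \<in> Arr C" "Dom C (g \<cdot> f) = Dom C f" "Cod C (g \<cdot> f) = Cod C g"
  using Cmp_hom[of f "Dom C f" "Cod C f" g "Cod C g"] assms by (auto simp: hom_iff)

lemma Ident_typing [simp]:
  assumes "A \<in> Obj C"
  shows "Ident C A \<in> Arr C" "Dom C (Ident C A) = A" "Cod C (Ident C A) = A"
  using Ident_hom[OF assms] by (auto simp: hom_iff)

lemma Cmp_Ident [simp]: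
  assumes "f \<in> Arr C"
  shows "Cod C f = B \<Longrightarrow> Ident C B \<cdot> f = f" "Dom C f = A \<Longrightarrow> f \<cdot> Ident C A = f"
  using Cmp_Ident_left[of f "Dom C f" "Cod C f"] Cmp_Ident_right[of f "Dom C f" "Cod C f"] assms
  by (auto simp: hom_iff)

lemma assoc [simp]:
  assumes "f \<in> Arr C" "g \<in> Arr C" "h \<in> Arr C" "Cod C f = Dom C g" "Cod C g = Dom C h"
  shows "(h \<cdot> g) \<cdot> f = h \<cdot> (g \<cdot> f)"
  using Cmp_assoc[of f "Dom C f" "Cod C f" g "Cod C g" h "Cod C h"] assms by (auto simp: hom_iff)

lemma Dom_Cod_Obj [simp]: "f \<in> Arr C \<Longrightarrow> Dom C f \<in> Obj C" "f \<in> Arr C \<Longrightarrow> Cod C f \<in> Obj C"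
  using Dom_Obj Cod_Obj by auto

text \<open>With composites associated to the right, an equation between composites of two arrows is
  applied inside a longer composite in the following form.\<close>

lemma Cmp_eq_extend:
  assumes "g \<cdot> f = g' \<cdot> f'"
    and "f \<in> Arr C" "g \<in> Arr C" "Cod C f = Dom C g" "f' \<in> Arr C" "g' \<in> Arr C" "Cod C f' = Dom C g'"
    and "x \<in> Arr C" "Cod C x = Dom C f"
  shows "g \<cdot> (f \<cdot> x) = g' \<cdot> (f' \<cdot> x)"
proof -
  have "Dom C (g' \<cdot> f') = Dom C (g \<cdot> f)" using assms(1) by simp
  then have "Dom C f' = Dom C f" using assms(2-) by simp
  then show ?thesis
    using assms assoc[of x f g] assoc[of x f' g'] by simp
qed

lemma Cmp_eq_collapse:
  assumes "g \<cdot> f = k"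
    and "f \<in> Arr C" "g \<in> Arr C" "Cod C f = Dom C g"
    and "x \<in> Arr C" "Cod C x = Dom C f"
  shows "g \<cdot> (f \<cdot> x) = k \<cdot> x"
  using assms assoc[of x f g] by simp

lemma iso_arrE:
  assumes "iso_arr C f"
  obtains g where "f \<in> Arr C" "g \<in> Arr C" "Dom C g = Cod C f" "Cod C g = Dom C f"
    "g \<cdot> f = Ident C (Dom C f)" "f \<cdot> g = Ident C (Cod C f)"
  using assms by (auto simp: iso_arr_def hom_iff)

lemma iso_arrI:
  assumes "f \<in> Arr C" "g \<in> Arr C" "Dom C g = Cod C f" "Cod C g = Dom C f"
    "g \<cdot> f = Ident C (Dom C f)" "f \<cdot> g = Ident C (Cod C f)"
  shows "iso_arr C f"
  using assms by (auto simp: iso_arr_def hom_iff)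

lemma iso_arr_Ident: "A \<in> Obj C \<Longrightarrow> iso_arr C (Ident C A)"
  by (rule iso_arrI[of _ "Ident C A"]) auto

lemma iso_arr_Cmp:
  assumes "iso_arr C f" "iso_arr C g" "Cod C f = Dom C g"
  shows "iso_arr C (g \<cdot> f)"
proof (rule iso_arrE[OF assms(1)], rule iso_arrE[OF assms(2)])
  fix f' g'
  assume f: "f \<in> Arr C" "f' \<in> Arr C" "Dom C f' = Cod C f" "Cod C f' = Dom C f"
      "f' \<cdot> f = Ident C (Dom C f)" "f \<cdot> f' = Ident C (Cod C f)"
    and g: "g \<in> Arr C" "g' \<in> Arr C" "Dom C g' = Cod C g" "Cod C g' = Dom C g"
      "g' \<cdot> g = Ident C (Dom C g)" "g \<cdot> g' = Ident C (Cod C g)"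
  show ?thesis
  proof (rule iso_arrI[of _ "f' \<cdot> g'"])
    show "(f' \<cdot> g') \<cdot> (g \<cdot> f) = Ident C (Dom C (g \<cdot> f))"
      using Cmp_eq_collapse[OF g(5), of f] f g assms(3) by simp
    show "(g \<cdot> f) \<cdot> (f' \<cdot> g') = Ident C (Cod C (g \<cdot> f))"
      using Cmp_eq_collapse[OF f(6), of g'] f g assms(3) by simp
  qed (use f g assms(3) in auto)
qed

lemma has_liftI:
  assumes "\<And>u v. \<lbrakk>u \<in> Arr C; v \<in> Arr C; Dom C u = Dom C i; Cod C u = Dom C p; Dom C v = Cod C i;
      Cod C v = Cod C p; p \<cdot> u = v \<cdot> i\<rbrakk> \<Longrightarrow>
      \<exists>h. h \<in> Arr C \<and> Dom C h = Cod C i \<and> Cod C h = Dom C p \<and> h \<cdot> i = u \<and> p \<cdot> h = v"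
  shows "has_lift C i p"
  unfolding has_lift_def using assms by (fastforce simp: hom_iff)

lemma has_liftE:
  assumes "has_lift C i p" "u \<in> Arr C" "v \<in> Arr C" "Dom C u = Dom C i" "Cod C u = Dom C p"
    "Dom C v = Cod C i" "Cod C v = Cod C p" "p \<cdot> u = v \<cdot> i"
  obtains h where "h \<in> Arr C" "Dom C h = Cod C i" "Cod C h = Dom C p" "h \<cdot> i = u" "p \<cdot> h = v"
proof -
  have "u \<in> hom C (Dom C i) (Dom C p)" "v \<in> hom C (Cod C i) (Cod C p)"
    using assms by (auto simp: hom_iff)
  then obtain h where "h \<in> hom C (Cod C i) (Dom C p)" "h \<cdot> i = u" "p \<cdot> h = v"
    using assms(1,8) unfolding has_lift_def by blast
  then show thesis using that by (auto simp: hom_iff)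
qed

end

definition llp :: "('o, 'm, 'x) precat_scheme \<Rightarrow> 'm set \<Rightarrow> 'm set" where
  "llp C P = {i \<in> Arr C. \<forall>p \<in> P. has_lift C i p}"

context category
begin

lemma has_lift_Cmp_left:
  assumes "has_lift C f p" "has_lift C g p" "f \<in> Arr C" "g \<in> Arr C" "Cod C f = Dom C g" "p \<in> Arr C"
  shows "has_lift C (g \<cdot> f) p"
proof (rule has_liftI)
  fix u v assume uv: "u \<in> Arr C" "v \<in> Arr C" "Dom C u = Dom C (g \<cdot> f)" "Cod C u = Dom C p"
    "Dom C v = Cod C (g \<cdot> f)" "Cod C v = Cod C p" "p \<cdot> u = v \<cdot> (g \<cdot> f)"
  obtain h where h: "h \<in> Arr C" "Dom C h = Cod C f" "Cod C h = Dom C p" "h \<cdot> f = u" "p \<cdot> h = v \<cdot> g"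
    by (rule has_liftE[OF assms(1), of u "v \<cdot> g"]) (use uv assms in auto)
  obtain k where k: "k \<in> Arr C" "Dom C k = Cod C g" "Cod C k = Dom C p" "k \<cdot> g = h" "p \<cdot> k = v"
    by (rule has_liftE[OF assms(2), of h v]) (use uv assms h in auto)
  have "k \<cdot> (g \<cdot> f) = u"
    using Cmp_eq_collapse[OF k(4)] k assms h by simp
  then show "\<exists>h. h \<in> Arr C \<and> Dom C h = Cod C (g \<cdot> f) \<and> Cod C h = Dom C p \<and> h \<cdot> (g \<cdot> f) = u \<and> p \<cdot> h = v"
    using k assms by auto
qed

lemma has_lift_Cmp_right:
  assumes "has_lift C i f" "has_lift C i g" "f \<in> Arr C" "g \<in> Arr C" "Cod C f = Dom C g" "i \<in> Arr C"
  shows "has_lift C i (g \<cdot> f)"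
proof (rule has_liftI)
  fix u v assume uv: "u \<in> Arr C" "v \<in> Arr C" "Dom C u = Dom C i" "Cod C u = Dom C (g \<cdot> f)"
    "Dom C v = Cod C i" "Cod C v = Cod C (g \<cdot> f)" "(g \<cdot> f) \<cdot> u = v \<cdot> i"
  obtain h where h: "h \<in> Arr C" "Dom C h = Cod C i" "Cod C h = Dom C g" "h \<cdot> i = f \<cdot> u" "g \<cdot> h = v"
    by (rule has_liftE[OF assms(2), of "f \<cdot> u" v]) (use uv assms in auto)
  obtain k where k: "k \<in> Arr C" "Dom C k = Cod C i" "Cod C k = Dom C f" "k \<cdot> i = u" "f \<cdot> k = h"
    by (rule has_liftE[OF assms(1), of u h]) (use uv assms h in auto)
  show "\<exists>h. h \<in> Arr C \<and> Dom C h = Cod C i \<and> Cod C h = Dom C (g \<cdot> f) \<and> h \<cdot> i = u \<and> (g \<cdot> f) \<cdot> h = v"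
    using k assms h by (intro exI[of _ k]) auto
qed

lemma retract_ofI:
  assumes "f \<in> Arr C" "g \<in> Arr C"
    "s \<in> Arr C" "Dom C s = Dom C f" "Cod C s = Dom C g"
    "r \<in> Arr C" "Dom C r = Dom C g" "Cod C r = Dom C f"
    "s' \<in> Arr C" "Dom C s' = Cod C f" "Cod C s' = Cod C g"
    "r' \<in> Arr C" "Dom C r' = Cod C g" "Cod C r' = Cod C f"
    and "r \<cdot> s = Ident C (Dom C f)" "r' \<cdot> s' = Ident C (Cod C f)"
    and "g \<cdot> s = s' \<cdot> f" "f \<cdot> r = r' \<cdot> g"
  shows "retract_of C f g"
proof -
  have "s \<in> hom C (Dom C f) (Dom C g)" "r \<in> hom C (Dom C g) (Dom C f)"
    "s' \<in> hom C (Cod C f) (Cod C g)" "r' \<in> hom C (Cod C g) (Cod C f)"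
    using assms by (simp_all add: hom_iff)
  then show ?thesis using assms(1,2,15-18) unfolding retract_of_def by blast
qed

lemma retract_ofE:
  assumes "retract_of C f g"
  obtains s r s' r' where "f \<in> Arr C" "g \<in> Arr C"
    "s \<in> Arr C" "Dom C s = Dom C f" "Cod C s = Dom C g"
    "r \<in> Arr C" "Dom C r = Dom C g" "Cod C r = Dom C f"
    "s' \<in> Arr C" "Dom C s' = Cod C f" "Cod C s' = Cod C g"
    "r' \<in> Arr C" "Dom C r' = Cod C g" "Cod C r' = Cod C f"
    "r \<cdot> s = Ident C (Dom C f)" "r' \<cdot> s' = Ident C (Cod C f)"
    "g \<cdot> s = s' \<cdot> f" "f \<cdot> r = r' \<cdot> g"
  using assms unfolding retract_of_def by (auto simp: hom_iff)

lemma has_lift_retract_left: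
  assumes "retract_of C f g" "has_lift C g p" "p \<in> Arr C"
  shows "has_lift C f p"
proof (rule retract_ofE[OF assms(1)], rule has_liftI)
  fix s r s' r' u v
  assume t: "f \<in> Arr C" "g \<in> Arr C"
    "s \<in> Arr C" "Dom C s = Dom C f" "Cod C s = Dom C g"
    "r \<in> Arr C" "Dom C r = Dom C g" "Cod C r = Dom C f"
    "s' \<in> Arr C" "Dom C s' = Cod C f" "Cod C s' = Cod C g"
    "r' \<in> Arr C" "Dom C r' = Cod C g" "Cod C r' = Cod C f"
    and e: "r \<cdot> s = Ident C (Dom C f)" "r' \<cdot> s' = Ident C (Cod C f)"
    "g \<cdot> s = s' \<cdot> f" "f \<cdot> r = r' \<cdot> g"
    and uv: "u \<in> Arr C" "v \<in> Arr C" "Dom C u = Dom C f" "Cod C u = Dom C p" "Dom C v = Cod C f"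
      "Cod C v = Cod C p" "p \<cdot> u = v \<cdot> f"
  have "p \<cdot> (u \<cdot> r) = v \<cdot> (f \<cdot> r)"
    by (rule Cmp_eq_extend[OF uv(7)]) (use t uv assms in auto)
  then have pu: "p \<cdot> (u \<cdot> r) = (v \<cdot> r') \<cdot> g" using t e uv by simp
  obtain h where h: "h \<in> Arr C" "Dom C h = Cod C g" "Cod C h = Dom C p"
      "h \<cdot> g = u \<cdot> r" "p \<cdot> h = v \<cdot> r'"
    by (rule has_liftE[OF assms(2), of "u \<cdot> r" "v \<cdot> r'"]) (use t uv pu assms in auto)
  have "(h \<cdot> s') \<cdot> f = h \<cdot> (g \<cdot> s)" using t h e by simp
  also have "\<dots> = (u \<cdot> r) \<cdot> s" by (rule Cmp_eq_collapse[OF h(4)]) (use t h in auto)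
  also have "\<dots> = u" using t uv e by simp
  finally have "(h \<cdot> s') \<cdot> f = u" .
  moreover have "p \<cdot> (h \<cdot> s') = (v \<cdot> r') \<cdot> s'"
    by (rule Cmp_eq_collapse[OF h(5)]) (use t h assms in auto)
  then have "p \<cdot> (h \<cdot> s') = v" using t uv e by simp
  ultimately show "\<exists>h. h \<in> Arr C \<and> Dom C h = Cod C f \<and> Cod C h = Dom C p \<and> h \<cdot> f = u \<and> p \<cdot> h = v"
    using t h by (intro exI[of _ "h \<cdot> s'"]) simp
qed

lemma has_lift_retract_right:
  assumes "retract_of C f g" "has_lift C i g" "i \<in> Arr C"
  shows "has_lift C i f"
proof (rule retract_ofE[OF assms(1)], rule has_liftI)
  fix s r s' r' u v
  assume t: "f \<in> Arr C" "g \<in> Arr C"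
    "s \<in> Arr C" "Dom C s = Dom C f" "Cod C s = Dom C g"
    "r \<in> Arr C" "Dom C r = Dom C g" "Cod C r = Dom C f"
    "s' \<in> Arr C" "Dom C s' = Cod C f" "Cod C s' = Cod C g"
    "r' \<in> Arr C" "Dom C r' = Cod C g" "Cod C r' = Cod C f"
    and e: "r \<cdot> s = Ident C (Dom C f)" "r' \<cdot> s' = Ident C (Cod C f)"
    "g \<cdot> s = s' \<cdot> f" "f \<cdot> r = r' \<cdot> g"
    and uv: "u \<in> Arr C" "v \<in> Arr C" "Dom C u = Dom C i" "Cod C u = Dom C f" "Dom C v = Cod C i"
      "Cod C v = Cod C f" "f \<cdot> u = v \<cdot> i"
  have "g \<cdot> (s \<cdot> u) = s' \<cdot> (f \<cdot> u)"
    by (rule Cmp_eq_extend[OF e(3)]) (use t uv in auto)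
  then have pu: "g \<cdot> (s \<cdot> u) = (s' \<cdot> v) \<cdot> i" using t uv assms by simp
  obtain h where h: "h \<in> Arr C" "Dom C h = Cod C i" "Cod C h = Dom C g"
      "h \<cdot> i = s \<cdot> u" "g \<cdot> h = s' \<cdot> v"
    by (rule has_liftE[OF assms(2), of "s \<cdot> u" "s' \<cdot> v"]) (use t uv pu assms in auto)
  have "(r \<cdot> h) \<cdot> i = r \<cdot> (s \<cdot> u)" using t h assms by simp
  also have "\<dots> = Ident C (Dom C f) \<cdot> u" by (rule Cmp_eq_collapse[OF e(1)]) (use t uv in auto)
  also have "\<dots> = u" using t uv by simp
  finally have hi: "(r \<cdot> h) \<cdot> i = u" .
  have "f \<cdot> (r \<cdot> h) = r' \<cdot> (g \<cdot> h)"
    by (rule Cmp_eq_extend[OF e(4)]) (use t h in auto)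
  then have "f \<cdot> (r \<cdot> h) = r' \<cdot> (s' \<cdot> v)" using h by simp
  also have "\<dots> = Ident C (Cod C f) \<cdot> v" by (rule Cmp_eq_collapse[OF e(2)]) (use t uv in auto)
  also have "\<dots> = v" using uv t by simp
  finally have "f \<cdot> (r \<cdot> h) = v" .
  with hi show "\<exists>h. h \<in> Arr C \<and> Dom C h = Cod C i \<and> Cod C h = Dom C f \<and> h \<cdot> i = u \<and> f \<cdot> h = v"
    using t h by (intro exI[of _ "r \<cdot> h"]) simp
qed

lemma has_lift_Ident_left:
  assumes "A \<in> Obj C" "p \<in> Arr C"
  shows "has_lift C (Ident C A) p"
  by (rule has_liftI) (use assms in auto)

lemma has_lift_Ident_right:
  assumes "A \<in> Obj C" "i \<in> Arr C"
  shows "has_lift C i (Ident C A)"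
proof (rule has_liftI)
  fix u v assume "u \<in> Arr C" "v \<in> Arr C" "Dom C u = Dom C i" "Cod C u = Dom C (Ident C A)"
    "Dom C v = Cod C i" "Cod C v = Cod C (Ident C A)" "Ident C A \<cdot> u = v \<cdot> i"
  then show "\<exists>h. h \<in> Arr C \<and> Dom C h = Cod C i \<and> Cod C h = Dom C (Ident C A) \<and> h \<cdot> i = u \<and> Ident C A \<cdot> h = v"
    using assms by (intro exI[of _ v]) auto
qed

lemma llp_wide_subcategory:
  assumes "P \<subseteq> Arr C"
  shows "wide_subcategory C (llp C P)"
  using assms has_lift_Cmp_left has_lift_Ident_left
  unfolding wide_subcategory_def llp_def by (auto simp: subset_iff)

lemma inj_class_wide_subcategory:
  assumes "K \<subseteq> Arr C"
  shows "wide_subcategory C (inj_class C K)"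
  using assms has_lift_Cmp_right has_lift_Ident_right
  unfolding wide_subcategory_def inj_class_def by (auto simp: subset_iff)

lemma llp_retract_closed:
  assumes "P \<subseteq> Arr C"
  shows "retract_closed C (llp C P)"
  using assms has_lift_retract_left unfolding retract_closed_def llp_def
  by (auto simp: subset_iff elim: retract_ofE)

lemma inj_class_retract_closed:
  assumes "K \<subseteq> Arr C"
  shows "retract_closed C (inj_class C K)"
  using assms has_lift_retract_right unfolding retract_closed_def inj_class_def
  by (auto simp: subset_iff elim: retract_ofE)

text \<open>The retract argument: a lift in the square formed by \<open>i\<close>, \<open>p\<close> and the identity exhibits
  \<open>p \<cdot> i\<close> as a retract of \<open>i\<close>.\<close>

lemma retract_argument:
  assumes "i \<in> Arr C" "p \<in> Arr C" "Cod C i = Dom C p" "has_lift C (p \<cdot> i) p"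
  shows "retract_of C (p \<cdot> i) i"
proof -
  obtain h where h: "h \<in> Arr C" "Dom C h = Cod C p" "Cod C h = Dom C p"
      "h \<cdot> (p \<cdot> i) = i" "p \<cdot> h = Ident C (Cod C p)"
    by (rule has_liftE[OF assms(4), of i "Ident C (Cod C p)"]) (use assms in auto)
  then show ?thesis
    using assms by (intro retract_ofI[of _ _ "Ident C (Dom C i)" "Ident C (Dom C i)" h p]) simp_all
qed

text \<open>Isomorphic arrows are retracts of each other; this is how isomorphism invariance of classes
  of arrows is used.\<close>

lemma retract_of_iso_square:
  assumes "f \<in> Arr C" "g \<in> Arr C"
    and "x \<in> hom C (Dom C f) (Dom C g)" "iso_arr C x"
    and "y \<in> hom C (Cod C f) (Cod C g)" "iso_arr C y"
    and "g \<cdot> x = y \<cdot> f"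
  shows "retract_of C f g" "retract_of C g f"
proof -
  obtain x' where x': "x' \<in> Arr C" "Dom C x' = Dom C g" "Cod C x' = Dom C f"
      "x' \<cdot> x = Ident C (Dom C f)" "x \<cdot> x' = Ident C (Dom C g)"
    using assms(3,4) by (auto simp: iso_arr_def hom_iff)
  obtain y' where y': "y' \<in> Arr C" "Dom C y' = Cod C g" "Cod C y' = Cod C f"
      "y' \<cdot> y = Ident C (Cod C f)" "y \<cdot> y' = Ident C (Cod C g)"
    using assms(5,6) by (auto simp: iso_arr_def hom_iff)
  note t = assms(1,2) assms(3)[unfolded hom_iff] assms(5)[unfolded hom_iff] x'(1-3) y'(1-3)
  have "y' \<cdot> (g \<cdot> (x \<cdot> x')) = y' \<cdot> (y \<cdot> (f \<cdot> x'))"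
    using Cmp_eq_extend[OF assms(7), of x'] t by simp
  also have "\<dots> = Ident C (Cod C f) \<cdot> (f \<cdot> x')"
    by (rule Cmp_eq_collapse[OF y'(4)]) (use t in auto)
  finally have *: "f \<cdot> x' = y' \<cdot> g" using t x' by simp
  show "retract_of C f g"
    by (rule retract_ofI[of _ _ x x' y y']) (use t x' y' assms(7) * in simp_all)
  show "retract_of C g f"
    by (rule retract_ofI[of _ _ x' x y' y]) (use t x' y' assms(7) * in simp_all)
qed

lemma initial_homE:
  assumes "is_initial C E" "X \<in> Obj C"
  obtains h where "h \<in> hom C E X"
  using assms unfolding is_initial_def by blast

lemma initial_hom_eq:
  assumes "is_initial C E" "f \<in> hom C E X" "g \<in> hom C E X"
  shows "f = g"
proof -
  have "X \<in> Obj C" using assms(2) by (auto simp: hom_iff)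
  then show ?thesis using assms unfolding is_initial_def by blast
qed

lemma has_lift_initialI:
  assumes "is_initial C (Dom C i)" "i \<in> Arr C" "p \<in> Arr C"
    and "\<And>v. v \<in> hom C (Cod C i) (Cod C p) \<Longrightarrow> \<exists>h \<in> hom C (Cod C i) (Dom C p). p \<cdot> h = v"
  shows "has_lift C i p"
proof (rule has_liftI)
  fix u v assume uv: "u \<in> Arr C" "v \<in> Arr C" "Dom C u = Dom C i" "Cod C u = Dom C p"
    "Dom C v = Cod C i" "Cod C v = Cod C p" "p \<cdot> u = v \<cdot> i"
  then obtain h where h: "h \<in> hom C (Cod C i) (Dom C p)" "p \<cdot> h = v"
    using assms(4)[of v] by (auto simp: hom_iff)
  have "h \<cdot> i = u"
    by (rule initial_hom_eq[OF assms(1), of _ "Dom C p"]) (use uv h assms in \<open>auto simp: hom_iff\<close>)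
  then show "\<exists>h. h \<in> Arr C \<and> Dom C h = Cod C i \<and> Cod C h = Dom C p \<and> h \<cdot> i = u \<and> p \<cdot> h = v"
    using h by (auto simp: hom_iff)
qed

end

context model_category
begin

lemma W_Arr: "f \<in> W \<Longrightarrow> f \<in> Arr C"
  and Cof_Arr: "f \<in> Cof \<Longrightarrow> f \<in> Arr C"
  and Fib_Arr: "f \<in> Fib \<Longrightarrow> f \<in> Arr C"
  using W_subcategory Cof_subcategory Fib_subcategory by (auto simp: wide_subcategory_def)

lemma W_Cmp: "f \<in> W \<Longrightarrow> g \<in> W \<Longrightarrow> Cod C f = Dom C g \<Longrightarrow> g \<cdot> f \<in> W"
  and Fib_Cmp: "f \<in> Fib \<Longrightarrow> g \<in> Fib \<Longrightarrow> Cod C f = Dom C g \<Longrightarrow> g \<cdot> f \<in> Fib"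
  and W_Ident: "A \<in> Obj C \<Longrightarrow> Ident C A \<in> W"
  using W_subcategory Cof_subcategory Fib_subcategory by (auto simp: wide_subcategory_def)

lemma W_cancel_left:
  "f \<in> Arr C \<Longrightarrow> g \<in> W \<Longrightarrow> g \<cdot> f \<in> W \<Longrightarrow> Cod C f = Dom C g \<Longrightarrow> f \<in> W"
  using two_of_three[of f g] W_Arr by blast

lemma W_cancel_right:
  "f \<in> W \<Longrightarrow> g \<in> Arr C \<Longrightarrow> g \<cdot> f \<in> W \<Longrightarrow> Cod C f = Dom C g \<Longrightarrow> g \<in> W"
  using two_of_three[of f g] W_Arr by blast

text \<open>Retract arguments: both classes can be recognized by lifting, which is how membership in them is
  proved below.\<close>

lemma Cof_eq_llp: "Cof = llp C (Fib \<inter> W)"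
proof
  show "Cof \<subseteq> llp C (Fib \<inter> W)" using lift_Cof Cof_Arr by (auto simp: llp_def)
  show "llp C (Fib \<inter> W) \<subseteq> Cof"
  proof
    fix f assume f: "f \<in> llp C (Fib \<inter> W)"
    then obtain i p where ip: "i \<in> Cof" "p \<in> Fib \<inter> W" "Cod C i = Dom C p" "f = p \<cdot> i"
      using factor_Cof[of f] by (auto simp: llp_def)
    then have "retract_of C f i"
      using f retract_argument[of i p] Cof_Arr Fib_Arr by (auto simp: llp_def)
    then show "f \<in> Cof" using ip Cof_retract by (auto simp: retract_closed_def)
  qed
qed

lemma trivial_Cof_eq_llp: "Cof \<inter> W = llp C Fib"
proof
  show "Cof \<inter> W \<subseteq> llp C Fib" using lift_Fib Cof_Arr by (auto simp: llp_def)
  show "llp C Fib \<subseteq> Cof \<inter> W"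
  proof
    fix f assume f: "f \<in> llp C Fib"
    then obtain i p where ip: "i \<in> Cof \<inter> W" "p \<in> Fib" "Cod C i = Dom C p" "f = p \<cdot> i"
      using factor_Fib[of f] by (auto simp: llp_def)
    then have "retract_of C f i"
      using f retract_argument[of i p] Cof_Arr Fib_Arr by (auto simp: llp_def)
    then show "f \<in> Cof \<inter> W" using ip Cof_retract W_retract by (auto simp: retract_closed_def)
  qed
qed

lemma cofibrant_lift:
  assumes "cofibrant C Cof X" "p \<in> Fib \<inter> W" "v \<in> hom C X (Cod C p)"
  shows "\<exists>h \<in> hom C X (Dom C p). p \<cdot> h = v"
proof -
  obtain E e where E: "is_initial C E" "e \<in> hom C E X" "e \<in> Cof"
    using assms(1) by (auto simp: cofibrant_def)
  have p: "p \<in> Arr C" using assms(2) Fib_Arr by auto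
  then obtain u where u: "u \<in> hom C E (Dom C p)" using E(1) unfolding is_initial_def by force
  have "p \<cdot> u = v \<cdot> e"
    by (rule initial_hom_eq[OF E(1), of _ "Cod C p"]) (use p u E assms in \<open>auto simp: hom_iff\<close>)
  then obtain h where "h \<in> Arr C" "Dom C h = Cod C e" "Cod C h = Dom C p" "p \<cdot> h = v"
    by (rule has_liftE[OF lift_Cof[OF E(3) assms(2)], rotated 6])
      (use p u E(2) assms(3) in \<open>auto simp: hom_iff\<close>)
  then show ?thesis using E(2) by (auto simp: hom_iff)
qed

end

section \<open>Small diagrams and attaching cells\<close>

lemma small_imp_inj:
  assumes "universe (\<Theta> :: 'u rel)" "small \<Theta> A"
  obtains f :: "'a \<Rightarrow> 'u" where "inj_on f A"
proof -
  have "|A| \<le>o \<Theta>" using assms(2) by (simp add: small_def ordLess_imp_ordLeq)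
  moreover have "\<Theta> =o |Field \<Theta>|"
    using assms(1) card_of_Field_ordIso ordIso_symmetric by (auto simp: universe_def)
  ultimately have "|A| \<le>o |Field \<Theta>|" by (rule ordLeq_ordIso_trans)
  then show ?thesis using that unfolding card_of_ordLeq[symmetric] by auto
qed

lemma small_image: "small \<Theta> A \<Longrightarrow> small \<Theta> (f ` A)"
  unfolding small_def by (rule ordLeq_ordLess_trans[OF card_of_image])

lemma small_subset: "small \<Theta> B \<Longrightarrow> A \<subseteq> B \<Longrightarrow> small \<Theta> A"
  unfolding small_def by (rule ordLeq_ordLess_trans[OF card_of_mono1])

lemma universe_infinite: "universe \<Theta> \<Longrightarrow> \<not> finite (Field \<Theta>)"
  unfolding universe_def
  by (metis Card_order_iff_ordLeq_card_of card_of_ordLeq_finite natLeq_Card_order ordLess_imp_ordLeq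
      Field_natLeq infinite_UNIV_nat card_of_Field_ordIso ordIso_symmetric
      ordIso_ordLeq_trans ordLeq_ordIso_trans)

lemma small_finite:
  assumes "universe \<Theta>" "finite A"
  shows "small \<Theta> A"
  unfolding small_def
proof (rule finite_ordLess_infinite)
  show "Well_order \<Theta>" using assms(1) by (auto simp: universe_def card_order_on_def)
qed (use assms universe_infinite in \<open>auto simp: Field_card_of card_of_well_order_on\<close>)

lemma small_Un: "universe \<Theta> \<Longrightarrow> small \<Theta> A \<Longrightarrow> small \<Theta> B \<Longrightarrow> small \<Theta> (A \<union> B)"
  unfolding small_def
  using card_of_Un_ordLess_infinite_Field universe_infinite universe_def by blast

lemma small_Times:
  fixes A :: "'a set" and B :: "'b set"
  assumes "universe \<Theta>" "small \<Theta> A" "small \<Theta> B"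
  shows "small \<Theta> (A \<times> B)"
proof -
  define S :: "('a + 'b) set" where "S = Inl ` A \<union> Inr ` B"
  have S: "small \<Theta> S" unfolding S_def by (intro small_Un small_image assms)
  have "small \<Theta> (S \<times> S)"
  proof (cases "finite S")
    case True
    then show ?thesis by (intro small_finite[OF assms(1)] finite_cartesian_product)
  next
    case False
    then have "|S \<times> S| =o |S|" by (rule card_of_Times_same_infinite)
    then show ?thesis using S unfolding small_def by (rule ordIso_ordLess_trans)
  qed
  then have "small \<Theta> (map_prod projl projr ` (S \<times> S))" by (rule small_image)
  moreover have "A \<times> B \<subseteq> map_prod projl projr ` (S \<times> S)"
  proof
    fix x assume "x \<in> A \<times> B"
    then have "(Inl (fst x), Inr (snd x)) \<in> S \<times> S" by (auto simp: S_def)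
    then show "x \<in> map_prod projl projr ` (S \<times> S)" by (rule rev_image_eqI) simp
  qed
  ultimately show ?thesis by (rule small_subset)
qed

text \<open>Completeness and cocompleteness speak of diagrams indexed by categories on the type \<open>'u\<close>. A small
  diagram of another type is moved there along injections of its objects and arrows.\<close>

lemma small_reindexing:
  fixes D :: "('i, 'j, 'y) precat_scheme" and \<Theta> :: "'u rel"
  assumes "universe \<Theta>" "category D" "small \<Theta> (Obj D)" "small \<Theta> (Arr D)" "is_functor D C X \<phi>"
  obtains D' :: "('u, 'u) precat" and s t X' \<phi>' where
    "category D'" "small \<Theta> (Obj D')" "small \<Theta> (Arr D')" "is_functor D' C X' \<phi>'"
    "Obj D' = s ` Obj D" "inj_on s (Obj D)" "Arr D' = t ` Arr D"
    "\<And>d. d \<in> Obj D \<Longrightarrow> X' (s d) = X d"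
    "\<And>u. u \<in> Arr D \<Longrightarrow> \<phi>' (t u) = \<phi> u"
    "\<And>u. u \<in> Arr D \<Longrightarrow> Dom D' (t u) = s (Dom D u)"
    "\<And>u. u \<in> Arr D \<Longrightarrow> Cod D' (t u) = s (Cod D u)"
proof -
  interpret D: category D by fact
  obtain s :: "'i \<Rightarrow> 'u" where s: "inj_on s (Obj D)" by (rule small_imp_inj[OF assms(1,3)])
  obtain t :: "'j \<Rightarrow> 'u" where t: "inj_on t (Arr D)" by (rule small_imp_inj[OF assms(1,4)])
  define s' where "s' = inv_into (Obj D) s"
  define t' where "t' = inv_into (Arr D) t"
  have s' [simp]: "s' (s d) = d" if "d \<in> Obj D" for d using s that by (simp add: s'_def)
  have t' [simp]: "t' (t u) = u" if "u \<in> Arr D" for u using t that by (simp add: t'_def)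
  define D' :: "('u, 'u) precat" where
    "D' = \<lparr>Obj = s ` Obj D, Arr = t ` Arr D, Dom = (\<lambda>u. s (Dom D (t' u))),
      Cod = (\<lambda>u. s (Cod D (t' u))), Ident = (\<lambda>a. t (Ident D (s' a))),
      Cmp = (\<lambda>v u. t (t' v \<cdot>\<^bsub>D\<^esub> t' u))\<rparr>"
  have seq [simp]: "s a = s b \<longleftrightarrow> a = b" if "a \<in> Obj D" "b \<in> Obj D" for a b
    using s that by (auto simp: inj_on_def)
  have teq [simp]: "t a = t b \<longleftrightarrow> a = b" if "a \<in> Arr D" "b \<in> Arr D" for a b
    using t that by (auto simp: inj_on_def)
  have cat: "category D'"
    by unfold_locales (auto simp: D'_def hom_def)
  have func: "is_functor D' C (X \<circ> s') (\<phi> \<circ> t')"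
    using assms(5) unfolding is_functor_def by (auto simp: D'_def)
  show thesis
    by (rule that[OF cat _ _ func, of s t]) (simp_all add: D'_def s small_image assms)
qed

context category
begin

lemma small_colimit_exists:
  fixes D :: "('i, 'j, 'y) precat_scheme" and \<Theta> :: "'u rel"
  assumes "universe \<Theta>" "cocomplete \<Theta> C"
    and "category D" "small \<Theta> (Obj D)" "small \<Theta> (Arr D)" "is_functor D C X \<phi>"
  shows "\<exists>Z \<iota>. is_colimit D C X \<phi> Z \<iota>"
proof (rule small_reindexing[OF assms(1,3-6)])
  fix D' :: "('u, 'u) precat" and s t X' \<phi>'
  assume D': "category D'" "small \<Theta> (Obj D')" "small \<Theta> (Arr D')" "is_functor D' C X' \<phi>'"
    and st: "Obj D' = s ` Obj D" "inj_on s (Obj D)" "Arr D' = t ` Arr D"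
    and r: "\<And>d. d \<in> Obj D \<Longrightarrow> X' (s d) = X d"
    "\<And>u. u \<in> Arr D \<Longrightarrow> \<phi>' (t u) = \<phi> u"
    "\<And>u. u \<in> Arr D \<Longrightarrow> Dom D' (t u) = s (Dom D u)"
    "\<And>u. u \<in> Arr D \<Longrightarrow> Cod D' (t u) = s (Cod D u)"
  interpret D: category D by fact
  obtain Z \<iota> where Z: "is_colimit D' C X' \<phi>' Z \<iota>"
    using assms(2) D' unfolding cocomplete_def by blast
  have cocone: "is_cocone D' C X' \<phi>' Z' \<iota>' \<longleftrightarrow> is_cocone D C X \<phi> Z' (\<iota>' \<circ> s)" for Z' \<iota>'
    unfolding is_cocone_def st using r by auto
  have "is_colimit D C X \<phi> Z (\<iota> \<circ> s)"
    unfolding is_colimit_def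
  proof (intro conjI allI impI)
    show "is_cocone D C X \<phi> Z (\<iota> \<circ> s)" using Z cocone by (simp add: is_colimit_def)
    fix Z' \<iota>' assume c: "is_cocone D C X \<phi> Z' \<iota>'"
    define \<kappa> where "\<kappa> = \<iota>' \<circ> inv_into (Obj D) s"
    have \<kappa>: "\<kappa> (s d) = \<iota>' d" if "d \<in> Obj D" for d using st(2) that by (simp add: \<kappa>_def)
    have "is_cocone D' C X' \<phi>' Z' \<kappa>"
      unfolding cocone using c unfolding is_cocone_def by (simp add: \<kappa>)
    then have "\<exists>!h. h \<in> hom C Z Z' \<and> (\<forall>d\<in>Obj D'. h \<cdot> \<iota> d = \<kappa> d)"
      using Z by (simp add: is_colimit_def)
    then show "\<exists>!h. h \<in> hom C Z Z' \<and> (\<forall>d\<in>Obj D. h \<cdot> (\<iota> \<circ> s) d = \<iota>' d)"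
      unfolding st by (simp add: \<kappa>)
  qed
  then show ?thesis by blast
qed

lemma small_limit_exists:
  fixes D :: "('i, 'j, 'y) precat_scheme" and \<Theta> :: "'u rel"
  assumes "universe \<Theta>" "complete \<Theta> C"
    and "category D" "small \<Theta> (Obj D)" "small \<Theta> (Arr D)" "is_functor D C X \<phi>"
  shows "\<exists>Z \<pi>. is_limit D C X \<phi> Z \<pi>"
proof (rule small_reindexing[OF assms(1,3-6)])
  fix D' :: "('u, 'u) precat" and s t X' \<phi>'
  assume D': "category D'" "small \<Theta> (Obj D')" "small \<Theta> (Arr D')" "is_functor D' C X' \<phi>'"
    and st: "Obj D' = s ` Obj D" "inj_on s (Obj D)" "Arr D' = t ` Arr D"
    and r: "\<And>d. d \<in> Obj D \<Longrightarrow> X' (s d) = X d"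
    "\<And>u. u \<in> Arr D \<Longrightarrow> \<phi>' (t u) = \<phi> u"
    "\<And>u. u \<in> Arr D \<Longrightarrow> Dom D' (t u) = s (Dom D u)"
    "\<And>u. u \<in> Arr D \<Longrightarrow> Cod D' (t u) = s (Cod D u)"
  interpret D: category D by fact
  obtain Z \<iota> where Z: "is_limit D' C X' \<phi>' Z \<iota>"
    using assms(2) D' unfolding complete_def by blast
  have cone: "is_cone D' C X' \<phi>' Z' \<iota>' \<longleftrightarrow> is_cone D C X \<phi> Z' (\<iota>' \<circ> s)" for Z' \<iota>'
    unfolding is_cone_def st using r by auto
  have "is_limit D C X \<phi> Z (\<iota> \<circ> s)"
    unfolding is_limit_def
  proof (intro conjI allI impI)
    show "is_cone D C X \<phi> Z (\<iota> \<circ> s)" using Z cone by (simp add: is_limit_def)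
    fix Z' \<iota>' assume c: "is_cone D C X \<phi> Z' \<iota>'"
    define \<kappa> where "\<kappa> = \<iota>' \<circ> inv_into (Obj D) s"
    have \<kappa>: "\<kappa> (s d) = \<iota>' d" if "d \<in> Obj D" for d using st(2) that by (simp add: \<kappa>_def)
    have "is_cone D' C X' \<phi>' Z' \<kappa>"
      unfolding cone using c unfolding is_cone_def by (simp add: \<kappa>)
    then have "\<exists>!h. h \<in> hom C Z' Z \<and> (\<forall>d\<in>Obj D'. \<iota> d \<cdot> h = \<kappa> d)"
      using Z by (simp add: is_limit_def)
    then show "\<exists>!h. h \<in> hom C Z' Z \<and> (\<forall>d\<in>Obj D. (\<iota> \<circ> s) d \<cdot> h = \<iota>' d)"
      unfolding st by (simp add: \<kappa>)
  qed
  then show ?thesis by blast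
qed

end

lemma order_category_category:
  assumes "refl_on (Field r) r" "trans r"
  shows "category (order_category r)"
  using assms
  by unfold_locales (auto simp: order_category_def hom_def refl_on_def dest: transD intro: FieldI1 FieldI2)

lemma Well_order_category:
  assumes "Well_order r"
  shows "category (order_category r)"
proof (rule order_category_category)
  show "refl_on (Field r) r" "trans r"
    using assms by (auto simp: well_order_on_def linear_order_on_def partial_order_on_def preorder_on_def)
qed

text \<open>The shape of the diagrams \<open>Z \<leftarrow> A t \<rightarrow> B t\<close>, with \<open>t\<close> ranging over \<open>T\<close> and \<open>Z\<close> in common.\<close>

datatype 't span_vertex = Base | Src 't | Tgt 't

definition span_shape :: "'t set \<Rightarrow> 't span_vertex rel" where
  "span_shape T = Id_on (insert Base (Src ` T \<union> Tgt ` T)) \<union>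
     (\<lambda>t. (Src t, Base)) ` T \<union> (\<lambda>t. (Src t, Tgt t)) ` T"

lemma Field_span_shape: "Field (span_shape T) = insert Base (Src ` T \<union> Tgt ` T)"
  by (auto simp: span_shape_def Field_def)

lemma span_shape_category: "category (order_category (span_shape T))"
proof (rule order_category_category)
  show "refl_on (Field (span_shape T)) (span_shape T)"
    unfolding Field_span_shape by (auto simp: refl_on_def span_shape_def)
  show "trans (span_shape T)" by (auto simp: trans_def span_shape_def)
qed

lemma cospan_shape_category: "category (order_category ((span_shape T)\<inverse>))"
proof (rule order_category_category)
  show "refl_on (Field ((span_shape T)\<inverse>)) ((span_shape T)\<inverse>)"
    unfolding Field_converse Field_span_shape by (auto simp: refl_on_def span_shape_def)
  show "trans ((span_shape T)\<inverse>)" by (auto simp: trans_def span_shape_def)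
qed

lemma small_span_shape:
  assumes "universe \<Theta>" "small \<Theta> T"
  shows "small \<Theta> (Field (span_shape T))" "small \<Theta> (span_shape T)" "small \<Theta> ((span_shape T)\<inverse>)"
proof -
  let ?F = "Field (span_shape T)"
  have "?F = {Base} \<union> (Src ` T \<union> Tgt ` T)" by (auto simp: Field_span_shape)
  then show F: "small \<Theta> ?F"
    using assms small_Un small_image small_finite by (metis finite.emptyI finite_insert)
  have "span_shape T \<subseteq> ?F \<times> ?F" "(span_shape T)\<inverse> \<subseteq> ?F \<times> ?F" by (auto simp: Field_def)
  then show "small \<Theta> (span_shape T)" "small \<Theta> ((span_shape T)\<inverse>)"
    using small_subset[OF small_Times[OF assms(1) F F]] by auto
qed

context category
begin

text \<open>Attaching a small family of arrows \<open>k t\<close> to an object \<open>Z\<close> along arrows \<open>a t\<close>: this is the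
  only kind of cell complex that the factorizations need. Arrows out of the result \<open>Z1\<close>
  are described by their restrictions to \<open>Z\<close> and to the codomains of the \<open>k t\<close>.\<close>

lemma attachment:
  fixes \<Theta> :: "'u rel" and k a :: "'t \<Rightarrow> 'm"
  assumes "universe \<Theta>" "cocomplete \<Theta> C" "small \<Theta> T" "Z \<in> Obj C"
    and "\<And>t. t \<in> T \<Longrightarrow> k t \<in> Arr C" "\<And>t. t \<in> T \<Longrightarrow> a t \<in> hom C (Dom C (k t)) Z"
  obtains Z1 z b where "z \<in> hom C Z Z1" "\<And>t. t \<in> T \<Longrightarrow> b t \<in> hom C (Cod C (k t)) Z1"
    "\<And>t. t \<in> T \<Longrightarrow> b t \<cdot> k t = z \<cdot> a t"
    "\<And>Y y c. \<lbrakk>y \<in> hom C Z Y; \<And>t. t \<in> T \<Longrightarrow> c t \<in> hom C (Cod C (k t)) Y;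
       \<And>t. t \<in> T \<Longrightarrow> c t \<cdot> k t = y \<cdot> a t\<rbrakk> \<Longrightarrow>
       \<exists>h. h \<in> hom C Z1 Y \<and> h \<cdot> z = y \<and> (\<forall>t \<in> T. h \<cdot> b t = c t)"
    "\<And>Y g h. \<lbrakk>g \<in> hom C Z1 Y; h \<in> hom C Z1 Y; g \<cdot> z = h \<cdot> z;
       \<And>t. t \<in> T \<Longrightarrow> g \<cdot> b t = h \<cdot> b t\<rbrakk> \<Longrightarrow> g = h"
proof -
  let ?r = "span_shape T"
  define X where "X v = (case v of Base \<Rightarrow> Z | Src t \<Rightarrow> Dom C (k t) | Tgt t \<Rightarrow> Cod C (k t))" for v
  define \<phi> where "\<phi> = (\<lambda>(v, w). if v = w then Ident C (X v) else
    case v of Src t \<Rightarrow> (case w of Base \<Rightarrow> a t | _ \<Rightarrow> k t) | _ \<Rightarrow> undefined)"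
  have ka: "k t \<in> Arr C" "a t \<in> Arr C" "Dom C (a t) = Dom C (k t)" "Cod C (a t) = Z" if "t \<in> T" for t
    using assms that by (auto simp: hom_iff)
  have r: "(v, w) \<in> ?r \<longleftrightarrow> v = w \<and> v \<in> Field ?r \<or> (\<exists>t \<in> T. v = Src t \<and> (w = Base \<or> w = Tgt t))" for v w
    unfolding Field_span_shape by (auto simp: span_shape_def)
  have X: "X v \<in> Obj C" if "v \<in> Field ?r" for v
    using that ka assms(4) by (auto simp: Field_span_shape X_def)
  have id: "\<phi> (v, v) = Ident C (X v)" for v by (simp add: \<phi>_def)
  have \<phi>: "\<phi> (v, w) \<in> hom C (X v) (X w)" if vw: "(v, w) \<in> ?r" for v w
    using vw[unfolded r]
  proof (elim disjE conjE bexE)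
    assume "v = w" "v \<in> Field ?r" then show ?thesis using X id by (simp add: hom_iff)
  qed (use ka in \<open>simp_all add: \<phi>_def hom_iff X_def\<close>)
  have F: "is_functor (order_category ?r) C X \<phi>"
    unfolding is_functor_def order_category_def
  proof (simp add: X id, intro conjI ballI)
    fix u assume "u \<in> ?r"
    then obtain v w where u: "u = (v, w)" "(v, w) \<in> ?r" by (cases u) auto
    then show "\<phi> u \<in> hom C (X (fst u)) (X (snd u))" using \<phi> by simp
    fix v' assume "v' \<in> ?r"
    then obtain w' x where v': "v' = (w', x)" "(w', x) \<in> ?r" by (cases v') auto
    show "snd u = fst v' \<longrightarrow> \<phi> (fst u, snd v') = \<phi> v' \<cdot> \<phi> u"
    proof
      assume w: "snd u = fst v'"
      then have "v = w \<or> w = x" using u v' unfolding r by auto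
      then show "\<phi> (fst u, snd v') = \<phi> v' \<cdot> \<phi> u"
        using u v' w \<phi>[OF u(2)] \<phi>[OF v'(2)] by (elim disjE) (simp_all add: id hom_iff)
    qed
  qed
  obtain Z1 \<iota> where col: "is_colimit (order_category ?r) C X \<phi> Z1 \<iota>"
    using small_colimit_exists[OF assms(1,2) span_shape_category _ _ F]
      small_span_shape[OF assms(1,3)] by (auto simp: order_category_def)
  then have cc: "is_cocone (order_category ?r) C X \<phi> Z1 \<iota>" by (simp add: is_colimit_def)
  have vert: "Base \<in> Field ?r" "t \<in> T \<Longrightarrow> Src t \<in> Field ?r" "t \<in> T \<Longrightarrow> Tgt t \<in> Field ?r" for t
    by (auto simp: Field_span_shape)
  have \<iota>: "\<iota> v \<in> hom C (X v) Z1" if "v \<in> Field ?r" for v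
    using cc that by (auto simp: is_cocone_def order_category_def)
  have nat: "\<iota> w \<cdot> \<phi> (v, w) = \<iota> v" if "(v, w) \<in> ?r" for v w
    using cc that unfolding is_cocone_def order_category_def by force
  have edge: "\<iota> Base \<cdot> a t = \<iota> (Src t)" "\<iota> (Tgt t) \<cdot> k t = \<iota> (Src t)" if "t \<in> T" for t
    using nat[of "Src t" Base] nat[of "Src t" "Tgt t"] that by (auto simp: r \<phi>_def)
  have Z1: "Z1 \<in> Obj C" using cc by (auto simp: is_cocone_def)
  have ex1: "\<exists>!h. h \<in> hom C Z1 Y \<and> (\<forall>d \<in> Field ?r. h \<cdot> \<iota> d = \<kappa> d)"
    if "is_cocone (order_category ?r) C X \<phi> Y \<kappa>" for Y \<kappa>
    using col that by (auto simp: is_colimit_def order_category_def)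
  have t: "\<iota> Base \<in> Arr C" "Dom C (\<iota> Base) = Z" "Cod C (\<iota> Base) = Z1" 
    "t \<in> T \<Longrightarrow> \<iota> (Tgt t) \<in> Arr C" "t \<in> T \<Longrightarrow> Dom C (\<iota> (Tgt t)) = Cod C (k t)" 
    "t \<in> T \<Longrightarrow> Cod C (\<iota> (Tgt t)) = Z1" for t
    using \<iota>[OF vert(1)] \<iota>[OF vert(3)[of t]] by (auto simp: hom_iff X_def)
  show thesis
  proof (rule that[of "\<iota> Base" Z1 "\<iota> \<circ> Tgt"])
    show "\<iota> Base \<in> hom C Z Z1" using t by (auto simp: hom_iff)
    show "(\<iota> \<circ> Tgt) t \<in> hom C (Cod C (k t)) Z1" if "t \<in> T" for t using t that by (auto simp: hom_iff)
    show "(\<iota> \<circ> Tgt) t \<cdot> k t = \<iota> Base \<cdot> a t" if "t \<in> T" for t using edge that by simp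
  next
    fix Y y c assume y: "y \<in> hom C Z Y" and c: "\<And>t. t \<in> T \<Longrightarrow> c t \<in> hom C (Cod C (k t)) Y"
      and e: "\<And>t. t \<in> T \<Longrightarrow> c t \<cdot> k t = y \<cdot> a t"
    define \<kappa> where "\<kappa> v = (case v of Base \<Rightarrow> y | Src t \<Rightarrow> y \<cdot> a t | Tgt t \<Rightarrow> c t)" for v
    have y': "y \<in> Arr C" "Dom C y = Z" "Cod C y = Y" "Y \<in> Obj C" using y by (auto simp: hom_iff)
    have c': "c t \<in> Arr C" "Dom C (c t) = Cod C (k t)" "Cod C (c t) = Y" if "t \<in> T" for t
      using c that by (auto simp: hom_iff)
    have "is_cocone (order_category ?r) C X \<phi> Y \<kappa>"
      unfolding is_cocone_def order_category_def
    proof (simp add: y', intro conjI ballI)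
      show "\<kappa> d \<in> hom C (X d) Y" if "d \<in> Field ?r" for d
        using that y' c' ka unfolding Field_span_shape
        by (elim insertE UnE imageE) (simp_all add: \<kappa>_def X_def hom_iff)
      then have id': "\<kappa> v \<cdot> Ident C (X v) = \<kappa> v" if "v \<in> Field ?r" for v
        using that by (simp add: hom_iff)
      fix u assume "u \<in> ?r"
      then obtain v w where u: "u = (v, w)" "(v, w) \<in> ?r" by (cases u) auto
      show "\<kappa> (snd u) \<cdot> \<phi> u = \<kappa> (fst u)"
        using u(2)[unfolded r]
      proof (elim disjE conjE bexE)
        assume "v = w" "v \<in> Field ?r" then show ?thesis using u id id' by simp
      qed (use u e in \<open>simp_all add: \<kappa>_def \<phi>_def\<close>)
    qed
    then obtain h where h: "h \<in> hom C Z1 Y" "\<forall>d \<in> Field ?r. h \<cdot> \<iota> d = \<kappa> d" using ex1 by blast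
    then show "\<exists>h. h \<in> hom C Z1 Y \<and> h \<cdot> \<iota> Base = y \<and> (\<forall>t\<in>T. h \<cdot> (\<iota> \<circ> Tgt) t = c t)"
      using vert by (intro exI[of _ h]) (auto simp: \<kappa>_def)
  next
    fix Y g h assume gh: "g \<in> hom C Z1 Y" "h \<in> hom C Z1 Y" "g \<cdot> \<iota> Base = h \<cdot> \<iota> Base"
      "\<And>t. t \<in> T \<Longrightarrow> g \<cdot> (\<iota> \<circ> Tgt) t = h \<cdot> (\<iota> \<circ> Tgt) t"
    have h': "h \<in> Arr C" "Dom C h = Z1" "Cod C h = Y" "g \<in> Arr C" "Dom C g = Z1" "Cod C g = Y" "Y \<in> Obj C"
      using gh by (auto simp: hom_iff)
    have S: "g \<cdot> \<iota> (Src t) = h \<cdot> \<iota> (Src t)" if "t \<in> T" for t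
      unfolding edge(1)[OF that, symmetric]
      by (rule Cmp_eq_extend[OF gh(3)]) (use h' t ka that in auto)
    have "is_cocone (order_category ?r) C X \<phi> Y (\<lambda>d. h \<cdot> \<iota> d)"
      unfolding is_cocone_def order_category_def
    proof (simp add: h', intro conjI ballI)
      fix d assume "d \<in> Field ?r" then show "h \<cdot> \<iota> d \<in> hom C (X d) Y"
        using \<iota>[of d] h' by (auto simp: hom_iff)
    next
      fix u assume "u \<in> ?r"
      then obtain v w where u: "u = (v, w)" "(v, w) \<in> ?r" by (cases u) auto
      then have vw: "v \<in> Field ?r" "w \<in> Field ?r" by (auto simp: Field_def)
      have "\<phi> u \<in> hom C (X v) (X w)" using F u unfolding is_functor_def order_category_def by force
      then have "(h \<cdot> \<iota> w) \<cdot> \<phi> u = h \<cdot> (\<iota> w \<cdot> \<phi> u)" using h' \<iota>[OF vw(2)] by (simp add: hom_iff)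
      then show "(h \<cdot> \<iota> (snd u)) \<cdot> \<phi> u = h \<cdot> \<iota> (fst u)" using nat u by simp
    qed
    then have "\<exists>!k. k \<in> hom C Z1 Y \<and> (\<forall>d \<in> Field ?r. k \<cdot> \<iota> d = h \<cdot> \<iota> d)" by (rule ex1)
    moreover have "\<forall>d \<in> Field ?r. g \<cdot> \<iota> d = h \<cdot> \<iota> d"
      using gh S by (auto simp: Field_span_shape)
    ultimately show "g = h" using gh(1,2) by blast
  qed
qed

text \<open>A lift is assembled from lifts on the cells. That it also lifts the lower side of the square
  follows from uniqueness of arrows out of \<open>Z1\<close>.\<close>

lemma attachment_llp:
  fixes \<Theta> :: "'u rel" and k a :: "'t \<Rightarrow> 'm"
  assumes "universe \<Theta>" "cocomplete \<Theta> C" "small \<Theta> T" "Z \<in> Obj C" "P \<subseteq> Arr C"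
    and "\<And>t. t \<in> T \<Longrightarrow> k t \<in> llp C P" "\<And>t. t \<in> T \<Longrightarrow> a t \<in> hom C (Dom C (k t)) Z"
  obtains Z1 z b where "z \<in> hom C Z Z1" "z \<in> llp C P"
    "\<And>t. t \<in> T \<Longrightarrow> b t \<in> hom C (Cod C (k t)) Z1"
    "\<And>t. t \<in> T \<Longrightarrow> b t \<cdot> k t = z \<cdot> a t"
    "\<And>Y y c. \<lbrakk>y \<in> hom C Z Y; \<And>t. t \<in> T \<Longrightarrow> c t \<in> hom C (Cod C (k t)) Y;
       \<And>t. t \<in> T \<Longrightarrow> c t \<cdot> k t = y \<cdot> a t\<rbrakk> \<Longrightarrow>
       \<exists>h. h \<in> hom C Z1 Y \<and> h \<cdot> z = y \<and> (\<forall>t \<in> T. h \<cdot> b t = c t)"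
proof -
  have k: "k t \<in> Arr C" if "t \<in> T" for t using assms(6) that by (auto simp: llp_def)
  obtain Z1 z b where z: "z \<in> hom C Z Z1" and b: "\<And>t. t \<in> T \<Longrightarrow> b t \<in> hom C (Cod C (k t)) Z1"
    and bk: "\<And>t. t \<in> T \<Longrightarrow> b t \<cdot> k t = z \<cdot> a t"
    and ex: "\<And>Y y c. \<lbrakk>y \<in> hom C Z Y; \<And>t. t \<in> T \<Longrightarrow> c t \<in> hom C (Cod C (k t)) Y;
       \<And>t. t \<in> T \<Longrightarrow> c t \<cdot> k t = y \<cdot> a t\<rbrakk> \<Longrightarrow>
       \<exists>h. h \<in> hom C Z1 Y \<and> h \<cdot> z = y \<and> (\<forall>t \<in> T. h \<cdot> b t = c t)"
    and un: "\<And>Y g h. \<lbrakk>g \<in> hom C Z1 Y; h \<in> hom C Z1 Y; g \<cdot> z = h \<cdot> z;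
       \<And>t. t \<in> T \<Longrightarrow> g \<cdot> b t = h \<cdot> b t\<rbrakk> \<Longrightarrow> g = h"
    by (rule attachment[OF assms(1-4) k assms(7)]) blast+
  have "has_lift C z p" if p: "p \<in> P" for p
  proof (rule has_liftI)
    fix u v assume uv: "u \<in> Arr C" "v \<in> Arr C" "Dom C u = Dom C z" "Cod C u = Dom C p"
      "Dom C v = Cod C z" "Cod C v = Cod C p" "p \<cdot> u = v \<cdot> z"
    have pA: "p \<in> Arr C" using assms(5) p by auto
    have "\<exists>c. c \<in> Arr C \<and> Dom C c = Cod C (k t) \<and> Cod C c = Dom C p \<and> c \<cdot> k t = u \<cdot> a t \<and>
        p \<cdot> c = v \<cdot> b t" if t: "t \<in> T" for t
    proof -
      note ty = z[unfolded hom_iff] b[OF t, unfolded hom_iff] assms(7)[OF t, unfolded hom_iff] k[OF t] pA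
      have "p \<cdot> (u \<cdot> a t) = v \<cdot> (z \<cdot> a t)"
        by (rule Cmp_eq_extend[OF uv(7)]) (use ty uv in auto)
      also have "\<dots> = (v \<cdot> b t) \<cdot> k t" using ty uv bk[OF t] by simp
      finally have "p \<cdot> (u \<cdot> a t) = (v \<cdot> b t) \<cdot> k t" .
      moreover have "has_lift C (k t) p" using assms(6)[OF t] p by (simp add: llp_def)
      ultimately show ?thesis
        using ty uv by (elim has_liftE[of "k t" p "u \<cdot> a t" "v \<cdot> b t"]) auto
    qed
    then obtain c where c: "\<And>t. t \<in> T \<Longrightarrow> c t \<in> Arr C \<and> Dom C (c t) = Cod C (k t) \<and>
        Cod C (c t) = Dom C p \<and> c t \<cdot> k t = u \<cdot> a t \<and> p \<cdot> c t = v \<cdot> b t" by metis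
    obtain h where h: "h \<in> hom C Z1 (Dom C p)" "h \<cdot> z = u" "\<And>t. t \<in> T \<Longrightarrow> h \<cdot> b t = c t"
      using ex[of u "Dom C p" c] uv z c by (auto simp: hom_iff)
    note ty = z[unfolded hom_iff] h(1)[unfolded hom_iff] pA uv(1-6)
    have "p \<cdot> h = v"
    proof (rule un)
      show "p \<cdot> h \<in> hom C Z1 (Cod C p)" "v \<in> hom C Z1 (Cod C p)" using ty by (auto simp: hom_iff)
      show "(p \<cdot> h) \<cdot> z = v \<cdot> z" using ty uv h by simp
      show "(p \<cdot> h) \<cdot> b t = v \<cdot> b t" if "t \<in> T" for t
        using ty h(3)[OF that] c[OF that] b[OF that, unfolded hom_iff] by simp
    qed
    then show "\<exists>h. h \<in> Arr C \<and> Dom C h = Cod C z \<and> Cod C h = Dom C p \<and> h \<cdot> z = u \<and> p \<cdot> h = v"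
      using h z by (auto simp: hom_iff)
  qed
  then have "z \<in> llp C P" using z by (auto simp: llp_def hom_iff)
  then show thesis using that z b bk ex by blast
qed

lemma pullback_exists:
  fixes \<Theta> :: "'u rel"
  assumes "universe \<Theta>" "complete \<Theta> C" "f \<in> Arr C" "g \<in> Arr C" "Cod C f = Cod C g"
  shows "\<exists>g' f'. is_pullback C f g g' f'"
proof -
  let ?r = "(span_shape {()})\<inverse>"
  define X where "X v = (case v of Base \<Rightarrow> Dom C f | Src t \<Rightarrow> Cod C f | Tgt t \<Rightarrow> Dom C g)"
    for v :: "unit span_vertex"
  define \<phi> where "\<phi> = (\<lambda>(v, w). if v = w then Ident C (X v) else
    case v of Base \<Rightarrow> f | _ \<Rightarrow> g)"
  have Fr: "Field ?r = {Base, Src (), Tgt ()}" by (auto simp: Field_span_shape)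
  have r: "(v, w) \<in> ?r \<longleftrightarrow> v = w \<or> w = Src () \<and> (v = Base \<or> v = Tgt ())" for v w
    by (cases v) (auto simp: span_shape_def)
  have X: "X v \<in> Obj C" for v
    using assms by (auto simp: X_def split: span_vertex.split)
  have \<phi>: "\<phi> (v, w) \<in> hom C (X v) (X w)" if "(v, w) \<in> ?r" for v w
    using that X assms unfolding r by (auto simp: \<phi>_def hom_iff X_def)
  have id: "\<phi> (v, v) = Ident C (X v)" for v by (simp add: \<phi>_def)
  have F: "is_functor (order_category ?r) C X \<phi>"
    unfolding is_functor_def order_category_def
  proof (simp add: X id, intro conjI ballI)
    fix u assume "u \<in> ?r"
    then obtain v w where u: "u = (v, w)" "(v, w) \<in> ?r" by (cases u) auto
    then show "\<phi> u \<in> hom C (X (fst u)) (X (snd u))" using \<phi> by simp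
    fix v' assume "v' \<in> ?r"
    then obtain w' x where v': "v' = (w', x)" "(w', x) \<in> ?r" by (cases v') auto
    show "snd u = fst v' \<longrightarrow> \<phi> (fst u, snd v') = \<phi> v' \<cdot> \<phi> u"
    proof
      assume w: "snd u = fst v'"
      then have "v = w \<or> w = x" using u v' unfolding r by auto
      then show "\<phi> (fst u, snd v') = \<phi> v' \<cdot> \<phi> u"
        using u v' w \<phi>[OF u(2)] \<phi>[OF v'(2)] by (elim disjE) (simp_all add: id hom_iff)
    qed
  qed
  have sm: "small \<Theta> {()}" by (intro small_finite[OF assms(1)]) simp
  obtain P \<pi> where lim: "is_limit (order_category ?r) C X \<phi> P \<pi>"
    using small_limit_exists[OF assms(1,2) cospan_shape_category _ _ F]
      small_span_shape[OF assms(1) sm] by (auto simp: order_category_def)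
  then have cn: "is_cone (order_category ?r) C X \<phi> P \<pi>" by (simp add: is_limit_def)
  have \<pi>: "\<pi> v \<in> hom C P (X v)" for v
    using cn Fr by (cases v) (auto simp: is_cone_def order_category_def)
  have "\<phi> (v, w) \<cdot> \<pi> v = \<pi> w" if "(v, w) \<in> ?r" for v w
    using cn that unfolding is_cone_def order_category_def by force
  from this[of Base "Src ()"] this[of "Tgt ()" "Src ()"]
  have e: "f \<cdot> \<pi> Base = \<pi> (Src ())" "g \<cdot> \<pi> (Tgt ()) = \<pi> (Src ())" by (auto simp: span_shape_def \<phi>_def)
  have "is_pullback C f g (\<pi> Base) (\<pi> (Tgt ()))"
    unfolding is_pullback_def
  proof (intro conjI ballI impI)
    fix Z a b assume Z: "Z \<in> Obj C" "a \<in> hom C Z (Dom C f)" "b \<in> hom C Z (Dom C g)" "f \<cdot> a = g \<cdot> b"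
    define \<kappa> where "\<kappa> v = (case v of Base \<Rightarrow> a | Src t \<Rightarrow> f \<cdot> a | Tgt t \<Rightarrow> b)"
      for v :: "unit span_vertex"
    have \<kappa>: "\<kappa> d \<in> hom C Z (X d)" for d
        using Z assms by (cases d) (auto simp: \<kappa>_def X_def hom_iff)
    have "is_cone (order_category ?r) C X \<phi> Z \<kappa>"
      unfolding is_cone_def order_category_def
    proof (simp add: Z \<kappa>, intro ballI)
      fix u assume "u \<in> ?r"
      then obtain v w where u: "u = (v, w)" "(v, w) \<in> ?r" by (cases u) auto
      have "Ident C (X v) \<cdot> \<kappa> v = \<kappa> v" using \<kappa>[of v] by (simp add: hom_iff)
      with u show "\<phi> u \<cdot> \<kappa> (fst u) = \<kappa> (snd u)"
        unfolding r using Z by (auto simp: \<kappa>_def \<phi>_def)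
    qed
    then have u1: "\<exists>!h. h \<in> hom C Z P \<and> (\<forall>d \<in> {Base, Src (), Tgt ()}. \<pi> d \<cdot> h = \<kappa> d)"
      using lim Fr by (auto simp: is_limit_def order_category_def)
    have *: "(h \<in> hom C Z P \<and> (\<forall>d \<in> {Base, Src (), Tgt ()}. \<pi> d \<cdot> h = \<kappa> d)) \<longleftrightarrow>
        h \<in> hom C Z (Dom C (\<pi> (Tgt ()))) \<and> \<pi> Base \<cdot> h = a \<and> \<pi> (Tgt ()) \<cdot> h = b" for h
    proof -
      have "\<pi> (Src ()) \<cdot> h = f \<cdot> a" if "h \<in> hom C Z P" "\<pi> Base \<cdot> h = a"
        unfolding e(1)[symmetric] using that assms \<pi>[of Base] by (auto simp: hom_iff X_def)
      then show ?thesis using \<pi>[of "Tgt ()"] by (auto simp: \<kappa>_def hom_iff)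
    qed
    show "\<exists>!h. h \<in> hom C Z (Dom C (\<pi> (Tgt ()))) \<and> \<pi> Base \<cdot> h = a \<and> \<pi> (Tgt ()) \<cdot> h = b"
      using u1 unfolding * .
  qed (use assms \<pi>[of Base] \<pi>[of "Tgt ()"] e in \<open>auto simp: hom_iff X_def\<close>)
  then show ?thesis by blast
qed

end

text \<open>Arrows out of an initial object exist and are unique at each stage of a sequence. This settles
  the smallness of \<open>\<emptyset>\<close>, the domain of the new generating cofibration.\<close>

lemma (in category) initial_small_relative:
  fixes \<Theta> :: "'u rel"
  assumes "universe \<Theta>" "is_initial C E"
  shows "small_relative \<Theta> C E K"
proof -
  have "small \<Theta> ({} :: 'u set)" by (rule small_finite[OF assms(1)]) simp
  moreover have "cardinal_small_relative \<Theta> C |{} :: 'u set| E K"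
    unfolding cardinal_small_relative_def
  proof (intro conjI allI impI ballI)
    show "E \<in> Obj C" using assms(2) by (simp add: is_initial_def)
  next
    fix r X \<phi> Z \<iota> h
    assume a: "filtered_ordinal |{} :: 'u set| r \<and> is_sequence \<Theta> C r X \<phi> \<and> steps_in r \<phi> K \<and>
      is_colimit (order_category r) C X \<phi> Z \<iota>" and h: "h \<in> hom C E Z"
    then obtain b where b: "b \<in> Field r" by (auto simp: filtered_ordinal_def)
    have \<iota>: "\<iota> b \<in> hom C (X b) Z"
      using a b by (auto simp: is_colimit_def is_cocone_def order_category_def)
    then have "X b \<in> Obj C" using Dom_Cod_Obj(1)[of "\<iota> b"] by (simp add: hom_iff)
    then obtain g where g: "g \<in> hom C E (X b)" using assms(2) unfolding is_initial_def by blast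
    have "h = \<iota> b \<cdot> g"
      by (rule initial_hom_eq[OF assms(2), of _ Z]) (use h g \<iota> in \<open>auto simp: hom_iff\<close>)
    then show "\<exists>b\<in>Field r. \<exists>g\<in>hom C E (X b). h = \<iota> b \<cdot> g" using b g by blast
  next
    fix r X \<phi> Z \<iota> b b' g g'
    assume a: "filtered_ordinal |{} :: 'u set| r \<and> is_sequence \<Theta> C r X \<phi> \<and> steps_in r \<phi> K \<and>
      is_colimit (order_category r) C X \<phi> Z \<iota>" and b: "b \<in> Field r" "b' \<in> Field r"
      and g: "g \<in> hom C E (X b)" "g' \<in> hom C E (X b')"
    have "Well_order r" using a by (simp add: is_sequence_def)
    then have "refl_on (Field r) r" "total_on (Field r) r"
      by (auto simp: well_order_on_def linear_order_on_def partial_order_on_def preorder_on_def)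
    then obtain c where c: "(b, c) \<in> r" "(b', c) \<in> r"
      using b unfolding refl_on_def total_on_def by metis
    have "\<phi> (b, c) \<in> hom C (X b) (X c)" "\<phi> (b', c) \<in> hom C (X b') (X c)"
      using a c by (auto simp: is_sequence_def is_functor_def order_category_def)
    then have "\<phi> (b, c) \<cdot> g = \<phi> (b', c) \<cdot> g'"
      by (intro initial_hom_eq[OF assms(2), of _ "X c"]) (use g in \<open>auto simp: hom_iff\<close>)
    then show "\<exists>c. (b, c) \<in> r \<and> (b', c) \<in> r \<and> \<phi> (b, c) \<cdot> g = \<phi> (b', c) \<cdot> g'" using c by blast
  qed
  ultimately show ?thesis unfolding small_relative_def small_def using card_of_Card_order by blast
qed

section \<open>Pull-backs and push-outs\<close>

context category
begin

lemma is_pullbackD: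
  assumes "is_pullback C f g g' f'"
  shows "f \<in> Arr C" "g \<in> Arr C" "g' \<in> Arr C" "f' \<in> Arr C" "Cod C g = Cod C f"
    "Cod C g' = Dom C f" "Cod C f' = Dom C g" "Dom C g' = Dom C f'" "f \<cdot> g' = g \<cdot> f'"
  using assms by (auto simp: is_pullback_def)

lemma pullback_induced:
  assumes "is_pullback C f g g' f'" "a \<in> hom C Z (Dom C f)" "b \<in> hom C Z (Dom C g)" "f \<cdot> a = g \<cdot> b"
  shows "\<exists>h. h \<in> hom C Z (Dom C f') \<and> g' \<cdot> h = a \<and> f' \<cdot> h = b"
proof -
  have "Z \<in> Obj C" using assms(2) by (auto simp: hom_iff)
  then show ?thesis using assms unfolding is_pullback_def by blast
qed

lemma pullback_eq:
  assumes "is_pullback C f g g' f'" "h \<in> hom C Z (Dom C f')" "k \<in> hom C Z (Dom C f')"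
    and "g' \<cdot> h = g' \<cdot> k" "f' \<cdot> h = f' \<cdot> k"
  shows "h = k"
proof -
  note t = is_pullbackD[OF assms(1)] assms(2,3)[unfolded hom_iff]
  have Z: "Z \<in> Obj C" using t by auto
  have "g' \<cdot> k \<in> hom C Z (Dom C f)" "f' \<cdot> k \<in> hom C Z (Dom C g)" using t by (auto simp: hom_iff)
  moreover have "f \<cdot> (g' \<cdot> k) = g \<cdot> (f' \<cdot> k)" by (rule Cmp_eq_extend[OF t(9)]) (use t in auto)
  ultimately have "\<exists>!h. h \<in> hom C Z (Dom C f') \<and> g' \<cdot> h = g' \<cdot> k \<and> f' \<cdot> h = f' \<cdot> k"
    using assms(1) Z unfolding is_pullback_def by blast
  then show ?thesis using assms(2-5) by blast
qed

lemma has_lift_pullback: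
  assumes pb: "is_pullback C f g g' f'" and L: "has_lift C i f" and i: "i \<in> Arr C"
  shows "has_lift C i f'"
proof (rule has_liftI)
  note t = is_pullbackD[OF pb]
  fix u v assume uv: "u \<in> Arr C" "v \<in> Arr C" "Dom C u = Dom C i" "Cod C u = Dom C f'"
    "Dom C v = Cod C i" "Cod C v = Cod C f'" "f' \<cdot> u = v \<cdot> i"
  have "f \<cdot> (g' \<cdot> u) = g \<cdot> (f' \<cdot> u)"
    by (rule Cmp_eq_extend[OF t(9)]) (use uv t in auto)
  then have "f \<cdot> (g' \<cdot> u) = (g \<cdot> v) \<cdot> i" using uv t i by simp
  then obtain h where h: "h \<in> Arr C" "Dom C h = Cod C i" "Cod C h = Dom C f" "h \<cdot> i = g' \<cdot> u" "f \<cdot> h = g \<cdot> v"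
    using uv t by (elim has_liftE[OF L, of "g' \<cdot> u" "g \<cdot> v", rotated 6]) simp_all
  obtain l where l: "l \<in> hom C (Cod C i) (Dom C f')" "g' \<cdot> l = h" "f' \<cdot> l = v"
    using pullback_induced[OF pb, of h "Cod C i" v] h uv t by (auto simp: hom_iff)
  note tl = l(1)[unfolded hom_iff]
  have "l \<cdot> i = u"
  proof (rule pullback_eq[OF pb, of _ "Dom C i"])
    show "g' \<cdot> (l \<cdot> i) = g' \<cdot> u"
      using Cmp_eq_collapse[OF l(2), of i] t tl i h by simp
    show "f' \<cdot> (l \<cdot> i) = f' \<cdot> u"
      using Cmp_eq_collapse[OF l(3), of i] t tl i uv by simp
  qed (use tl i uv in \<open>auto simp: hom_iff\<close>)
  then show "\<exists>h. h \<in> Arr C \<and> Dom C h = Cod C i \<and> Cod C h = Dom C f' \<and> h \<cdot> i = u \<and> f' \<cdot> h = v"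
    using l tl by auto
qed

lemma is_pushoutD:
  assumes "is_pushout C f g g' f'"
  shows "f \<in> Arr C" "g \<in> Arr C" "g' \<in> Arr C" "f' \<in> Arr C" "Dom C g = Dom C f"
    "Dom C g' = Cod C f" "Dom C f' = Cod C g" "Cod C g' = Cod C f'" "g' \<cdot> f = f' \<cdot> g"
  using assms by (auto simp: is_pushout_def)

lemma pushout_induced:
  assumes "is_pushout C f g g' f'" "a \<in> hom C (Cod C f) Z" "b \<in> hom C (Cod C g) Z" "a \<cdot> f = b \<cdot> g"
  shows "\<exists>h. h \<in> hom C (Cod C f') Z \<and> h \<cdot> g' = a \<and> h \<cdot> f' = b"
proof -
  have "Z \<in> Obj C" using assms(2) by (auto simp: hom_iff)
  then show ?thesis using assms unfolding is_pushout_def by blast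
qed

lemma pushout_eq:
  assumes "is_pushout C f g g' f'" "h \<in> hom C (Cod C f') Z" "k \<in> hom C (Cod C f') Z"
    and "h \<cdot> g' = k \<cdot> g'" "h \<cdot> f' = k \<cdot> f'"
  shows "h = k"
proof -
  note t = is_pushoutD[OF assms(1)] assms(2,3)[unfolded hom_iff]
  have Z: "Z \<in> Obj C" using t by auto
  have "k \<cdot> g' \<in> hom C (Cod C f) Z" "k \<cdot> f' \<in> hom C (Cod C g) Z" using t by (auto simp: hom_iff)
  moreover have "(k \<cdot> g') \<cdot> f = (k \<cdot> f') \<cdot> g" using t by simp
  ultimately have "\<exists>!h. h \<in> hom C (Cod C f') Z \<and> h \<cdot> g' = k \<cdot> g' \<and> h \<cdot> f' = k \<cdot> f'"
    using assms(1) Z unfolding is_pushout_def by blast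
  then show ?thesis using assms(2-5) by blast
qed

lemma is_pushoutI:
  assumes "f \<in> Arr C" "g \<in> Arr C" "g' \<in> Arr C" "f' \<in> Arr C" "Dom C g = Dom C f"
    "Dom C g' = Cod C f" "Dom C f' = Cod C g" "Cod C g' = Cod C f'" "g' \<cdot> f = f' \<cdot> g"
    and ex: "\<And>Z a b. \<lbrakk>a \<in> hom C (Cod C f) Z; b \<in> hom C (Cod C g) Z; a \<cdot> f = b \<cdot> g\<rbrakk> \<Longrightarrow>
      \<exists>h. h \<in> hom C (Cod C f') Z \<and> h \<cdot> g' = a \<and> h \<cdot> f' = b"
    and un: "\<And>Z h k. \<lbrakk>h \<in> hom C (Cod C f') Z; k \<in> hom C (Cod C f') Z; h \<cdot> g' = k \<cdot> g';
      h \<cdot> f' = k \<cdot> f'\<rbrakk> \<Longrightarrow> h = k"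
  shows "is_pushout C f g g' f'"
  unfolding is_pushout_def
proof (intro conjI ballI impI)
  fix Z a b assume "a \<in> hom C (Cod C f) Z" "b \<in> hom C (Cod C g) Z" "a \<cdot> f = b \<cdot> g"
  from ex[OF this] show "\<exists>!h. h \<in> hom C (Cod C f') Z \<and> h \<cdot> g' = a \<and> h \<cdot> f' = b"
    by (rule ex_ex1I) (metis un)
qed (use assms in simp_all)

lemma pushout_exists:
  fixes \<Theta> :: "'u rel"
  assumes "universe \<Theta>" "cocomplete \<Theta> C" "f \<in> Arr C" "g \<in> Arr C" "Dom C f = Dom C g"
  shows "\<exists>g' f'. is_pushout C f g g' f'"
proof (rule attachment[OF assms(1,2), of "{()}" "Cod C g" "\<lambda>_. f" "\<lambda>_. g"])
  show "small \<Theta> {()}" by (intro small_finite[OF assms(1)]) simp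
  fix Z1 z b
  assume z: "z \<in> hom C (Cod C g) Z1"
    and b: "\<And>t. t \<in> {()} \<Longrightarrow> b t \<in> hom C (Cod C f) Z1"
    and bk: "\<And>t. t \<in> {()} \<Longrightarrow> b t \<cdot> f = z \<cdot> g"
    and ex: "\<And>Y y c. \<lbrakk>y \<in> hom C (Cod C g) Y; \<And>t. t \<in> {()} \<Longrightarrow> c t \<in> hom C (Cod C f) Y;
       \<And>t. t \<in> {()} \<Longrightarrow> c t \<cdot> f = y \<cdot> g\<rbrakk> \<Longrightarrow>
       \<exists>h. h \<in> hom C Z1 Y \<and> h \<cdot> z = y \<and> (\<forall>t \<in> {()}. h \<cdot> b t = c t)"
    and un: "\<And>Y g h. \<lbrakk>g \<in> hom C Z1 Y; h \<in> hom C Z1 Y; g \<cdot> z = h \<cdot> z;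
       \<And>t. t \<in> {()} \<Longrightarrow> g \<cdot> b t = h \<cdot> b t\<rbrakk> \<Longrightarrow> g = h"
  note t = z[unfolded hom_iff] b[of "()", simplified, unfolded hom_iff]
  have "is_pushout C f g (b ()) z"
  proof (rule is_pushoutI)
    fix Z a c assume ac: "a \<in> hom C (Cod C f) Z" "c \<in> hom C (Cod C g) Z" "a \<cdot> f = c \<cdot> g"
    show "\<exists>h. h \<in> hom C (Cod C z) Z \<and> h \<cdot> b () = a \<and> h \<cdot> z = c"
      using ex[of c Z "\<lambda>_. a"] ac t by auto
  next
    fix Z h k assume "h \<in> hom C (Cod C z) Z" "k \<in> hom C (Cod C z) Z" "h \<cdot> b () = k \<cdot> b ()" "h \<cdot> z = k \<cdot> z"
    then show "h = k" using un[of h Z k] t by auto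
  qed (use assms t bk[of "()"] in auto)
  then show ?thesis by blast
qed (use assms in \<open>auto simp: hom_iff\<close>)

text \<open>Isomorphic spans have the same push-outs; \<open>x\<close>, \<open>y\<close>, \<open>z\<close> go from the new span to the given one.\<close>

lemma is_pushout_iso:
  assumes po: "is_pushout C f g g' f'"
    and "x \<in> Arr C" "Cod C x = Dom C f" "y \<in> Arr C" "Cod C y = Cod C f" "z \<in> Arr C" "Cod C z = Cod C g"
    and iso: "iso_arr C x" "iso_arr C y" "iso_arr C z"
    and fg2: "f2 \<in> hom C (Dom C x) (Dom C y)" "g2 \<in> hom C (Dom C x) (Dom C z)"
    and eq: "f \<cdot> x = y \<cdot> f2" "g \<cdot> x = z \<cdot> g2"
  shows "is_pushout C f2 g2 (g' \<cdot> y) (f' \<cdot> z)"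
proof -
  note t = is_pushoutD(1-8)[OF po] assms(2-7) fg2[unfolded hom_iff]
  obtain x' where x': "x' \<in> Arr C" "Dom C x' = Dom C f" "Cod C x' = Dom C x" 
      "x \<cdot> x' = Ident C (Dom C f)"
    using iso(1) assms(2,3) by (auto simp: iso_arr_def hom_iff)
  obtain y' where y': "y' \<in> Arr C" "Dom C y' = Cod C f" "Cod C y' = Dom C y" 
      "y' \<cdot> y = Ident C (Dom C y)" "y \<cdot> y' = Ident C (Cod C f)"
    using iso(2) assms(4,5) by (auto simp: iso_arr_def hom_iff)
  obtain z' where z': "z' \<in> Arr C" "Dom C z' = Cod C g" "Cod C z' = Dom C z" 
      "z' \<cdot> z = Ident C (Dom C z)" "z \<cdot> z' = Ident C (Cod C g)"
    using iso(3) assms(6,7) by (auto simp: iso_arr_def hom_iff)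
  have f2x: "y' \<cdot> f = f2 \<cdot> x'"
  proof -
    have "y' \<cdot> f = y' \<cdot> (f \<cdot> (x \<cdot> x'))" by (simp add: t x')
    also have "f \<cdot> (x \<cdot> x') = y \<cdot> (f2 \<cdot> x')"
      by (rule Cmp_eq_extend[OF eq(1)]) (simp_all add: t x')
    also have "y' \<cdot> \<dots> = Ident C (Dom C y) \<cdot> (f2 \<cdot> x')"
      by (rule Cmp_eq_collapse[OF y'(4)]) (simp_all add: t x' y')
    also have "\<dots> = f2 \<cdot> x'" by (simp add: t x')
    finally show ?thesis .
  qed
  have g2x: "z' \<cdot> g = g2 \<cdot> x'"
  proof -
    have "z' \<cdot> g = z' \<cdot> (g \<cdot> (x \<cdot> x'))" by (simp add: t x')
    also have "g \<cdot> (x \<cdot> x') = z \<cdot> (g2 \<cdot> x')"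
      by (rule Cmp_eq_extend[OF eq(2)]) (simp_all add: t x')
    also have "z' \<cdot> \<dots> = Ident C (Dom C z) \<cdot> (g2 \<cdot> x')"
      by (rule Cmp_eq_collapse[OF z'(4)]) (simp_all add: t x' z')
    also have "\<dots> = g2 \<cdot> x'" by (simp add: t x')
    finally show ?thesis .
  qed
  show ?thesis
  proof (rule is_pushoutI)
    have "(g' \<cdot> y) \<cdot> f2 = g' \<cdot> (f \<cdot> x)" using t eq by simp
    also have "\<dots> = f' \<cdot> (g \<cdot> x)"
      by (rule Cmp_eq_extend[OF is_pushoutD(9)[OF po]]) (use t in auto)
    also have "\<dots> = (f' \<cdot> z) \<cdot> g2" using t eq by simp
    finally show "(g' \<cdot> y) \<cdot> f2 = (f' \<cdot> z) \<cdot> g2" .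
  next
    fix Z a b assume ab: "a \<in> hom C (Cod C f2) Z" "b \<in> hom C (Cod C g2) Z" "a \<cdot> f2 = b \<cdot> g2"
    note t' = t x'(1-3) y'(1-3) z'(1-3) ab(1,2)[unfolded hom_iff]
    have "(a \<cdot> y') \<cdot> f = a \<cdot> (f2 \<cdot> x')" using t' f2x by simp
    also have "\<dots> = b \<cdot> (g2 \<cdot> x')" by (rule Cmp_eq_extend[OF ab(3)]) (use t' in auto)
    also have "\<dots> = (b \<cdot> z') \<cdot> g" using t' g2x by simp
    finally obtain h where h: "h \<in> hom C (Cod C f') Z" "h \<cdot> g' = a \<cdot> y'" "h \<cdot> f' = b \<cdot> z'"
      using pushout_induced[OF po, of "a \<cdot> y'" Z "b \<cdot> z'"] t' by (auto simp: hom_iff)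
    note h' = h(1)[unfolded hom_iff]
    have "h \<cdot> (g' \<cdot> y) = (a \<cdot> y') \<cdot> y" by (rule Cmp_eq_collapse[OF h(2)]) (use t' h' in auto)
    then have 1: "h \<cdot> (g' \<cdot> y) = a" using t' y' by simp
    have "h \<cdot> (f' \<cdot> z) = (b \<cdot> z') \<cdot> z" by (rule Cmp_eq_collapse[OF h(3)]) (use t' h' in auto)
    then have "h \<cdot> (f' \<cdot> z) = b" using t' z' by simp
    with 1 show "\<exists>h. h \<in> hom C (Cod C (f' \<cdot> z)) Z \<and> h \<cdot> (g' \<cdot> y) = a \<and> h \<cdot> (f' \<cdot> z) = b"
      using h' t' by (intro exI[of _ h]) (auto simp: hom_iff)
  next
    fix Z h k assume hk: "h \<in> hom C (Cod C (f' \<cdot> z)) Z" "k \<in> hom C (Cod C (f' \<cdot> z)) Z"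
      "h \<cdot> (g' \<cdot> y) = k \<cdot> (g' \<cdot> y)" "h \<cdot> (f' \<cdot> z) = k \<cdot> (f' \<cdot> z)"
    then have hk': "h \<in> hom C (Cod C f') Z" "k \<in> hom C (Cod C f') Z" using t by auto
    note t' = t x'(1-3) y'(1-3) z'(1-3) hk'[unfolded hom_iff]
    have "(h \<cdot> (g' \<cdot> y)) \<cdot> y' = (k \<cdot> (g' \<cdot> y)) \<cdot> y'" "(h \<cdot> (f' \<cdot> z)) \<cdot> z' = (k \<cdot> (f' \<cdot> z)) \<cdot> z'"
      using hk by simp_all
    then have "h \<cdot> g' = k \<cdot> g'" "h \<cdot> f' = k \<cdot> f'" using t' y' z' by simp_all
    then show "h = k" by (rule pushout_eq[OF po hk'])
  qed (use t in auto)
qed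

end

text \<open>For a commutative square \<open>l1 \<cdot> k1 = l2 \<cdot> k2\<close>, lifting the arrow out of the push-out of
  \<open>k1\<close> and \<open>k2\<close> that \<open>l1\<close> and \<open>l2\<close> induce, expressed without the push-out.\<close>

definition corner_lift ::
  "('o, 'm, 'x) precat_scheme \<Rightarrow> 'm \<Rightarrow> 'm \<Rightarrow> 'm \<Rightarrow> 'm \<Rightarrow> 'm \<Rightarrow> bool"
where
  "corner_lift C k1 k2 l1 l2 p \<longleftrightarrow>
     (\<forall>a \<in> hom C (Cod C k1) (Dom C p). \<forall>b \<in> hom C (Cod C k2) (Dom C p).
      \<forall>c \<in> hom C (Cod C l1) (Cod C p).
       a \<cdot>\<^bsub>C\<^esub> k1 = b \<cdot>\<^bsub>C\<^esub> k2 \<and> p \<cdot>\<^bsub>C\<^esub> a = c \<cdot>\<^bsub>C\<^esub> l1 \<and> p \<cdot>\<^bsub>C\<^esub> b = c \<cdot>\<^bsub>C\<^esub> l2 \<longrightarrow>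
       (\<exists>d \<in> hom C (Cod C l1) (Dom C p). d \<cdot>\<^bsub>C\<^esub> l1 = a \<and> d \<cdot>\<^bsub>C\<^esub> l2 = b \<and> p \<cdot>\<^bsub>C\<^esub> d = c))"

lemma corner_liftE:
  assumes "corner_lift C k1 k2 l1 l2 p"
    and "a \<in> hom C (Cod C k1) (Dom C p)" "b \<in> hom C (Cod C k2) (Dom C p)"
    and "c \<in> hom C (Cod C l1) (Cod C p)"
    and "a \<cdot>\<^bsub>C\<^esub> k1 = b \<cdot>\<^bsub>C\<^esub> k2" "p \<cdot>\<^bsub>C\<^esub> a = c \<cdot>\<^bsub>C\<^esub> l1" "p \<cdot>\<^bsub>C\<^esub> b = c \<cdot>\<^bsub>C\<^esub> l2"
  obtains d where "d \<in> hom C (Cod C l1) (Dom C p)" "d \<cdot>\<^bsub>C\<^esub> l1 = a" "d \<cdot>\<^bsub>C\<^esub> l2 = b" "p \<cdot>\<^bsub>C\<^esub> d = c"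
  using assms(1)[unfolded corner_lift_def, rule_format, OF assms(2-4)] assms(5-7) by blast

lemma corner_lift_sym:
  assumes "corner_lift C k1 k2 l1 l2 p" "Cod C l1 = Cod C l2"
  shows "corner_lift C k2 k1 l2 l1 p"
  unfolding corner_lift_def
proof (intro ballI impI, elim conjE)
  fix a b c assume "a \<in> hom C (Cod C k2) (Dom C p)" "b \<in> hom C (Cod C k1) (Dom C p)"
    "c \<in> hom C (Cod C l2) (Cod C p)" "a \<cdot>\<^bsub>C\<^esub> k2 = b \<cdot>\<^bsub>C\<^esub> k1" "p \<cdot>\<^bsub>C\<^esub> a = c \<cdot>\<^bsub>C\<^esub> l2" "p \<cdot>\<^bsub>C\<^esub> b = c \<cdot>\<^bsub>C\<^esub> l1"
  then have "\<exists>d \<in> hom C (Cod C l1) (Dom C p). d \<cdot>\<^bsub>C\<^esub> l1 = b \<and> d \<cdot>\<^bsub>C\<^esub> l2 = a \<and> p \<cdot>\<^bsub>C\<^esub> d = c"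
    using assms unfolding corner_lift_def by simp
  then show "\<exists>d\<in>hom C (Cod C l2) (Dom C p). d \<cdot>\<^bsub>C\<^esub> l2 = a \<and> d \<cdot>\<^bsub>C\<^esub> l1 = b \<and> p \<cdot>\<^bsub>C\<^esub> d = c"
    using assms(2) by auto
qed

context category
begin

lemma corner_lift_iff:
  assumes po: "is_pushout C k1 k2 m1 m2" and h: "h \<in> Arr C" "Dom C h = Cod C m1"
    and p: "p \<in> Arr C"
  shows "corner_lift C k1 k2 (h \<cdot> m1) (h \<cdot> m2) p \<longleftrightarrow> has_lift C h p"
proof
  note t = is_pushoutD[OF po] h p
  assume L: "corner_lift C k1 k2 (h \<cdot> m1) (h \<cdot> m2) p"
  show "has_lift C h p"
  proof (rule has_liftI)
    fix u v assume uv: "u \<in> Arr C" "v \<in> Arr C" "Dom C u = Dom C h" "Cod C u = Dom C p"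
      "Dom C v = Cod C h" "Cod C v = Cod C p" "p \<cdot> u = v \<cdot> h"
    have "p \<cdot> (u \<cdot> m1) = v \<cdot> (h \<cdot> m1)" "p \<cdot> (u \<cdot> m2) = v \<cdot> (h \<cdot> m2)"
      by (rule Cmp_eq_extend[OF uv(7)]; use t uv in simp)+
    moreover have "(u \<cdot> m1) \<cdot> k1 = (u \<cdot> m2) \<cdot> k2" using t uv by simp
    ultimately obtain d where d: "d \<in> hom C (Cod C h) (Dom C p)" "d \<cdot> (h \<cdot> m1) = u \<cdot> m1"
        "d \<cdot> (h \<cdot> m2) = u \<cdot> m2" "p \<cdot> d = v"
      by (elim corner_liftE[OF L, of "u \<cdot> m1" "u \<cdot> m2" v, rotated 3])
        (use t uv in \<open>simp_all add: hom_iff\<close>)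
    have "d \<cdot> h = u"
      by (rule pushout_eq[OF po, of _ "Dom C p"]) (use d uv t in \<open>simp_all add: hom_iff\<close>)
    then show "\<exists>l. l \<in> Arr C \<and> Dom C l = Cod C h \<and> Cod C l = Dom C p \<and> l \<cdot> h = u \<and> p \<cdot> l = v"
      using d by (auto simp: hom_iff)
  qed
next
  note t = is_pushoutD[OF po] h p
  assume L: "has_lift C h p"
  show "corner_lift C k1 k2 (h \<cdot> m1) (h \<cdot> m2) p"
    unfolding corner_lift_def
  proof (intro ballI impI, elim conjE)
    fix a b c assume "a \<in> hom C (Cod C k1) (Dom C p)" "b \<in> hom C (Cod C k2) (Dom C p)"
      "c \<in> hom C (Cod C (h \<cdot> m1)) (Cod C p)"
      and e: "a \<cdot> k1 = b \<cdot> k2" "p \<cdot> a = c \<cdot> (h \<cdot> m1)" "p \<cdot> b = c \<cdot> (h \<cdot> m2)"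
    then obtain u where u: "u \<in> hom C (Cod C m2) (Dom C p)" "u \<cdot> m1 = a" "u \<cdot> m2 = b"
      and c: "c \<in> Arr C" "Dom C c = Cod C h" "Cod C c = Cod C p"
      using pushout_induced[OF po, of a "Dom C p" b] t by (auto simp: hom_iff)
    have "p \<cdot> u = c \<cdot> h"
      by (rule pushout_eq[OF po, of _ "Cod C p"]) (use u c e t in \<open>simp_all add: hom_iff\<close>)
    then obtain l where l: "l \<in> Arr C" "Dom C l = Cod C h" "Cod C l = Dom C p" "l \<cdot> h = u" "p \<cdot> l = c"
      using u c t by (elim has_liftE[OF L, of u c, rotated 6]) (auto simp: hom_iff)
    have "l \<cdot> (h \<cdot> m1) = u \<cdot> m1" "l \<cdot> (h \<cdot> m2) = u \<cdot> m2"
      by (rule Cmp_eq_collapse[OF l(4)]; use t l in simp)+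
    then show "\<exists>d\<in>hom C (Cod C (h \<cdot> m1)) (Dom C p). d \<cdot> (h \<cdot> m1) = a \<and> d \<cdot> (h \<cdot> m2) = b \<and> p \<cdot> d = c"
      using l u t by (auto simp: hom_iff)
  qed
qed

text \<open>If \<open>k1\<close> is an arrow between initial objects, the push-out of \<open>k1\<close> and \<open>k2\<close> is the codomain of
  \<open>k2\<close>, and \<open>l2\<close> is itself the induced arrow.\<close>

lemma corner_lift_initial:
  assumes ini: "is_initial C (Dom C k1)" "is_initial C (Cod C k1)"
    and t: "k1 \<in> Arr C" "k2 \<in> Arr C" "l1 \<in> Arr C" "l2 \<in> Arr C" "p \<in> Arr C" "Dom C k2 = Dom C k1"
      "Dom C l1 = Cod C k1" "Dom C l2 = Cod C k2" "Cod C l1 = Cod C l2"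
  shows "corner_lift C k1 k2 l1 l2 p \<longleftrightarrow> has_lift C l2 p"
proof
  assume L: "corner_lift C k1 k2 l1 l2 p"
  show "has_lift C l2 p"
  proof (rule has_liftI)
    fix u v assume uv: "u \<in> Arr C" "v \<in> Arr C" "Dom C u = Dom C l2" "Cod C u = Dom C p"
      "Dom C v = Cod C l2" "Cod C v = Cod C p" "p \<cdot> u = v \<cdot> l2"
    obtain a where a: "a \<in> hom C (Cod C k1) (Dom C p)"
      by (rule initial_homE[OF ini(2), of "Dom C p"]) (use t in auto)
    note a' = a[unfolded hom_iff]
    have "a \<cdot> k1 = u \<cdot> k2"
      by (rule initial_hom_eq[OF ini(1), of _ "Dom C p"]) (use a' uv t in \<open>auto simp: hom_iff\<close>)
    moreover have "p \<cdot> a = v \<cdot> l1"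
      by (rule initial_hom_eq[OF ini(2), of _ "Cod C p"]) (use a' uv t in \<open>auto simp: hom_iff\<close>)
    ultimately obtain d where "d \<in> hom C (Cod C l1) (Dom C p)" "d \<cdot> l2 = u" "p \<cdot> d = v"
      using uv(7) by (elim corner_liftE[OF L, of a u v, rotated 3]) (use a uv t in \<open>simp_all add: hom_iff\<close>)
    then show "\<exists>h. h \<in> Arr C \<and> Dom C h = Cod C l2 \<and> Cod C h = Dom C p \<and> h \<cdot> l2 = u \<and> p \<cdot> h = v"
      using t by (auto simp: hom_iff)
  qed
next
  assume L: "has_lift C l2 p"
  show "corner_lift C k1 k2 l1 l2 p"
    unfolding corner_lift_def
  proof (intro ballI impI, elim conjE)
    fix a b c assume abc: "a \<in> hom C (Cod C k1) (Dom C p)" "b \<in> hom C (Cod C k2) (Dom C p)"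
      "c \<in> hom C (Cod C l1) (Cod C p)" "p \<cdot> b = c \<cdot> l2"
    then obtain d where d: "d \<in> Arr C" "Dom C d = Cod C l2" "Cod C d = Dom C p" "d \<cdot> l2 = b" "p \<cdot> d = c"
      using t by (elim has_liftE[OF L, of b c, rotated 6]) (auto simp: hom_iff)
    have "d \<cdot> l1 = a"
      by (rule initial_hom_eq[OF ini(2), of _ "Dom C p"]) (use d abc t in \<open>auto simp: hom_iff\<close>)
    then show "\<exists>d\<in>hom C (Cod C l1) (Dom C p). d \<cdot> l1 = a \<and> d \<cdot> l2 = b \<and> p \<cdot> d = c"
      using d t by (intro bexI[of _ d]) (auto simp: hom_iff)
  qed
qed

end

section \<open>Left adjoint endofunctors\<close>

text \<open>Adjointness is expressed by universal arrows, the form in which a closed monoidal structure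
  provides it. A choice of universal arrows yields the right adjoint, called \<open>Ro\<close> on objects and
  \<open>Ra\<close> on arrows; transposition takes \<open>u : B \<rightarrow> Ro Z\<close> to \<open>counit Z \<cdot> Fa u\<close>.\<close>

locale left_adjoint = category C
  for C :: "('o, 'm, 'x) precat_scheme" (structure) +
  fixes Fo :: "'o \<Rightarrow> 'o" and Fa :: "'m \<Rightarrow> 'm"
  assumes F_functor: "is_functor C C Fo Fa"
    and F_universal: "Z \<in> Obj C \<Longrightarrow>
      \<exists>H \<in> Obj C. \<exists>ev \<in> hom C (Fo H) Z. \<forall>B \<in> Obj C. \<forall>f \<in> hom C (Fo B) Z.
        \<exists>!h. h \<in> hom C B H \<and> ev \<cdot> Fa h = f"
begin

lemma Fo_Obj [simp]: "A \<in> Obj C \<Longrightarrow> Fo A \<in> Obj C"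
  and Fa_typing [simp]: "f \<in> Arr C \<Longrightarrow> Fa f \<in> Arr C" "f \<in> Arr C \<Longrightarrow> Dom C (Fa f) = Fo (Dom C f)"
    "f \<in> Arr C \<Longrightarrow> Cod C (Fa f) = Fo (Cod C f)"
  and Fa_Ident [simp]: "A \<in> Obj C \<Longrightarrow> Fa (Ident C A) = Ident C (Fo A)"
  and Fa_Cmp: "f \<in> Arr C \<Longrightarrow> g \<in> Arr C \<Longrightarrow> Cod C f = Dom C g \<Longrightarrow> Fa (g \<cdot> f) = Fa g \<cdot> Fa f"
  using F_functor by (auto simp: is_functor_def hom_iff)

definition universal_arrow :: "'o \<Rightarrow> 'o \<times> 'm" where
  "universal_arrow Z = (SOME (H, ev). H \<in> Obj C \<and> ev \<in> hom C (Fo H) Z \<and>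
     (\<forall>B \<in> Obj C. \<forall>f \<in> hom C (Fo B) Z. \<exists>!h. h \<in> hom C B H \<and> ev \<cdot> Fa h = f))"

definition Ro :: "'o \<Rightarrow> 'o" where "Ro Z = fst (universal_arrow Z)"

definition counit :: "'o \<Rightarrow> 'm" where "counit Z = snd (universal_arrow Z)"

lemma counit_universal:
  assumes "Z \<in> Obj C"
  shows "Ro Z \<in> Obj C \<and> counit Z \<in> hom C (Fo (Ro Z)) Z \<and>
     (\<forall>B \<in> Obj C. \<forall>f \<in> hom C (Fo B) Z. \<exists>!h. h \<in> hom C B (Ro Z) \<and> counit Z \<cdot> Fa h = f)"
proof -
  have "\<exists>x. case x of (H, ev) \<Rightarrow> H \<in> Obj C \<and> ev \<in> hom C (Fo H) Z \<and>
     (\<forall>B \<in> Obj C. \<forall>f \<in> hom C (Fo B) Z. \<exists>!h. h \<in> hom C B H \<and> ev \<cdot> Fa h = f)"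
    using F_universal[OF assms] by auto
  from someI_ex[OF this] show ?thesis
    unfolding universal_arrow_def[symmetric] Ro_def counit_def by (simp add: case_prod_beta)
qed

lemma counit_typing [simp]: "Z \<in> Obj C \<Longrightarrow> Ro Z \<in> Obj C" "Z \<in> Obj C \<Longrightarrow> counit Z \<in> Arr C"
    "Z \<in> Obj C \<Longrightarrow> Dom C (counit Z) = Fo (Ro Z)" "Z \<in> Obj C \<Longrightarrow> Cod C (counit Z) = Z"
  using counit_universal by (auto simp: hom_iff)

lemma transposeE:
  assumes "f \<in> hom C (Fo B) Z" "B \<in> Obj C"
  obtains h where "h \<in> hom C B (Ro Z)" "counit Z \<cdot> Fa h = f"
proof -
  have "Z \<in> Obj C" using assms by (auto simp: hom_iff)
  then show thesis using counit_universal assms that by blast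
qed

lemma transpose_eq:
  assumes "h \<in> hom C B (Ro Z)" "k \<in> hom C B (Ro Z)" "counit Z \<cdot> Fa h = counit Z \<cdot> Fa k" "Z \<in> Obj C"
  shows "h = k"
proof -
  have "B \<in> Obj C" "counit Z \<cdot> Fa k \<in> hom C (Fo B) Z" using assms by (auto simp: hom_iff)
  then show ?thesis using counit_universal[OF assms(4)] assms(1-3) by blast
qed

definition Ra :: "'m \<Rightarrow> 'm" where
  "Ra p = (THE h. h \<in> hom C (Ro (Dom C p)) (Ro (Cod C p)) \<and>
     counit (Cod C p) \<cdot> Fa h = p \<cdot> counit (Dom C p))"

lemma Ra:
  assumes "p \<in> Arr C"
  shows "Ra p \<in> Arr C" "Dom C (Ra p) = Ro (Dom C p)" "Cod C (Ra p) = Ro (Cod C p)"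
    "counit (Cod C p) \<cdot> Fa (Ra p) = p \<cdot> counit (Dom C p)"
proof -
  have "p \<cdot> counit (Dom C p) \<in> hom C (Fo (Ro (Dom C p))) (Cod C p)"
    using assms by (auto simp: hom_iff)
  then have "\<exists>!h. h \<in> hom C (Ro (Dom C p)) (Ro (Cod C p)) \<and>
      counit (Cod C p) \<cdot> Fa h = p \<cdot> counit (Dom C p)"
    using counit_universal[of "Cod C p"] assms by auto
  from theI'[OF this] show "Ra p \<in> Arr C" "Dom C (Ra p) = Ro (Dom C p)" "Cod C (Ra p) = Ro (Cod C p)"
    "counit (Cod C p) \<cdot> Fa (Ra p) = p \<cdot> counit (Dom C p)"
    unfolding Ra_def[symmetric] by (auto simp: hom_iff)
qed

lemma Ra_typing [simp]: "p \<in> Arr C \<Longrightarrow> Ra p \<in> Arr C" "p \<in> Arr C \<Longrightarrow> Dom C (Ra p) = Ro (Dom C p)"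
    "p \<in> Arr C \<Longrightarrow> Cod C (Ra p) = Ro (Cod C p)"
  using Ra by auto

lemma transpose_Ra:
  assumes "p \<in> Arr C" "u \<in> Arr C" "Cod C u = Ro (Dom C p)"
  shows "counit (Cod C p) \<cdot> Fa (Ra p \<cdot> u) = p \<cdot> (counit (Dom C p) \<cdot> Fa u)"
  using Cmp_eq_extend[OF Ra(4)[OF assms(1)], of "Fa u"] assms by (simp add: Fa_Cmp)

lemma transpose_Cmp:
  assumes "Z \<in> Obj C" "v \<in> Arr C" "Cod C v = Ro Z" "f \<in> Arr C" "Cod C f = Dom C v"
  shows "counit Z \<cdot> Fa (v \<cdot> f) = (counit Z \<cdot> Fa v) \<cdot> Fa f"
  using assms by (simp add: Fa_Cmp)

text \<open>Transposition matches the squares from \<open>Fa f\<close> to \<open>p\<close> with those from \<open>f\<close> to \<open>Ra p\<close>, and their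
  lifts. Consequently, if \<open>Fa\<close> sends a set \<open>K\<close> into \<open>llp C P\<close>, then it sends every arrow with the left
  lifting property against \<open>inj_class C K\<close> there: no decomposition into cells is involved.\<close>

lemma transpose_lift:
  assumes p: "p \<in> Arr C" and f: "f \<in> Arr C"
  shows "has_lift C (Fa f) p \<longleftrightarrow> has_lift C f (Ra p)"
proof
  assume L: "has_lift C (Fa f) p"
  show "has_lift C f (Ra p)"
  proof (rule has_liftI)
    fix u v assume uv: "u \<in> Arr C" "v \<in> Arr C" "Dom C u = Dom C f" "Cod C u = Dom C (Ra p)"
      "Dom C v = Cod C f" "Cod C v = Cod C (Ra p)" "Ra p \<cdot> u = v \<cdot> f"
    have "p \<cdot> (counit (Dom C p) \<cdot> Fa u) = counit (Cod C p) \<cdot> Fa (v \<cdot> f)"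
      using transpose_Ra[OF p, of u] uv p by simp
    also have "\<dots> = (counit (Cod C p) \<cdot> Fa v) \<cdot> Fa f"
      by (rule transpose_Cmp) (use uv p f in auto)
    finally obtain l where l: "l \<in> Arr C" "Dom C l = Fo (Cod C f)" "Cod C l = Dom C p"
        "l \<cdot> Fa f = counit (Dom C p) \<cdot> Fa u" "p \<cdot> l = counit (Cod C p) \<cdot> Fa v"
      using uv p f by (elim has_liftE[OF L, of "counit (Dom C p) \<cdot> Fa u" "counit (Cod C p) \<cdot> Fa v", rotated 6]) simp_all
    obtain h where h: "h \<in> hom C (Cod C f) (Ro (Dom C p))" "counit (Dom C p) \<cdot> Fa h = l"
      by (rule transposeE[of l "Cod C f" "Dom C p"]) (use l f in \<open>auto simp: hom_iff\<close>)
    note h' = h(1)[unfolded hom_iff]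
    have "h \<cdot> f = u"
    proof (rule transpose_eq[of _ "Dom C f" "Dom C p"])
      show "counit (Dom C p) \<cdot> Fa (h \<cdot> f) = counit (Dom C p) \<cdot> Fa u"
        using transpose_Cmp[of "Dom C p" h f] h h' l f p by simp
    qed (use h' uv f p in \<open>auto simp: hom_iff\<close>)
    moreover have "Ra p \<cdot> h = v"
    proof (rule transpose_eq[of _ "Cod C f" "Cod C p"])
      show "counit (Cod C p) \<cdot> Fa (Ra p \<cdot> h) = counit (Cod C p) \<cdot> Fa v"
        using transpose_Ra[of p h] h h' l f p by simp
    qed (use h' uv f p in \<open>auto simp: hom_iff\<close>)
    ultimately show "\<exists>h. h \<in> Arr C \<and> Dom C h = Cod C f \<and> Cod C h = Dom C (Ra p) \<and> h \<cdot> f = u \<and> Ra p \<cdot> h = v"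
      using h' p by auto
  qed
next
  assume L: "has_lift C f (Ra p)"
  show "has_lift C (Fa f) p"
  proof (rule has_liftI)
    fix u v assume uv: "u \<in> Arr C" "v \<in> Arr C" "Dom C u = Dom C (Fa f)" "Cod C u = Dom C p"
      "Dom C v = Cod C (Fa f)" "Cod C v = Cod C p" "p \<cdot> u = v \<cdot> Fa f"
    obtain u' where u': "u' \<in> hom C (Dom C f) (Ro (Dom C p))" "counit (Dom C p) \<cdot> Fa u' = u"
      by (rule transposeE[of u "Dom C f" "Dom C p"]) (use uv f in \<open>auto simp: hom_iff\<close>)
    obtain v' where v': "v' \<in> hom C (Cod C f) (Ro (Cod C p))" "counit (Cod C p) \<cdot> Fa v' = v"
      by (rule transposeE[of v "Cod C f" "Cod C p"]) (use uv f in \<open>auto simp: hom_iff\<close>)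
    note t = u'(1)[unfolded hom_iff] v'(1)[unfolded hom_iff]
    have "Ra p \<cdot> u' = v' \<cdot> f"
    proof (rule transpose_eq[of _ "Dom C f" "Cod C p"])
      show "counit (Cod C p) \<cdot> Fa (Ra p \<cdot> u') = counit (Cod C p) \<cdot> Fa (v' \<cdot> f)"
        using transpose_Ra[of p u'] transpose_Cmp[of "Cod C p" v' f] t u' v' uv f p by simp
    qed (use t f p in \<open>auto simp: hom_iff\<close>)
    then obtain h where h: "h \<in> Arr C" "Dom C h = Cod C f" "Cod C h = Ro (Dom C p)" "h \<cdot> f = u'" "Ra p \<cdot> h = v'"
      using t p f by (elim has_liftE[OF L, of u' v', rotated 6]) simp_all
    have "(counit (Dom C p) \<cdot> Fa h) \<cdot> Fa f = u" "p \<cdot> (counit (Dom C p) \<cdot> Fa h) = v"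
      using transpose_Ra[of p h] transpose_Cmp[of "Dom C p" h f] h u' v' f p by simp_all
    then show "\<exists>h. h \<in> Arr C \<and> Dom C h = Cod C (Fa f) \<and> Cod C h = Dom C p \<and> h \<cdot> Fa f = u \<and> p \<cdot> h = v"
      using h p f by (intro exI[of _ "counit (Dom C p) \<cdot> Fa h"]) simp
  qed
qed

lemma iso_arr_Fa:
  assumes "iso_arr C f"
  shows "iso_arr C (Fa f)"
proof (rule iso_arrE[OF assms])
  fix g assume g: "f \<in> Arr C" "g \<in> Arr C" "Dom C g = Cod C f" "Cod C g = Dom C f"
      "g \<cdot> f = Ident C (Dom C f)" "f \<cdot> g = Ident C (Cod C f)"
  show ?thesis
    by (rule iso_arrI[of _ "Fa g"]) (use g in \<open>simp_all add: Fa_Cmp[symmetric]\<close>)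
qed

lemma preserves_initial:
  assumes "is_initial C E"
  shows "is_initial C (Fo E)"
  unfolding is_initial_def
proof (intro conjI ballI)
  have E: "E \<in> Obj C" using assms by (simp add: is_initial_def)
  then show "Fo E \<in> Obj C" by simp
  fix X assume X: "X \<in> Obj C"
  then obtain h where h: "h \<in> hom C E (Ro X)" using assms unfolding is_initial_def by force
  show "\<exists>!h. h \<in> hom C (Fo E) X"
  proof (rule ex_ex1I)
    show "\<exists>h. h \<in> hom C (Fo E) X"
      using h X by (intro exI[of _ "counit X \<cdot> Fa h"]) (auto simp: hom_iff)
    fix f g assume fg: "f \<in> hom C (Fo E) X" "g \<in> hom C (Fo E) X"
    obtain f' where "f' \<in> hom C E (Ro X)" "counit X \<cdot> Fa f' = f" by (rule transposeE[OF fg(1) E])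
    moreover obtain g' where "g' \<in> hom C E (Ro X)" "counit X \<cdot> Fa g' = g" by (rule transposeE[OF fg(2) E])
    ultimately show "f = g" using initial_hom_eq[OF assms] by metis
  qed
qed

lemma preserves_pushout:
  assumes po: "is_pushout C f g g' f'"
  shows "is_pushout C (Fa f) (Fa g) (Fa g') (Fa f')"
proof (rule is_pushoutI)
  note t = is_pushoutD[OF po]
  show "Fa g' \<cdot> Fa f = Fa f' \<cdot> Fa g" using t Fa_Cmp[of f g'] Fa_Cmp[of g f'] by simp
next
  note t = is_pushoutD[OF po]
  fix Z a b assume ab: "a \<in> hom C (Cod C (Fa f)) Z" "b \<in> hom C (Cod C (Fa g)) Z" "a \<cdot> Fa f = b \<cdot> Fa g"
  have Z: "Z \<in> Obj C" using ab by (auto simp: hom_iff)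
  obtain a' where a': "a' \<in> hom C (Cod C f) (Ro Z)" "counit Z \<cdot> Fa a' = a"
    by (rule transposeE[of a "Cod C f" Z]) (use ab t in auto)
  obtain b' where b': "b' \<in> hom C (Cod C g) (Ro Z)" "counit Z \<cdot> Fa b' = b"
    by (rule transposeE[of b "Cod C g" Z]) (use ab t in auto)
  note t' = a'(1)[unfolded hom_iff] b'(1)[unfolded hom_iff]
  have "a' \<cdot> f = b' \<cdot> g"
  proof (rule transpose_eq[of _ "Dom C f" Z])
    show "counit Z \<cdot> Fa (a' \<cdot> f) = counit Z \<cdot> Fa (b' \<cdot> g)"
      using transpose_Cmp[OF Z, of a' f] transpose_Cmp[OF Z, of b' g] t t' a' b' ab by simp
  qed (use t t' Z in \<open>auto simp: hom_iff\<close>)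
  then obtain h where h: "h \<in> hom C (Cod C f') (Ro Z)" "h \<cdot> g' = a'" "h \<cdot> f' = b'"
    using pushout_induced[OF po a'(1) b'(1)] by blast
  have "(counit Z \<cdot> Fa h) \<cdot> Fa g' = a" "(counit Z \<cdot> Fa h) \<cdot> Fa f' = b"
    using transpose_Cmp[OF Z, of h g'] transpose_Cmp[OF Z, of h f'] t h a' b' by (simp_all add: hom_iff)
  then show "\<exists>h. h \<in> hom C (Cod C (Fa f')) Z \<and> h \<cdot> Fa g' = a \<and> h \<cdot> Fa f' = b"
    using h t Z by (intro exI[of _ "counit Z \<cdot> Fa h"]) (auto simp: hom_iff)
next
  note t = is_pushoutD[OF po]
  fix Z h k assume hk: "h \<in> hom C (Cod C (Fa f')) Z" "k \<in> hom C (Cod C (Fa f')) Z"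
    "h \<cdot> Fa g' = k \<cdot> Fa g'" "h \<cdot> Fa f' = k \<cdot> Fa f'"
  have Z: "Z \<in> Obj C" using hk by (auto simp: hom_iff)
  obtain h' where h': "h' \<in> hom C (Cod C f') (Ro Z)" "counit Z \<cdot> Fa h' = h"
    by (rule transposeE[of h "Cod C f'" Z]) (use hk t in auto)
  obtain k' where k': "k' \<in> hom C (Cod C f') (Ro Z)" "counit Z \<cdot> Fa k' = k"
    by (rule transposeE[of k "Cod C f'" Z]) (use hk t in auto)
  note t' = h'(1)[unfolded hom_iff] k'(1)[unfolded hom_iff]
  have "h' \<cdot> g' = k' \<cdot> g'"
  proof (rule transpose_eq[of _ "Cod C f" Z])
    show "counit Z \<cdot> Fa (h' \<cdot> g') = counit Z \<cdot> Fa (k' \<cdot> g')"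
      using transpose_Cmp[OF Z, of h' g'] transpose_Cmp[OF Z, of k' g'] t t' h' k' hk by simp
  qed (use t t' Z in \<open>auto simp: hom_iff\<close>)
  moreover have "h' \<cdot> f' = k' \<cdot> f'"
  proof (rule transpose_eq[of _ "Cod C g" Z])
    show "counit Z \<cdot> Fa (h' \<cdot> f') = counit Z \<cdot> Fa (k' \<cdot> f')"
      using transpose_Cmp[OF Z, of h' f'] transpose_Cmp[OF Z, of k' f'] t t' h' k' hk by simp
  qed (use t t' Z in \<open>auto simp: hom_iff\<close>)
  ultimately have "h' = k'" using pushout_eq[OF po h'(1) k'(1)] by blast
  then show "h = k" using h' k' by simp
qed (use is_pushoutD[OF po] in simp_all)

lemma preserves_colimit:
  assumes D: "category D" and X: "is_functor D C X \<phi>" and col: "is_colimit D C X \<phi> Z \<iota>"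
  shows "is_colimit D C (Fo \<circ> X) (Fa \<circ> \<phi>) (Fo Z) (Fa \<circ> \<iota>)"
  unfolding is_colimit_def
proof (intro conjI allI impI)
  interpret D: category D by fact
  have cc: "is_cocone D C X \<phi> Z \<iota>" using col by (simp add: is_colimit_def)
  have Z: "Z \<in> Obj C" using cc by (simp add: is_cocone_def)
  have \<iota>: "\<iota> d \<in> Arr C" "Dom C (\<iota> d) = X d" "Cod C (\<iota> d) = Z" if "d \<in> Obj D" for d
    using cc that by (auto simp: is_cocone_def hom_iff)
  have \<phi>: "\<phi> u \<in> Arr C" "Dom C (\<phi> u) = X (Dom D u)" "Cod C (\<phi> u) = X (Cod D u)" if "u \<in> Arr D" for u
    using X that by (auto simp: is_functor_def hom_iff)
  have XO: "X d \<in> Obj C" if "d \<in> Obj D" for d using X that by (auto simp: is_functor_def)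
  have nat: "\<iota> (Cod D u) \<cdot> \<phi> u = \<iota> (Dom D u)" if "u \<in> Arr D" for u
    using cc that by (auto simp: is_cocone_def)
  show "is_cocone D C (Fo \<circ> X) (Fa \<circ> \<phi>) (Fo Z) (Fa \<circ> \<iota>)"
    unfolding is_cocone_def
  proof (intro conjI ballI)
    fix u assume u: "u \<in> Arr D"
    show "(Fa \<circ> \<iota>) (Cod D u) \<cdot> (Fa \<circ> \<phi>) u = (Fa \<circ> \<iota>) (Dom D u)"
      using Fa_Cmp[of "\<phi> u" "\<iota> (Cod D u)"] nat[OF u] \<iota> \<phi> u by simp
  qed (use Z \<iota> in \<open>auto simp: hom_iff\<close>)
  fix Y \<kappa> assume k: "is_cocone D C (Fo \<circ> X) (Fa \<circ> \<phi>) Y \<kappa>"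
  then have Y: "Y \<in> Obj C" by (simp add: is_cocone_def)
  have "\<forall>d \<in> Obj D. \<exists>l. l \<in> hom C (X d) (Ro Y) \<and> counit Y \<cdot> Fa l = \<kappa> d"
  proof
    fix d assume d: "d \<in> Obj D"
    then have "\<kappa> d \<in> hom C (Fo (X d)) Y" using k by (simp add: is_cocone_def)
    then show "\<exists>l. l \<in> hom C (X d) (Ro Y) \<and> counit Y \<cdot> Fa l = \<kappa> d"
      using transposeE XO[OF d] by metis
  qed
  then obtain l where l: "l d \<in> hom C (X d) (Ro Y)" "counit Y \<cdot> Fa (l d) = \<kappa> d" if "d \<in> Obj D" for d
    by metis
  have "is_cocone D C X \<phi> (Ro Y) l"
    unfolding is_cocone_def
  proof (intro conjI ballI)
    fix u assume u: "u \<in> Arr D"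
    note t = \<phi>[OF u] l(1)[of "Cod D u", unfolded hom_iff] l(1)[of "Dom D u", unfolded hom_iff]
    show "l (Cod D u) \<cdot> \<phi> u = l (Dom D u)"
    proof (rule transpose_eq[of _ "X (Dom D u)" Y])
      have "\<kappa> (Cod D u) \<cdot> Fa (\<phi> u) = \<kappa> (Dom D u)" using k u by (simp add: is_cocone_def)
      then show "counit Y \<cdot> Fa (l (Cod D u) \<cdot> \<phi> u) = counit Y \<cdot> Fa (l (Dom D u))"
        using transpose_Cmp[OF Y, of "l (Cod D u)" "\<phi> u"] t l(2) u by simp
    qed (use t u Y in \<open>auto simp: hom_iff\<close>)
  qed (use l Y in auto)
  then have u1: "\<exists>!h. h \<in> hom C Z (Ro Y) \<and> (\<forall>d\<in>Obj D. h \<cdot> \<iota> d = l d)"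
    using col by (simp add: is_colimit_def)
  have iff: "(\<forall>d\<in>Obj D. (counit Y \<cdot> Fa h) \<cdot> (Fa \<circ> \<iota>) d = \<kappa> d) \<longleftrightarrow> (\<forall>d\<in>Obj D. h \<cdot> \<iota> d = l d)"
    if h: "h \<in> hom C Z (Ro Y)" for h
  proof (rule ball_cong[OF refl])
    fix d assume d: "d \<in> Obj D"
    note t = \<iota>[OF d] l(1)[OF d] h
    have "(counit Y \<cdot> Fa h) \<cdot> (Fa \<circ> \<iota>) d = counit Y \<cdot> Fa (h \<cdot> \<iota> d)"
      using transpose_Cmp[OF Y, of h "\<iota> d"] t by (simp add: hom_iff)
    moreover have "counit Y \<cdot> Fa (h \<cdot> \<iota> d) = \<kappa> d \<longleftrightarrow> h \<cdot> \<iota> d = l d"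
      using transpose_eq[of "h \<cdot> \<iota> d" "X d" Y "l d"] l(2)[OF d] t Y by (auto simp: hom_iff)
    ultimately show "((counit Y \<cdot> Fa h) \<cdot> (Fa \<circ> \<iota>) d = \<kappa> d) = (h \<cdot> \<iota> d = l d)" by simp
  qed
  show "\<exists>!h. h \<in> hom C (Fo Z) Y \<and> (\<forall>d\<in>Obj D. h \<cdot> (Fa \<circ> \<iota>) d = \<kappa> d)"
  proof (rule ex_ex1I)
    obtain h where h: "h \<in> hom C Z (Ro Y)" "\<forall>d\<in>Obj D. h \<cdot> \<iota> d = l d" using u1 by blast
    then show "\<exists>h. h \<in> hom C (Fo Z) Y \<and> (\<forall>d\<in>Obj D. h \<cdot> (Fa \<circ> \<iota>) d = \<kappa> d)"
      using iff[OF h(1)] Y by (intro exI[of _ "counit Y \<cdot> Fa h"]) (auto simp: hom_iff)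
  next
    fix g h assume gh: "g \<in> hom C (Fo Z) Y \<and> (\<forall>d\<in>Obj D. g \<cdot> (Fa \<circ> \<iota>) d = \<kappa> d)"
      "h \<in> hom C (Fo Z) Y \<and> (\<forall>d\<in>Obj D. h \<cdot> (Fa \<circ> \<iota>) d = \<kappa> d)"
    obtain g' where g': "g' \<in> hom C Z (Ro Y)" "counit Y \<cdot> Fa g' = g" using gh transposeE Z by metis
    obtain h' where h': "h' \<in> hom C Z (Ro Y)" "counit Y \<cdot> Fa h' = h" using gh transposeE Z by metis
    have "g' = h'" using u1 iff[OF g'(1)] iff[OF h'(1)] g' h' gh by blast
    then show "g = h" using g' h' by simp
  qed
qed

lemma preserves_sequence:
  assumes "is_sequence \<Theta> C r X \<phi>"
  shows "is_sequence \<Theta> C r (Fo \<circ> X) (Fa \<circ> \<phi>)"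
proof -
  have r: "Well_order r" and F: "is_functor (order_category r) C X \<phi>"
    using assms by (auto simp: is_sequence_def)
  have "is_functor (order_category r) C (Fo \<circ> X) (Fa \<circ> \<phi>)"
    using F F_functor unfolding is_functor_def hom_def by (simp add: order_category_def)
  moreover have "is_colimit (order_category (Restr r (underS r c))) C (Fo \<circ> X) (Fa \<circ> \<phi>) ((Fo \<circ> X) c)
      (\<lambda>b. (Fa \<circ> \<phi>) (b, c))" if c: "limit_elem r c" for c
  proof -
    let ?s = "Restr r (underS r c)"
    have "?s \<subseteq> r" by blast
    moreover from this have "Field ?s \<subseteq> Field r" by (rule mono_Field)
    ultimately have "is_functor (order_category ?s) C X \<phi>"
      using F unfolding is_functor_def order_category_def by (auto simp: subset_iff)
    moreover have "category (order_category ?s)"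
      by (rule Well_order_category[OF Well_order_Restr[OF r]])
    moreover have "is_colimit (order_category ?s) C X \<phi> (X c) (\<lambda>b. \<phi> (b, c))"
      using assms c by (simp add: is_sequence_def)
    ultimately have "is_colimit (order_category ?s) C (Fo \<circ> X) (Fa \<circ> \<phi>) (Fo (X c)) (Fa \<circ> (\<lambda>b. \<phi> (b, c)))"
      by (intro preserves_colimit)
    then show ?thesis by (simp add: comp_def)
  qed
  ultimately show ?thesis using assms by (simp add: is_sequence_def)
qed

lemma preserves_transfinite_compositions:
  assumes "f \<in> transfinite_compositions \<Theta> C S" "\<And>s. s \<in> S \<Longrightarrow> Fa s \<in> S'"
  shows "Fa f \<in> transfinite_compositions \<Theta> C S'"
proof -
  obtain r X \<phi> Z \<iota> a where *: "is_sequence \<Theta> C r X \<phi>" "steps_in r \<phi> S"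
      "is_colimit (order_category r) C X \<phi> Z \<iota>" "least_elem r a" "f = \<iota> a"
    using assms(1) unfolding transfinite_compositions_def by blast
  have "is_sequence \<Theta> C r (Fo \<circ> X) (Fa \<circ> \<phi>)" by (rule preserves_sequence[OF *(1)])
  moreover have "steps_in r (Fa \<circ> \<phi>) S'" using *(2) assms(2) by (auto simp: steps_in_def)
  moreover have "is_colimit (order_category r) C (Fo \<circ> X) (Fa \<circ> \<phi>) (Fo Z) (Fa \<circ> \<iota>)"
    by (rule preserves_colimit) (use * in \<open>auto simp: is_sequence_def intro: Well_order_category\<close>)
  ultimately show ?thesis using *(4,5) unfolding transfinite_compositions_def
    by (intro CollectI exI[of _ r] exI[of _ "Fo \<circ> X"] exI[of _ "Fa \<circ> \<phi>"] exI[of _ "Fo Z"]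
        exI[of _ "Fa \<circ> \<iota>"] exI[of _ a] conjI) simp_all
qed

end

section \<open>Transposing push-out corners\<close>

text \<open>The naturality square of \<open>\<tau>\<close> at \<open>f\<close> has a push-out corner, and lifting this corner against \<open>p\<close>
  is again equivalent to lifting \<open>f\<close> against some \<open>p'\<close>. For \<open>F = - \<otimes> U\<close>, \<open>G = - \<otimes> V\<close> and \<open>\<tau> = - \<otimes> g\<close>
  the corner is the push-out product of \<open>f\<close> and \<open>g\<close>.\<close>

locale adjoint_transformation =
  F: left_adjoint C Fo Fa + G: left_adjoint C Go Ga
  for C :: "('o, 'm, 'x) precat_scheme" (structure) and Fo Fa Go Ga +
  fixes \<tau> :: "'o \<Rightarrow> 'm"
  assumes \<tau>_hom: "A \<in> Obj C \<Longrightarrow> \<tau> A \<in> hom C (Fo A) (Go A)"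
    and \<tau>_natural: "f \<in> Arr C \<Longrightarrow> \<tau> (Cod C f) \<cdot> Fa f = Ga f \<cdot> \<tau> (Dom C f)"
begin

lemma \<tau>_typing [simp]: "A \<in> Obj C \<Longrightarrow> \<tau> A \<in> Arr C" "A \<in> Obj C \<Longrightarrow> Dom C (\<tau> A) = Fo A"
    "A \<in> Obj C \<Longrightarrow> Cod C (\<tau> A) = Go A"
  using \<tau>_hom by (auto simp: F.hom_iff)

text \<open>The transformation of right adjoints corresponding to \<open>\<tau>\<close>.\<close>

definition mate :: "'o \<Rightarrow> 'm" where
  "mate Z = (SOME h. h \<in> hom C (G.Ro Z) (F.Ro Z) \<and> F.counit Z \<cdot> Fa h = G.counit Z \<cdot> \<tau> (G.Ro Z))"

lemma mate:
  assumes "Z \<in> Obj C"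
  shows "mate Z \<in> Arr C" "Dom C (mate Z) = G.Ro Z" "Cod C (mate Z) = F.Ro Z"
    "F.counit Z \<cdot> Fa (mate Z) = G.counit Z \<cdot> \<tau> (G.Ro Z)"
proof -
  have "\<exists>h. h \<in> hom C (G.Ro Z) (F.Ro Z) \<and> F.counit Z \<cdot> Fa h = G.counit Z \<cdot> \<tau> (G.Ro Z)"
    by (rule F.transposeE[of "G.counit Z \<cdot> \<tau> (G.Ro Z)" "G.Ro Z" Z])
      (use assms in \<open>auto simp: F.hom_iff\<close>)
  from someI_ex[OF this] show "mate Z \<in> Arr C" "Dom C (mate Z) = G.Ro Z" "Cod C (mate Z) = F.Ro Z"
    "F.counit Z \<cdot> Fa (mate Z) = G.counit Z \<cdot> \<tau> (G.Ro Z)"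
    unfolding mate_def[symmetric] by (auto simp: F.hom_iff)
qed

lemma transpose_mate:
  assumes "Z \<in> Obj C" "u \<in> Arr C" "Cod C u = G.Ro Z"
  shows "F.counit Z \<cdot> Fa (mate Z \<cdot> u) = (G.counit Z \<cdot> Ga u) \<cdot> \<tau> (Dom C u)"
proof -
  have "F.counit Z \<cdot> Fa (mate Z \<cdot> u) = F.counit Z \<cdot> (Fa (mate Z) \<cdot> Fa u)"
    using assms mate[OF assms(1)] by (simp add: F.Fa_Cmp)
  also have "\<dots> = G.counit Z \<cdot> (\<tau> (Cod C u) \<cdot> Fa u)"
    unfolding assms(3)
    by (rule F.Cmp_eq_extend[OF mate(4)]) (use assms mate[OF assms(1)] in simp_all)
  also have "\<dots> = G.counit Z \<cdot> (Ga u \<cdot> \<tau> (Dom C u))"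
    using \<tau>_natural assms(2) by simp
  also have "\<dots> = (G.counit Z \<cdot> Ga u) \<cdot> \<tau> (Dom C u)"
    using assms by simp
  finally show ?thesis .
qed

text \<open>For \<open>p : Z \<rightarrow> Y\<close>, the arrow \<open>p'\<close> goes from \<open>G.Ro Z\<close> to the pull-back of \<open>F.Ra p\<close> and \<open>mate Y\<close>; it is
  the pull-back power of \<open>p\<close> in the case of a tensor product.\<close>

lemma corner_lift_transpose:
  fixes \<Theta> :: "'u rel"
  assumes "universe \<Theta>" "complete \<Theta> C" and p: "p \<in> Arr C"
  shows "\<exists>p' \<in> Arr C. \<forall>f \<in> Arr C.
    corner_lift C (\<tau> (Dom C f)) (Fa f) (Ga f) (\<tau> (Cod C f)) p \<longleftrightarrow> has_lift C f p'"
proof -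
  define Z where "Z = Dom C p"
  define Y where "Y = Cod C p"
  have ZY: "Z \<in> Obj C" "Y \<in> Obj C" using p by (auto simp: Z_def Y_def)
  note m = mate[OF ZY(1)] mate[OF ZY(2)]
  obtain b1 b2 where pb: "is_pullback C (F.Ra p) (mate Y) b1 b2"
    using F.pullback_exists[OF assms(1,2), of "F.Ra p" "mate Y"] p m by (auto simp: Y_def)
  then have b: "b1 \<in> Arr C" "b2 \<in> Arr C" "Cod C b1 = F.Ro Z" "Cod C b2 = G.Ro Y" "Dom C b1 = Dom C b2"
      "F.Ra p \<cdot> b1 = mate Y \<cdot> b2"
    using p m by (auto simp: is_pullback_def Z_def)
  have "F.Ra p \<cdot> mate Z = mate Y \<cdot> G.Ra p"
  proof (rule F.transpose_eq[of _ "G.Ro Z" Y])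
    have "F.counit Y \<cdot> Fa (F.Ra p \<cdot> mate Z) = p \<cdot> (G.counit Z \<cdot> \<tau> (G.Ro Z))"
      using F.transpose_Ra[OF p, of "mate Z"] m p by (simp add: Z_def Y_def)
    also have "\<dots> = (G.counit Y \<cdot> Ga (G.Ra p)) \<cdot> \<tau> (G.Ro Z)"
      using G.Ra(4)[OF p] p ZY by (simp add: Z_def Y_def)
    also have "\<dots> = F.counit Y \<cdot> Fa (mate Y \<cdot> G.Ra p)"
      using transpose_mate[of Y "G.Ra p"] p ZY by (simp add: Z_def Y_def)
    finally show "F.counit Y \<cdot> Fa (F.Ra p \<cdot> mate Z) = F.counit Y \<cdot> Fa (mate Y \<cdot> G.Ra p)" .
  qed (use p m ZY in \<open>auto simp: F.hom_iff Z_def Y_def\<close>)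
  then obtain p' where p': "p' \<in> hom C (G.Ro Z) (Dom C b2)"
      "b1 \<cdot> p' = mate Z" "b2 \<cdot> p' = G.Ra p"
    using F.pullback_induced[OF pb, of "mate Z" "G.Ro Z" "G.Ra p"] p m ZY
    by (auto simp: F.hom_iff Z_def Y_def)
  note tp' = p'(1)[unfolded F.hom_iff]
  have "corner_lift C (\<tau> (Dom C f)) (Fa f) (Ga f) (\<tau> (Cod C f)) p \<longleftrightarrow> has_lift C f p'"
    if f: "f \<in> Arr C" for f
  proof
    assume L: "corner_lift C (\<tau> (Dom C f)) (Fa f) (Ga f) (\<tau> (Cod C f)) p"
    show "has_lift C f p'"
    proof (rule F.has_liftI)
      fix u v assume uv: "u \<in> Arr C" "v \<in> Arr C" "Dom C u = Dom C f" "Cod C u = Dom C p'"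
        "Dom C v = Cod C f" "Cod C v = Cod C p'" "p' \<cdot> u = v \<cdot> f"
      have "b1 \<cdot> (p' \<cdot> u) = b1 \<cdot> (v \<cdot> f)" "b2 \<cdot> (p' \<cdot> u) = b2 \<cdot> (v \<cdot> f)" using uv(7) by simp_all
      then have 1: "mate Z \<cdot> u = (b1 \<cdot> v) \<cdot> f" and 2: "G.Ra p \<cdot> u = (b2 \<cdot> v) \<cdot> f"
        using F.Cmp_eq_collapse[OF p'(2), of u] F.Cmp_eq_collapse[OF p'(3), of u] b uv tp' f by simp_all
      \<comment> \<open>Transposing a square from \<open>f\<close> to \<open>p'\<close> gives the data \<open>a\<close>, \<open>b'\<close>, \<open>c\<close> of a corner lifting problem.\<close>
      define a where "a = G.counit Z \<cdot> Ga u"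
      define b' where "b' = F.counit Z \<cdot> Fa (b1 \<cdot> v)"
      define c where "c = G.counit Y \<cdot> Ga (b2 \<cdot> v)"
      have ta: "a \<in> hom C (Go (Dom C f)) Z" "b' \<in> hom C (Fo (Cod C f)) Z" "c \<in> hom C (Go (Cod C f)) Y"
        using uv b tp' ZY f by (auto simp: a_def b'_def c_def F.hom_iff)
      have "a \<cdot> \<tau> (Dom C f) = F.counit Z \<cdot> Fa (mate Z \<cdot> u)"
        using transpose_mate[OF ZY(1), of u] uv tp' by (simp add: a_def)
      also have "\<dots> = b' \<cdot> Fa f"
        unfolding 1 b'_def by (rule F.transpose_Cmp) (use uv b tp' f ZY in auto)
      finally have e1: "a \<cdot> \<tau> (Dom C f) = b' \<cdot> Fa f" .
      have "p \<cdot> a = G.counit Y \<cdot> Ga (G.Ra p \<cdot> u)"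
        using G.transpose_Ra[OF p, of u] uv tp' by (simp add: a_def Z_def Y_def)
      also have "\<dots> = c \<cdot> Ga f"
        unfolding 2 c_def by (rule G.transpose_Cmp) (use uv b tp' f ZY in auto)
      finally have e2: "p \<cdot> a = c \<cdot> Ga f" .
      have "p \<cdot> b' = F.counit Y \<cdot> Fa (F.Ra p \<cdot> (b1 \<cdot> v))"
        using F.transpose_Ra[OF p, of "b1 \<cdot> v"] uv tp' b by (simp add: b'_def Z_def Y_def)
      also have "F.Ra p \<cdot> (b1 \<cdot> v) = mate Y \<cdot> (b2 \<cdot> v)"
        by (rule F.Cmp_eq_extend[OF b(6)]) (use b uv tp' p m in \<open>auto simp: Z_def Y_def\<close>)
      also have "F.counit Y \<cdot> Fa (mate Y \<cdot> (b2 \<cdot> v)) = c \<cdot> \<tau> (Cod C f)"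
        using transpose_mate[OF ZY(2), of "b2 \<cdot> v"] uv tp' b by (simp add: c_def)
      finally have e3: "p \<cdot> b' = c \<cdot> \<tau> (Cod C f)" .
      obtain d where d: "d \<in> hom C (Go (Cod C f)) Z" "d \<cdot> Ga f = a" "d \<cdot> \<tau> (Cod C f) = b'" "p \<cdot> d = c"
        by (rule corner_liftE[OF L, of a b' c]) (use ta e1 e2 e3 f in \<open>simp_all add: Z_def Y_def\<close>)
      obtain h where h: "h \<in> hom C (Cod C f) (G.Ro Z)" "G.counit Z \<cdot> Ga h = d"
        by (rule G.transposeE[OF d(1)]) (use f in auto)
      note th = h(1)[unfolded F.hom_iff]
      have "h \<cdot> f = u"
      proof (rule G.transpose_eq[of _ "Dom C f" Z])
        show "G.counit Z \<cdot> Ga (h \<cdot> f) = G.counit Z \<cdot> Ga u"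
          using G.transpose_Cmp[OF ZY(1), of h f] th f h d by (simp add: a_def)
      qed (use th f uv tp' ZY in \<open>auto simp: F.hom_iff\<close>)
      moreover have "p' \<cdot> h = v"
      proof -
        have "b1 \<cdot> (p' \<cdot> h) = mate Z \<cdot> h" "b2 \<cdot> (p' \<cdot> h) = G.Ra p \<cdot> h"
          using F.Cmp_eq_collapse[OF p'(2), of h] F.Cmp_eq_collapse[OF p'(3), of h] b th tp' by simp_all
        moreover have "mate Z \<cdot> h = b1 \<cdot> v"
        proof (rule F.transpose_eq[of _ "Cod C f" Z])
          show "F.counit Z \<cdot> Fa (mate Z \<cdot> h) = F.counit Z \<cdot> Fa (b1 \<cdot> v)"
            using transpose_mate[OF ZY(1), of h] th h d by (simp add: b'_def)
        qed (use th f uv tp' ZY m b in \<open>auto simp: F.hom_iff\<close>)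
        moreover have "G.Ra p \<cdot> h = b2 \<cdot> v"
        proof (rule G.transpose_eq[of _ "Cod C f" Y])
          show "G.counit Y \<cdot> Ga (G.Ra p \<cdot> h) = G.counit Y \<cdot> Ga (b2 \<cdot> v)"
            using G.transpose_Ra[OF p, of h] th h d by (simp add: c_def Z_def Y_def)
        qed (use th f uv tp' ZY b p in \<open>auto simp: F.hom_iff Z_def Y_def\<close>)
        ultimately have "b1 \<cdot> (p' \<cdot> h) = b1 \<cdot> v" "b2 \<cdot> (p' \<cdot> h) = b2 \<cdot> v" by simp_all
        moreover have "p' \<cdot> h \<in> hom C (Cod C f) (Dom C b2)" "v \<in> hom C (Cod C f) (Dom C b2)"
          using th tp' uv(1-6) by (simp_all add: F.hom_iff)
        ultimately show ?thesis by (rule F.pullback_eq[OF pb, rotated 2])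
      qed
      ultimately show "\<exists>h. h \<in> Arr C \<and> Dom C h = Cod C f \<and> Cod C h = Dom C p' \<and> h \<cdot> f = u \<and> p' \<cdot> h = v"
        using th tp' by auto
    qed
  next
    assume L: "has_lift C f p'"
    show "corner_lift C (\<tau> (Dom C f)) (Fa f) (Ga f) (\<tau> (Cod C f)) p"
      unfolding corner_lift_def
    proof (intro ballI impI, elim conjE)
      fix a b' c assume "a \<in> hom C (Cod C (\<tau> (Dom C f))) (Dom C p)" "b' \<in> hom C (Cod C (Fa f)) (Dom C p)"
        "c \<in> hom C (Cod C (Ga f)) (Cod C p)" and e1: "a \<cdot> \<tau> (Dom C f) = b' \<cdot> Fa f"
        and e2: "p \<cdot> a = c \<cdot> Ga f" and e3: "p \<cdot> b' = c \<cdot> \<tau> (Cod C f)"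
      then have ta: "a \<in> hom C (Go (Dom C f)) Z" "b' \<in> hom C (Fo (Cod C f)) Z" "c \<in> hom C (Go (Cod C f)) Y"
        using f by (auto simp: Z_def Y_def)
      obtain u where u: "u \<in> hom C (Dom C f) (G.Ro Z)" "G.counit Z \<cdot> Ga u = a"
        by (rule G.transposeE[OF ta(1)]) (use f in auto)
      obtain v1 where v1: "v1 \<in> hom C (Cod C f) (F.Ro Z)" "F.counit Z \<cdot> Fa v1 = b'"
        by (rule F.transposeE[OF ta(2)]) (use f in auto)
      obtain v2 where v2: "v2 \<in> hom C (Cod C f) (G.Ro Y)" "G.counit Y \<cdot> Ga v2 = c"
        by (rule G.transposeE[OF ta(3)]) (use f in auto)
      note t = u(1)[unfolded F.hom_iff] v1(1)[unfolded F.hom_iff] v2(1)[unfolded F.hom_iff]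
      have "F.Ra p \<cdot> v1 = mate Y \<cdot> v2"
      proof (rule F.transpose_eq[of _ "Cod C f" Y])
        show "F.counit Y \<cdot> Fa (F.Ra p \<cdot> v1) = F.counit Y \<cdot> Fa (mate Y \<cdot> v2)"
          using F.transpose_Ra[OF p, of v1] transpose_mate[OF ZY(2), of v2] t v1 v2 e3
          by (simp add: Z_def Y_def)
      qed (use t f p m ZY in \<open>auto simp: F.hom_iff Z_def Y_def\<close>)
      then obtain v where v: "v \<in> hom C (Cod C f) (Dom C b2)" "b1 \<cdot> v = v1" "b2 \<cdot> v = v2"
        using F.pullback_induced[OF pb, of v1 "Cod C f" v2] v1 v2 p m by (auto simp: Z_def)
      note tv = v(1)[unfolded F.hom_iff]
      have "p' \<cdot> u = v \<cdot> f"
      proof -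
        have "b1 \<cdot> (p' \<cdot> u) = mate Z \<cdot> u" "b2 \<cdot> (p' \<cdot> u) = G.Ra p \<cdot> u"
          using F.Cmp_eq_collapse[OF p'(2), of u] F.Cmp_eq_collapse[OF p'(3), of u] b t tp' by simp_all
        moreover have "b1 \<cdot> (v \<cdot> f) = v1 \<cdot> f" "b2 \<cdot> (v \<cdot> f) = v2 \<cdot> f"
          using F.Cmp_eq_collapse[OF v(2), of f] F.Cmp_eq_collapse[OF v(3), of f] b t tv f by simp_all
        moreover have "mate Z \<cdot> u = v1 \<cdot> f"
        proof (rule F.transpose_eq[of _ "Dom C f" Z])
          show "F.counit Z \<cdot> Fa (mate Z \<cdot> u) = F.counit Z \<cdot> Fa (v1 \<cdot> f)"
            using transpose_mate[OF ZY(1), of u] F.transpose_Cmp[OF ZY(1), of v1 f] t u v1 e1 f by simp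
        qed (use t f ZY m in \<open>auto simp: F.hom_iff\<close>)
        moreover have "G.Ra p \<cdot> u = v2 \<cdot> f"
        proof (rule G.transpose_eq[of _ "Dom C f" Y])
          show "G.counit Y \<cdot> Ga (G.Ra p \<cdot> u) = G.counit Y \<cdot> Ga (v2 \<cdot> f)"
            using G.transpose_Ra[OF p, of u] G.transpose_Cmp[OF ZY(2), of v2 f] t u v2 e2 f
            by (simp add: Z_def Y_def)
        qed (use t f ZY p in \<open>auto simp: F.hom_iff Z_def Y_def\<close>)
        ultimately have "b1 \<cdot> (p' \<cdot> u) = b1 \<cdot> (v \<cdot> f)" "b2 \<cdot> (p' \<cdot> u) = b2 \<cdot> (v \<cdot> f)" by simp_all
        moreover have "p' \<cdot> u \<in> hom C (Dom C f) (Dom C b2)" "v \<cdot> f \<in> hom C (Dom C f) (Dom C b2)"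
          using t tp' tv f by (simp_all add: F.hom_iff)
        ultimately show ?thesis by (rule F.pullback_eq[OF pb, rotated 2])
      qed
      then obtain h where h: "h \<in> Arr C" "Dom C h = Cod C f" "Cod C h = G.Ro Z" "h \<cdot> f = u" "p' \<cdot> h = v"
        using t tv tp' f by (elim F.has_liftE[OF L, of u v, rotated 6]) simp_all
      have 1: "mate Z \<cdot> h = v1" "G.Ra p \<cdot> h = v2"
        using F.Cmp_eq_collapse[OF p'(2), of h] F.Cmp_eq_collapse[OF p'(3), of h] h v tp' b by simp_all
      have "(G.counit Z \<cdot> Ga h) \<cdot> Ga f = a" "(G.counit Z \<cdot> Ga h) \<cdot> \<tau> (Cod C f) = b'"
        "p \<cdot> (G.counit Z \<cdot> Ga h) = c"
        using G.transpose_Cmp[OF ZY(1), of h f] transpose_mate[OF ZY(1), of h]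
          G.transpose_Ra[OF p, of h] h 1 u v1 v2 f by (simp_all add: Z_def Y_def)
      then show "\<exists>d\<in>hom C (Cod C (Ga f)) (Dom C p). d \<cdot> Ga f = a \<and> d \<cdot> \<tau> (Cod C f) = b' \<and> p \<cdot> d = c"
        using h f ZY by (intro bexI[of _ "G.counit Z \<cdot> Ga h"]) (auto simp: F.hom_iff Z_def)
    qed
  qed
  then show ?thesis using tp' by blast
qed

end

section \<open>Making an object cofibrant\<close>

text \<open>Such a functor compares the structure in which \<open>U\<close> has been made cofibrant with the given
  one: weak equivalences can be tested after applying it, and it turns the additional cofibrations
  into cofibrations of the given structure.\<close>

locale resolving_functor = left_adjoint C Fo Fa + model_category C \<Theta> W Cof Fib
  for C :: "('o, 'm, 'x) precat_scheme" (structure) and Fo Fa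
    and \<Theta> :: "'u rel" and W Cof Fib :: "'m set" +
  fixes U :: 'o
  assumes Fa_Cof: "f \<in> Cof \<Longrightarrow> Fa f \<in> Cof"
    and Fa_W: "f \<in> Arr C \<Longrightarrow> Fa f \<in> W \<longleftrightarrow> f \<in> W"
    and Fo_cofibrant: "cofibrant C Cof (Fo U)"

text \<open>The tensor unit enters the construction of the new model structure as an object \<open>U\<close> for which a
  resolving functor exists, and the setting is abstracted accordingly.\<close>

locale enlargement = model_category C \<Theta> W Cof Fib
  for C :: "('o, 'm, 'x) precat_scheme" (structure)
    and \<Theta> :: "'u rel" and W Cof Fib :: "'m set" +
  fixes I J :: "'m set" and q j p i1 i2 e :: 'm and S E U :: 'o
  assumes universe: "universe \<Theta>"
    and I_Arr: "I \<subseteq> Arr C" and J_Arr: "J \<subseteq> Arr C"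
    and Fib_eq: "Fib = inj_class C J" and trivial_Fib_eq: "Fib \<inter> W = inj_class C I"
    and q_W: "q \<in> W" and q_cofibrant: "cofibrant C Cof (Dom C q)"
    and coproduct: "is_coproduct C (Dom C q) U S i1 i2"
    and j_Cof: "j \<in> Cof" and Dom_j: "Dom C j = S"
    and p_W: "p \<in> W" and Dom_p: "Dom C p = Cod C j" and Cod_p: "Cod C p = U"
    and p_j_i1: "p \<cdot> j \<cdot> i1 = q" and p_j_i2: "p \<cdot> j \<cdot> i2 = Ident C U"
    and E_initial: "is_initial C E" and e_hom: "e \<in> hom C E U"
    and resolution: "\<exists>Fo Fa. resolving_functor C Fo Fa \<Theta> W Cof Fib U"
begin

definition Fib' :: "'m set" where
  "Fib' = inj_class C (insert (j \<cdot> i1) J)"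

definition Cof' :: "'m set" where
  "Cof' = llp C (inj_class C (insert e I))"

lemma typing [simp]:
  "q \<in> Arr C" "j \<in> Arr C" "p \<in> Arr C" "Dom C j = S" "Dom C p = Cod C j" "Cod C p = U"
  "i1 \<in> Arr C" "Dom C i1 = Dom C q" "Cod C i1 = S" "i2 \<in> Arr C" "Dom C i2 = U" "Cod C i2 = S"
  "e \<in> Arr C" "Dom C e = E" "Cod C e = U" "S \<in> Obj C" "U \<in> Obj C" "E \<in> Obj C" "Cod C q = U"
proof -
  show t: "q \<in> Arr C" "j \<in> Arr C" "p \<in> Arr C" "Dom C j = S" "Dom C p = Cod C j" "Cod C p = U"
    "i1 \<in> Arr C" "Dom C i1 = Dom C q" "Cod C i1 = S" "i2 \<in> Arr C" "Dom C i2 = U" "Cod C i2 = S"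
    "e \<in> Arr C" "Dom C e = E" "Cod C e = U"
    using q_W p_W W_Arr j_Cof Cof_Arr Dom_j Dom_p Cod_p coproduct e_hom
    by (auto simp: is_coproduct_def hom_iff)
  show "S \<in> Obj C" "U \<in> Obj C" "E \<in> Obj C"
    using Dom_Cod_Obj[OF t(2)] Dom_Cod_Obj[OF t(13)] t by auto
  show "Cod C q = U" unfolding p_j_i1[symmetric] using t by simp
qed

lemma p_j_i: "p \<cdot> (j \<cdot> i1) = q" "p \<cdot> (j \<cdot> i2) = Ident C U"
  using p_j_i1 p_j_i2 by simp_all

lemma coproduct_induced:
  assumes "a \<in> hom C (Dom C q) Z" "b \<in> hom C U Z"
  obtains h where "h \<in> Arr C" "Dom C h = S" "Cod C h = Z" "h \<cdot> i1 = a" "h \<cdot> i2 = b"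
proof -
  have "Z \<in> Obj C" using assms by (auto simp: hom_iff)
  then obtain h where "h \<in> hom C S Z" "h \<cdot> i1 = a" "h \<cdot> i2 = b"
    using coproduct assms unfolding is_coproduct_def by blast
  then show thesis using that by (auto simp: hom_iff)
qed

lemma coproduct_eq:
  assumes "h \<in> Arr C" "k \<in> Arr C" "Dom C h = S" "Dom C k = S" "Cod C h = Cod C k"
    and "h \<cdot> i1 = k \<cdot> i1" "h \<cdot> i2 = k \<cdot> i2"
  shows "h = k"
proof -
  have "k \<cdot> i1 \<in> hom C (Dom C q) (Cod C k)" "k \<cdot> i2 \<in> hom C U (Cod C k)" "Cod C k \<in> Obj C"
    using assms by (auto simp: hom_iff)
  then have "\<exists>!h. h \<in> hom C S (Cod C k) \<and> h \<cdot> i1 = k \<cdot> i1 \<and> h \<cdot> i2 = k \<cdot> i2"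
    using coproduct unfolding is_coproduct_def by blast
  moreover have "h \<in> hom C S (Cod C k)" "k \<in> hom C S (Cod C k)" using assms by (auto simp: hom_iff)
  ultimately show ?thesis using assms by blast
qed

lemma inj_class_Arr: "inj_class C K \<subseteq> Arr C"
  by (auto simp: inj_class_def)

lemma generators_Cof: "I \<subseteq> Cof" "J \<subseteq> Cof \<inter> W"
proof -
  show "I \<subseteq> Cof"
    unfolding Cof_eq_llp trivial_Fib_eq using I_Arr by (auto simp: llp_def inj_class_def)
  show "J \<subseteq> Cof \<inter> W"
    unfolding trivial_Cof_eq_llp Fib_eq using J_Arr by (auto simp: llp_def inj_class_def)
qed

lemma inj_class_insert_e: "inj_class C (insert e I) \<subseteq> Fib \<inter> W"
  unfolding trivial_Fib_eq by (auto simp: inj_class_def)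

lemma Fib'_subset: "Fib' \<subseteq> Fib"
  unfolding Fib_eq Fib'_def by (auto simp: inj_class_def)

lemma Cof_subset: "Cof \<subseteq> Cof'"
  unfolding Cof_eq_llp Cof'_def llp_def using inj_class_insert_e by auto

lemma trivial_Cof_subset: "Cof \<inter> W \<subseteq> llp C Fib'"
  unfolding trivial_Cof_eq_llp llp_def using Fib'_subset by auto

lemma e_Cof': "e \<in> Cof'"
  unfolding Cof'_def llp_def inj_class_def by auto

lemma lift_U:
  assumes "has_lift C e r" "r \<in> Arr C" "y \<in> hom C U (Cod C r)"
  shows "\<exists>h \<in> hom C U (Dom C r). r \<cdot> h = y"
proof -
  obtain u where u: "u \<in> hom C E (Dom C r)" using E_initial assms(2) unfolding is_initial_def by force
  have "r \<cdot> u = y \<cdot> e"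
    by (rule initial_hom_eq[OF E_initial, of _ "Cod C r"]) (use assms u in \<open>auto simp: hom_iff\<close>)
  then obtain h where "h \<in> Arr C" "Dom C h = Cod C e" "Cod C h = Dom C r" "r \<cdot> h = y"
    using assms u by (elim has_liftE[OF assms(1), of u y, rotated 6]) (auto simp: hom_iff)
  then show ?thesis by (auto simp: hom_iff)
qed

text \<open>The inclusion \<open>i1\<close> is a push-out of \<open>e\<close>: a lift on the second summand suffices.\<close>

lemma i1_Cof': "i1 \<in> Cof'"
proof -
  have "has_lift C i1 r" if r: "r \<in> inj_class C (insert e I)" for r
  proof (rule has_liftI)
    fix u v assume uv: "u \<in> Arr C" "v \<in> Arr C" "Dom C u = Dom C i1" "Cod C u = Dom C r"
      "Dom C v = Cod C i1" "Cod C v = Cod C r" "r \<cdot> u = v \<cdot> i1"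
    have rA: "r \<in> Arr C" "has_lift C e r" using r by (auto simp: inj_class_def)
    obtain b where b: "b \<in> hom C U (Dom C r)" "r \<cdot> b = v \<cdot> i2"
      using lift_U[OF rA(2,1), of "v \<cdot> i2"] uv by (auto simp: hom_iff)
    obtain h where h: "h \<in> Arr C" "Dom C h = S" "Cod C h = Dom C r" "h \<cdot> i1 = u" "h \<cdot> i2 = b"
      by (rule coproduct_induced[of u "Dom C r" b]) (use uv b in \<open>auto simp: hom_iff\<close>)
    have "r \<cdot> h = v"
      by (rule coproduct_eq) (use h rA uv b in auto)
    then show "\<exists>h. h \<in> Arr C \<and> Dom C h = Cod C i1 \<and> Cod C h = Dom C r \<and> h \<cdot> i1 = u \<and> r \<cdot> h = v"
      using h by auto
  qed
  then show ?thesis by (simp add: Cof'_def llp_def)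
qed

lemma Cof'_subcategory: "wide_subcategory C Cof'"
  unfolding Cof'_def by (rule llp_wide_subcategory[OF inj_class_Arr])

lemma j_i1_Cof': "j \<cdot> i1 \<in> Cof'"
  using Cof'_subcategory i1_Cof' j_Cof Cof_subset by (auto simp: wide_subcategory_def)

lemma j_i1_W: "j \<cdot> i1 \<in> W"
  by (rule W_cancel_left[of _ p]) (use p_W q_W p_j_i in auto)

text \<open>Let \<open>r\<close> be a trivial fibration with the right lifting property against \<open>j \<cdot> i1\<close>, and let
  \<open>y : U \<rightarrow> Cod r\<close>. Then \<open>y \<cdot> q\<close> lifts through \<open>r\<close> because \<open>Dom q\<close> is cofibrant; this lift extends along
  \<open>j \<cdot> i1\<close> to a lift of \<open>y \<cdot> p\<close>, and \<open>p \<cdot> j \<cdot> i2 = 1\<close> turns it into a lift of \<open>y\<close>.\<close>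

lemma trivial_Fib'_eq: "Fib' \<inter> W = inj_class C (insert e I)"
proof
  show "inj_class C (insert e I) \<subseteq> Fib' \<inter> W"
  proof
    fix r assume r: "r \<in> inj_class C (insert e I)"
    then have "r \<in> Fib \<inter> W" using inj_class_insert_e by auto
    moreover have "has_lift C (j \<cdot> i1) r" using j_i1_Cof' r by (auto simp: Cof'_def llp_def)
    ultimately show "r \<in> Fib' \<inter> W" unfolding Fib_eq Fib'_def by (auto simp: inj_class_def)
  qed
  show "Fib' \<inter> W \<subseteq> inj_class C (insert e I)"
  proof
    fix r assume r: "r \<in> Fib' \<inter> W"
    then have rA: "r \<in> Arr C" and rF: "r \<in> Fib \<inter> W" and rj: "has_lift C (j \<cdot> i1) r"
      using Fib'_subset by (auto simp: Fib'_def inj_class_def)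
    have "has_lift C e r"
    proof (rule has_lift_initialI)
      fix y assume "y \<in> hom C (Cod C e) (Cod C r)"
      then have y: "y \<in> Arr C" "Dom C y = U" "Cod C y = Cod C r" by (auto simp: hom_iff)
      have "y \<cdot> q \<in> hom C (Dom C q) (Cod C r)" using y by (auto simp: hom_iff)
      from cofibrant_lift[OF q_cofibrant rF this]
      obtain a where a: "a \<in> hom C (Dom C q) (Dom C r)" "r \<cdot> a = y \<cdot> q" by blast
      have "r \<cdot> a = (y \<cdot> p) \<cdot> (j \<cdot> i1)" using a y p_j_i by simp
      then obtain h where h: "h \<in> Arr C" "Dom C h = Cod C j" "Cod C h = Dom C r" "r \<cdot> h = y \<cdot> p"
        using y a rA by (elim has_liftE[OF rj, of a "y \<cdot> p", rotated 6]) (auto simp: hom_iff)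
      have "r \<cdot> (h \<cdot> (j \<cdot> i2)) = (y \<cdot> p) \<cdot> (j \<cdot> i2)"
        by (rule Cmp_eq_collapse[OF h(4)]) (use h rA in auto)
      also have "\<dots> = y" using y p_j_i by simp
      finally show "\<exists>h\<in>hom C (Cod C e) (Dom C r). r \<cdot> h = y"
        using h by (intro bexI[of _ "h \<cdot> (j \<cdot> i2)"]) (auto simp: hom_iff)
    qed (use E_initial rA in auto)
    then show "r \<in> inj_class C (insert e I)"
      using rF unfolding trivial_Fib_eq by (auto simp: inj_class_def)
  qed
qed

text \<open>By transposition it is enough to look at the generators. For \<open>e\<close> the claim is that \<open>Fo U\<close> is
  cofibrant, as \<open>Fo E\<close> is initial.\<close>

lemma resolving_Cof':
  assumes "resolving_functor C Fo Fa \<Theta> W Cof Fib U" "f \<in> Cof'"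
  shows "Fa f \<in> Cof"
proof -
  interpret F: resolving_functor C Fo Fa \<Theta> W Cof Fib U by fact
  have f: "f \<in> Arr C" using assms(2) by (simp add: Cof'_def llp_def)
  have "has_lift C (Fa f) r" if r: "r \<in> Fib \<inter> W" for r
  proof -
    have rA: "r \<in> Arr C" using r Fib_Arr by auto
    have "has_lift C i (F.Ra r)" if i: "i \<in> I" for i
    proof -
      have "Fa i \<in> Cof" "i \<in> Arr C" using i F.Fa_Cof generators_Cof I_Arr by auto
      then show ?thesis using F.transpose_lift[OF rA] lift_Cof r by blast
    qed
    moreover have "has_lift C (Fa e) r"
      by (rule has_lift_initialI)
        (use rA F.preserves_initial[OF E_initial] cofibrant_lift[OF F.Fo_cofibrant r] in auto)
    then have "has_lift C e (F.Ra r)" using F.transpose_lift[OF rA] by simp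
    ultimately have "F.Ra r \<in> inj_class C (insert e I)" using rA by (auto simp: inj_class_def)
    then show ?thesis using F.transpose_lift[OF rA f] assms(2) by (auto simp: Cof'_def llp_def)
  qed
  then show ?thesis unfolding Cof_eq_llp using f by (simp add: llp_def)
qed

text \<open>The generator \<open>j \<cdot> i1\<close> is a weak equivalence in \<open>Cof'\<close>, so that the previous lemma makes
  \<open>Fa (j \<cdot> i1)\<close> a trivial cofibration, although \<open>j \<cdot> i1\<close> itself may fail to be a cofibration of
  the given structure.\<close>

lemma resolving_trivial_Cof':
  assumes "resolving_functor C Fo Fa \<Theta> W Cof Fib U" "f \<in> llp C Fib'"
  shows "Fa f \<in> Cof \<inter> W"
proof -
  interpret F: resolving_functor C Fo Fa \<Theta> W Cof Fib U by fact
  have f: "f \<in> Arr C" using assms(2) by (simp add: llp_def)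
  have "has_lift C (Fa f) r" if r: "r \<in> Fib" for r
  proof -
    have rA: "r \<in> Arr C" using r Fib_Arr by auto
    have "has_lift C i (F.Ra r)" if i: "i \<in> insert (j \<cdot> i1) J" for i
    proof -
      have "i \<in> Cof'" "i \<in> W" "i \<in> Arr C"
        using i j_i1_Cof' j_i1_W generators_Cof Cof_subset J_Arr by auto
      then have "Fa i \<in> Cof \<inter> W" using F.Fa_W resolving_Cof'[OF assms(1)] by auto
      then show ?thesis using F.transpose_lift[OF rA \<open>i \<in> Arr C\<close>] lift_Fib[OF _ r] by blast
    qed
    then have "F.Ra r \<in> Fib'" using rA by (auto simp: Fib'_def inj_class_def)
    then show ?thesis using F.transpose_lift[OF rA f] assms(2) by (auto simp: llp_def)
  qed
  then show ?thesis unfolding trivial_Cof_eq_llp using f by (simp add: llp_def)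
qed

text \<open>The heart of the matter: the arrows on the left, such as push-outs of \<open>j \<cdot> i1\<close>, are weak
  equivalences because a resolving functor makes them trivial cofibrations and reflects weak
  equivalences.\<close>

lemma llp_Fib'_subset: "llp C Fib' \<subseteq> Cof' \<inter> W"
proof
  fix f assume f: "f \<in> llp C Fib'"
  obtain Fo Fa where F: "resolving_functor C Fo Fa \<Theta> W Cof Fib U" using resolution by blast
  interpret F: resolving_functor C Fo Fa \<Theta> W Cof Fib U by fact
  have "f \<in> W" using resolving_trivial_Cof'[OF F f] F.Fa_W[of f] f by (simp add: llp_def)
  moreover have "f \<in> Cof'" using f trivial_Fib'_eq unfolding Cof'_def llp_def by auto
  ultimately show "f \<in> Cof' \<inter> W" by simp
qed

text \<open>Once a copy of \<open>U\<close> has been adjoined for every arrow \<open>U \<rightarrow> Cod f\<close>, these arrows factor through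
  whatever comes next in a factorization of \<open>f\<close>; the rest is done by a factorization of the given
  structure.\<close>

lemma factor_Cof':
  assumes f: "f \<in> Arr C"
  shows "\<exists>i \<in> Cof'. \<exists>r \<in> Fib' \<inter> W. Cod C i = Dom C r \<and> f = r \<cdot> i"
proof -
  obtain a where a: "a \<in> hom C E (Dom C f)" using E_initial f unfolding is_initial_def by force
  have T: "small \<Theta> (hom C U (Cod C f))" using locally_small f by (auto simp: locally_small_def)
  obtain X1 x b where x: "x \<in> hom C (Dom C f) X1" "x \<in> Cof'"
    and b: "\<And>t. t \<in> hom C U (Cod C f) \<Longrightarrow> b t \<in> hom C U X1"
    and ex: "\<And>Y y c. \<lbrakk>y \<in> hom C (Dom C f) Y; \<And>t. t \<in> hom C U (Cod C f) \<Longrightarrow> c t \<in> hom C U Y;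
       \<And>t. t \<in> hom C U (Cod C f) \<Longrightarrow> c t \<cdot> e = y \<cdot> a\<rbrakk> \<Longrightarrow>
       \<exists>h. h \<in> hom C X1 Y \<and> h \<cdot> x = y \<and> (\<forall>t \<in> hom C U (Cod C f). h \<cdot> b t = c t)"
    by (rule attachment_llp[OF universe cocomplete T, of "Dom C f" "inj_class C (insert e I)" "\<lambda>_. e" "\<lambda>_. a"])
      (use f a e_Cof' inj_class_Arr in \<open>auto simp: Cof'_def\<close>)
  have "t \<cdot> e = f \<cdot> a" if "t \<in> hom C U (Cod C f)" for t
    by (rule initial_hom_eq[OF E_initial, of _ "Cod C f"]) (use that a f in \<open>auto simp: hom_iff\<close>)
  then obtain h where h: "h \<in> hom C X1 (Cod C f)" "h \<cdot> x = f" "\<And>t. t \<in> hom C U (Cod C f) \<Longrightarrow> h \<cdot> b t = t"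
    using ex[of f "Cod C f" "\<lambda>t. t"] f by (auto simp: hom_iff)
  obtain i r where ir: "i \<in> Cof" "r \<in> Fib \<inter> W" "Cod C i = Dom C r" "h = r \<cdot> i"
    using factor_Cof[of h] h(1) by (auto simp: hom_iff)
  have A: "i \<in> Arr C" "r \<in> Arr C" using ir Cof_Arr Fib_Arr by auto
  have t: "Dom C i = X1" "Cod C r = Cod C f" using h(1) ir A by (auto simp: hom_iff)
  have "has_lift C e r"
  proof (rule has_lift_initialI)
    fix y assume "y \<in> hom C (Cod C e) (Cod C r)"
    then have y: "y \<in> hom C U (Cod C f)" using t by simp
    have "r \<cdot> (i \<cdot> b y) = h \<cdot> b y"
      using ir A t b[OF y] by (simp add: hom_iff)
    then show "\<exists>g\<in>hom C (Cod C e) (Dom C r). r \<cdot> g = y"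
      using h(3)[OF y] b[OF y] A ir(3) t by (intro bexI[of _ "i \<cdot> b y"]) (auto simp: hom_iff)
  qed (use E_initial A in auto)
  then have "r \<in> Fib' \<inter> W"
    using ir(2) unfolding trivial_Fib'_eq trivial_Fib_eq by (auto simp: inj_class_def)
  moreover have "i \<cdot> x \<in> Cof'"
    using Cof'_subcategory x ir(1) Cof_subset t by (auto simp: wide_subcategory_def hom_iff)
  moreover have "f = r \<cdot> (i \<cdot> x)"
    unfolding h(2)[symmetric] ir(4) using A x ir(3) t by (simp add: hom_iff)
  moreover have "Cod C (i \<cdot> x) = Dom C r" using x A ir(3) t by (simp add: hom_iff)
  ultimately show ?thesis by blast
qed

text \<open>
  Lifts along \<open>k = j \<cdot> i1\<close> exist as soon as they exist up to homotopy. Let \<open>w\<close> be a weak equivalence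
  from a fibration \<open>r \<cdot> w\<close> to a fibration \<open>r\<close> over the same object, and suppose that every square
  from \<open>k\<close> to \<open>r \<cdot> w\<close> has a lift after composition with \<open>w\<close>. Consider a square from \<open>k\<close> to \<open>r\<close> with
  upper side \<open>a\<close>. As \<open>Dom q\<close> is cofibrant, \<open>a\<close> is homotopic over \<open>Cod r\<close> to an arrow through \<open>w\<close>, for
  which there is a lift \<open>l\<close>. The homotopy on \<open>Dom q\<close>, together with the constant homotopy of
  \<open>l \<cdot> j \<cdot> i2\<close> on \<open>U\<close>, extends along the cofibration \<open>j\<close> to a homotopy that starts at \<open>l\<close>. Its end is
  the lift that is sought.
\<close>

lemma homotopy_lift:
  assumes r: "r \<in> Fib" and w: "w \<in> W" "Cod C w = Dom C r" and rw: "r \<cdot> w \<in> Fib"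
    and lift: "\<And>a c. \<lbrakk>a \<in> hom C (Dom C q) (Dom C w); c \<in> hom C (Cod C j) (Cod C r);
        (r \<cdot> w) \<cdot> a = c \<cdot> (j \<cdot> i1)\<rbrakk> \<Longrightarrow>
      \<exists>l \<in> hom C (Cod C j) (Dom C r). l \<cdot> (j \<cdot> i1) = w \<cdot> a \<and> r \<cdot> l = c"
  shows "has_lift C (j \<cdot> i1) r"
proof -
  have A: "r \<in> Arr C" "w \<in> Arr C" using r w Fib_Arr W_Arr by auto
  define Z2 where "Z2 = Dom C r"
  have Z2: "Z2 \<in> Obj C" "Dom C r = Z2" "Cod C w = Z2" using A w by (auto simp: Z2_def)
  obtain d0 d1 where pb: "is_pullback C r r d0 d1"
    using pullback_exists[OF universe complete A(1) A(1)] by blast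
  define Q where "Q = Dom C d1"
  have d: "d0 \<in> Arr C" "d1 \<in> Arr C" "Dom C d0 = Q" "Dom C d1 = Q" "Cod C d0 = Z2" "Cod C d1 = Z2"
      "r \<cdot> d0 = r \<cdot> d1"
    using pb Z2 by (auto simp: is_pullback_def Q_def)
  have pbI: "\<exists>h. h \<in> hom C X Q \<and> d0 \<cdot> h = a \<and> d1 \<cdot> h = b"
    if "a \<in> hom C X Z2" "b \<in> hom C X Z2" "r \<cdot> a = r \<cdot> b" for X a b
    using pullback_induced[OF pb, of a X b] that unfolding Q_def[symmetric] Z2(2) by blast
  obtain dg where dg: "dg \<in> hom C Z2 Q" "d0 \<cdot> dg = Ident C Z2" "d1 \<cdot> dg = Ident C Z2"
    using pbI[of "Ident C Z2" Z2 "Ident C Z2"] Z2 by (auto simp: hom_iff)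
  \<comment> \<open>\<open>Dom P\<close> is a path object of \<open>r\<close> over \<open>Cod r\<close>, with constant paths \<open>s\<close>, start \<open>ev0\<close> and end \<open>ev1\<close>.\<close>
  obtain s P where sP: "s \<in> Cof \<inter> W" "P \<in> Fib" "Cod C s = Dom C P" "dg = P \<cdot> s"
    using factor_Fib[of dg] dg(1) by (auto simp: hom_iff)
  have sA: "s \<in> Arr C" "P \<in> Arr C" using sP Cof_Arr Fib_Arr by auto
  have st: "Dom C s = Z2" "Cod C P = Q" using dg(1) sP sA by (auto simp: hom_iff)
  define ev0 where "ev0 = d0 \<cdot> P"
  define ev1 where "ev1 = d1 \<cdot> P"
  have ev: "ev0 \<in> Arr C" "Dom C ev0 = Dom C P" "Cod C ev0 = Z2" "ev1 \<in> Arr C" "Dom C ev1 = Dom C P" "Cod C ev1 = Z2"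
    using d sA st by (auto simp: ev0_def ev1_def)
  have evs: "ev0 \<cdot> s = Ident C Z2" "ev1 \<cdot> s = Ident C Z2"
    using dg(2,3) sP(3,4) d sA st by (auto simp: ev0_def ev1_def)
  have rev: "r \<cdot> ev0 = r \<cdot> ev1"
    using Cmp_eq_extend[OF d(7), of P] d sA st A Z2 by (simp add: ev0_def ev1_def)
  have pb': "is_pullback C r r d1 d0"
    unfolding is_pullback_def
  proof (intro conjI ballI impI)
    fix X a b assume "X \<in> Obj C" "a \<in> hom C X (Dom C r)" "b \<in> hom C X (Dom C r)" "r \<cdot> a = r \<cdot> b"
    then have "\<exists>!h. h \<in> hom C X Q \<and> d0 \<cdot> h = b \<and> d1 \<cdot> h = a"
      using pb unfolding is_pullback_def Q_def by simp
    then show "\<exists>!h. h \<in> hom C X (Dom C d0) \<and> d1 \<cdot> h = a \<and> d0 \<cdot> h = b"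
      unfolding d(3) by (simp add: conj_commute conj_left_commute)
  qed (use d A Z2 in auto)
  then have "d0 \<in> Fib"
    using has_lift_pullback[OF pb'] r J_Arr d unfolding Fib_eq inj_class_def by blast
  then have "ev0 \<in> Fib" unfolding ev0_def by (rule Fib_Cmp[OF sP(2)]) (use d st in auto)
  moreover have "ev0 \<in> W"
    by (rule W_cancel_right[of s]) (use sP(1) ev evs W_Ident[OF Z2(1)] sP(3) in auto)
  ultimately have ev0: "ev0 \<in> Fib \<inter> W" by simp
  \<comment> \<open>The trivial cofibration \<open>s1\<close>, a replacement of \<open>w\<close>, has a retraction \<open>\<rho>\<close> over \<open>Cod r\<close>.\<close>
  obtain s1 r1 where sr: "s1 \<in> Cof \<inter> W" "r1 \<in> Fib" "Cod C s1 = Dom C r1" "w = r1 \<cdot> s1"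
    using factor_Fib[OF A(2)] by blast
  have srA: "s1 \<in> Arr C" "r1 \<in> Arr C" using sr Cof_Arr Fib_Arr by auto
  have srt: "Dom C s1 = Dom C w" "Cod C r1 = Z2" using sr srA Z2 by auto
  have r1: "r1 \<in> Fib \<inter> W" using W_cancel_right[of s1 r1] sr srA w by auto
  have "(r \<cdot> w) \<cdot> Ident C (Dom C w) = (r \<cdot> r1) \<cdot> s1"
    using A srA srt sr(3,4) Z2 by simp
  then obtain \<rho> where \<rho>: "\<rho> \<in> Arr C" "Dom C \<rho> = Dom C r1" "Cod C \<rho> = Dom C w"
      "\<rho> \<cdot> s1 = Ident C (Dom C w)" "(r \<cdot> w) \<cdot> \<rho> = r \<cdot> r1"
    using A srA srt sr(3) Z2
    by (elim has_liftE[OF lift_Fib[OF sr(1) rw], of "Ident C (Dom C w)" "r \<cdot> r1", rotated 6]) simp_all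
  have rw\<rho>: "r \<cdot> (w \<cdot> \<rho>) = r \<cdot> r1" using \<rho> A Z2 by simp
  obtain m where m: "m \<in> hom C (Dom C r1) Q" "d0 \<cdot> m = w \<cdot> \<rho>" "d1 \<cdot> m = r1"
    using pbI[of "w \<cdot> \<rho>" "Dom C r1" r1] rw\<rho> \<rho> A srA srt Z2 by (auto simp: hom_iff)
  note mt = m(1)[unfolded hom_iff]
  have "P \<cdot> (s \<cdot> w) = m \<cdot> s1"
  proof -
    have 1: "P \<cdot> (s \<cdot> w) = dg \<cdot> w" using sP sA A st Z2 by simp
    have dgt: "dg \<in> Arr C" "Dom C dg = Z2" "Cod C dg = Q" using dg(1) by (auto simp: hom_iff)
    have 2: "d0 \<cdot> (dg \<cdot> w) = w" "d1 \<cdot> (dg \<cdot> w) = w"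
      using Cmp_eq_collapse[OF dg(2), of w] Cmp_eq_collapse[OF dg(3), of w] d dgt A Z2 by simp_all
    have 3: "d0 \<cdot> (m \<cdot> s1) = w"
      using Cmp_eq_collapse[OF m(2), of s1] d mt srA sr(3) srt \<rho> A Z2 by simp
    have "d1 \<cdot> (m \<cdot> s1) = r1 \<cdot> s1"
      by (rule Cmp_eq_collapse[OF m(3)]) (simp_all add: d mt srA sr(3))
    then have 4: "d1 \<cdot> (m \<cdot> s1) = w" using sr(4) by simp
    have "dg \<cdot> w \<in> hom C (Dom C w) (Dom C d1)" "m \<cdot> s1 \<in> hom C (Dom C w) (Dom C d1)"
      using dgt mt A srA sr(3) srt Z2 d by (simp_all add: hom_iff)
    then have "dg \<cdot> w = m \<cdot> s1" by (rule pullback_eq[OF pb]) (simp_all only: 2 3 4)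
    then show ?thesis using 1 by simp
  qed
  \<comment> \<open>A homotopy over \<open>Cod r\<close> from \<open>w \<cdot> \<rho>\<close> to \<open>r1\<close>.\<close>
  then obtain H where H: "H \<in> Arr C" "Dom C H = Dom C r1" "Cod C H = Dom C P" "P \<cdot> H = m"
    using sA A mt st srA srt sr(3) sP(3) Z2
    by (elim has_liftE[OF lift_Fib[OF sr(1) sP(2)], of "s \<cdot> w" m, rotated 6]) simp_all
  have evH: "ev0 \<cdot> H = w \<cdot> \<rho>" "ev1 \<cdot> H = r1"
    using H m d sA st by (auto simp: ev0_def ev1_def)
  show ?thesis
  proof (rule has_liftI)
    fix a c assume ac: "a \<in> Arr C" "c \<in> Arr C" "Dom C a = Dom C (j \<cdot> i1)" "Cod C a = Dom C r"
      "Dom C c = Cod C (j \<cdot> i1)" "Cod C c = Cod C r" "r \<cdot> a = c \<cdot> (j \<cdot> i1)"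
    have "a \<in> hom C (Dom C q) (Cod C r1)" using ac srt Z2 by (auto simp: hom_iff)
    from cofibrant_lift[OF q_cofibrant r1 this]
    obtain a' where "a' \<in> hom C (Dom C q) (Dom C r1)" and r1a': "r1 \<cdot> a' = a" by blast
    then have a': "a' \<in> Arr C" "Dom C a' = Dom C q" "Cod C a' = Dom C r1" by (auto simp: hom_iff)
    have "(r \<cdot> w) \<cdot> (\<rho> \<cdot> a') = (r \<cdot> r1) \<cdot> a'"
      by (rule Cmp_eq_collapse[OF \<rho>(5)]) (use \<rho> a' A Z2 in auto)
    also have "\<dots> = c \<cdot> (j \<cdot> i1)" using r1a' a' A srA srt Z2 ac(7) by simp
    finally obtain l where "l \<in> hom C (Cod C j) (Dom C r)" and l: "l \<cdot> (j \<cdot> i1) = w \<cdot> (\<rho> \<cdot> a')" "r \<cdot> l = c"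
      using lift[of "\<rho> \<cdot> a'" c] \<rho> a' ac by (auto simp: hom_iff)
    then have lt: "l \<in> Arr C" "Dom C l = Cod C j" "Cod C l = Z2" using Z2 by (auto simp: hom_iff)
    \<comment> \<open>The homotopy on \<open>S\<close> that is to be extended along \<open>j\<close>: it is constant on \<open>U\<close>.\<close>
    obtain n0 where n0: "n0 \<in> Arr C" "Dom C n0 = S" "Cod C n0 = Dom C P" "n0 \<cdot> i1 = H \<cdot> a'"
        "n0 \<cdot> i2 = s \<cdot> (l \<cdot> (j \<cdot> i2))"
      by (rule coproduct_induced[of "H \<cdot> a'" "Dom C P" "s \<cdot> (l \<cdot> (j \<cdot> i2))"])
        (use H a' sA lt st sP(3) in \<open>auto simp: hom_iff\<close>)
    have "ev0 \<cdot> n0 = l \<cdot> j"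
    proof (rule coproduct_eq)
      show "(ev0 \<cdot> n0) \<cdot> i1 = (l \<cdot> j) \<cdot> i1"
        using n0 ev l(1) lt Cmp_eq_collapse[OF evH(1), of a'] H a' \<rho> A Z2 by simp
      show "(ev0 \<cdot> n0) \<cdot> i2 = (l \<cdot> j) \<cdot> i2"
        using n0 ev lt Cmp_eq_collapse[OF evs(1), of "l \<cdot> (j \<cdot> i2)"] sA st sP(3) by simp
    qed (use n0 ev lt in auto)
    then obtain n where n: "n \<in> Arr C" "Dom C n = Cod C j" "Cod C n = Dom C P" "n \<cdot> j = n0" "ev0 \<cdot> n = l"
      using n0 lt ev by (elim has_liftE[OF lift_Cof[OF j_Cof ev0], of n0 l, rotated 6]) simp_all
    have "(ev1 \<cdot> n) \<cdot> (j \<cdot> i1) = ev1 \<cdot> (n0 \<cdot> i1)"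
      using Cmp_eq_collapse[OF n(4), of i1] n ev by simp
    also have "\<dots> = r1 \<cdot> a'"
      unfolding n0(4) by (rule Cmp_eq_collapse[OF evH(2)]) (use ev H a' in auto)
    finally have 1: "(ev1 \<cdot> n) \<cdot> (j \<cdot> i1) = a" using r1a' by simp
    have "r \<cdot> (ev1 \<cdot> n) = r \<cdot> (ev0 \<cdot> n)"
      by (rule Cmp_eq_extend[OF rev[symmetric]]) (use A ev n Z2 in auto)
    then have "r \<cdot> (ev1 \<cdot> n) = c" using n l by simp
    with 1 show "\<exists>h. h \<in> Arr C \<and> Dom C h = Cod C (j \<cdot> i1) \<and> Cod C h = Dom C r \<and> h \<cdot> (j \<cdot> i1) = a \<and> r \<cdot> h = c"
      using ev n Z2 by (intro exI[of _ "ev1 \<cdot> n"]) simp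
  qed
qed

text \<open>The fibration \<open>z\<close> of a first factorization may lack lifts along \<open>j \<cdot> i1\<close>, so they are attached
  for all squares at once. The second factorization then restores the fibration property, and the
  attached lifts remain sufficient because lifts only matter up to homotopy.\<close>

lemma factor_Fib':
  assumes f: "f \<in> Arr C"
  shows "\<exists>i \<in> llp C Fib'. \<exists>r \<in> Fib'. Cod C i = Dom C r \<and> f = r \<cdot> i"
proof -
  obtain i z where iz: "i \<in> Cof \<inter> W" "z \<in> Fib" "Cod C i = Dom C z" "f = z \<cdot> i"
    using factor_Fib[OF f] by blast
  have izA: "i \<in> Arr C" "z \<in> Arr C" using iz Cof_Arr Fib_Arr by auto
  define T where "T = {(a, c). a \<in> hom C (Dom C q) (Dom C z) \<and> c \<in> hom C (Cod C j) (Cod C z) \<and>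
      z \<cdot> a = c \<cdot> (j \<cdot> i1)}"
  have "T \<subseteq> hom C (Dom C q) (Dom C z) \<times> hom C (Cod C j) (Cod C z)" by (auto simp: T_def)
  moreover have "small \<Theta> (hom C (Dom C q) (Dom C z) \<times> hom C (Cod C j) (Cod C z))"
    using locally_small izA by (intro small_Times[OF universe]) (auto simp: locally_small_def)
  ultimately have T: "small \<Theta> T" using small_subset by blast
  have k: "j \<cdot> i1 \<in> llp C Fib'" by (auto simp: llp_def Fib'_def inj_class_def)
  obtain Z1 x b where x: "x \<in> hom C (Dom C z) Z1" "x \<in> llp C Fib'"
    and b: "\<And>t. t \<in> T \<Longrightarrow> b t \<in> hom C (Cod C (j \<cdot> i1)) Z1"
    and bk: "\<And>t. t \<in> T \<Longrightarrow> b t \<cdot> (j \<cdot> i1) = x \<cdot> fst t"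
    and ex: "\<And>Y y c. \<lbrakk>y \<in> hom C (Dom C z) Y; \<And>t. t \<in> T \<Longrightarrow> c t \<in> hom C (Cod C (j \<cdot> i1)) Y;
       \<And>t. t \<in> T \<Longrightarrow> c t \<cdot> (j \<cdot> i1) = y \<cdot> fst t\<rbrakk> \<Longrightarrow>
       \<exists>h. h \<in> hom C Z1 Y \<and> h \<cdot> x = y \<and> (\<forall>t \<in> T. h \<cdot> b t = c t)"
    by (rule attachment_llp[OF universe cocomplete T, of "Dom C z" Fib' "\<lambda>_. j \<cdot> i1" fst])
      (use izA k inj_class_Arr in \<open>auto simp: T_def Fib'_def\<close>)
  have xt: "x \<in> Arr C" "Dom C x = Dom C z" "Cod C x = Z1" using x by (auto simp: hom_iff)
  obtain h where h: "h \<in> hom C Z1 (Cod C z)" "h \<cdot> x = z" "\<And>t. t \<in> T \<Longrightarrow> h \<cdot> b t = snd t"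
    using ex[of z "Cod C z" snd] izA by (auto simp: hom_iff T_def)
  obtain i' r where ir: "i' \<in> Cof \<inter> W" "r \<in> Fib" "Cod C i' = Dom C r" "h = r \<cdot> i'"
    using factor_Fib[of h] h(1) by (auto simp: hom_iff)
  have A: "i' \<in> Arr C" "r \<in> Arr C" using ir Cof_Arr Fib_Arr by auto
  have t: "Dom C i' = Z1" "Cod C r = Cod C z" using h(1) ir A by (auto simp: hom_iff)
  have rix: "r \<cdot> (i' \<cdot> x) = z" using h(2) ir(3,4) A t xt by simp
  \<comment> \<open>The attached cells solve the lifting problems of \<open>z\<close>, which is \<open>r\<close> restricted along \<open>i' \<cdot> x\<close>.\<close>
  have "has_lift C (j \<cdot> i1) r"
  proof (rule homotopy_lift[of r "i' \<cdot> x"])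
    show "r \<cdot> (i' \<cdot> x) \<in> Fib" using rix iz by simp
    show "i' \<cdot> x \<in> W"
      by (rule W_Cmp) (use x llp_Fib'_subset ir t xt in auto)
    fix a c assume ac: "a \<in> hom C (Dom C q) (Dom C (i' \<cdot> x))" "c \<in> hom C (Cod C j) (Cod C r)"
      "(r \<cdot> (i' \<cdot> x)) \<cdot> a = c \<cdot> (j \<cdot> i1)"
    then have T: "(a, c) \<in> T" using rix xt A t ir(3) by (auto simp: T_def)
    note bt = b[OF T, unfolded hom_iff]
    have "(i' \<cdot> b (a, c)) \<cdot> (j \<cdot> i1) = i' \<cdot> (x \<cdot> a)" using bk[OF T] bt A t by simp
    then have "(i' \<cdot> b (a, c)) \<cdot> (j \<cdot> i1) = (i' \<cdot> x) \<cdot> a" using xt A t ac(1) by (simp add: hom_iff)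
    moreover have "r \<cdot> (i' \<cdot> b (a, c)) = c" using h(3)[OF T] ir(3,4) A t bt by simp
    ultimately show "\<exists>l\<in>hom C (Cod C j) (Dom C r). l \<cdot> (j \<cdot> i1) = (i' \<cdot> x) \<cdot> a \<and> r \<cdot> l = c"
      using bt A t ir(3) by (intro bexI[of _ "i' \<cdot> b (a, c)"]) (auto simp: hom_iff)
  qed (use ir A t xt in auto)
  then have "r \<in> Fib'" using ir(2) unfolding Fib_eq Fib'_def by (auto simp: inj_class_def)
  moreover have llp: "g \<cdot> f \<in> llp C Fib'" if "f \<in> llp C Fib'" "g \<in> llp C Fib'" "Cod C f = Dom C g" for f g
    using llp_wide_subcategory[OF inj_class_Arr, of "insert (j \<cdot> i1) J"] that
    unfolding Fib'_def[symmetric] wide_subcategory_def by blast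
  have "(i' \<cdot> x) \<cdot> i \<in> llp C Fib'"
  proof (rule llp[OF _ llp])
    show "i \<in> llp C Fib'" "i' \<in> llp C Fib'" using iz(1) ir(1) trivial_Cof_subset by auto
  qed (use x(2) t xt A izA iz(3) in simp_all)
  moreover have "f = r \<cdot> ((i' \<cdot> x) \<cdot> i)"
    using Cmp_eq_collapse[OF rix, of i] iz(3,4) izA A t xt ir(3) by simp
  moreover have "Cod C ((i' \<cdot> x) \<cdot> i) = Dom C r" using A t xt ir(3) izA iz(3) by simp
  ultimately show ?thesis by blast
qed

lemma trivial_Cof'_eq: "Cof' \<inter> W = llp C Fib'"
proof
  show "llp C Fib' \<subseteq> Cof' \<inter> W" by (rule llp_Fib'_subset)
  show "Cof' \<inter> W \<subseteq> llp C Fib'"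
  proof
    fix f assume f: "f \<in> Cof' \<inter> W"
    then have fA: "f \<in> Arr C" using W_Arr by auto
    obtain i r where ir: "i \<in> llp C Fib'" "r \<in> Fib'" "Cod C i = Dom C r" "f = r \<cdot> i"
      using factor_Fib'[OF fA] by blast
    have A: "i \<in> Arr C" "r \<in> Arr C" using ir by (auto simp: llp_def Fib'_def inj_class_def)
    have "r \<in> W"
      by (rule W_cancel_right[of i]) (use ir f A llp_Fib'_subset in auto)
    then have "r \<in> inj_class C (insert e I)" using ir trivial_Fib'_eq by blast
    then have "has_lift C f r" using f by (auto simp: Cof'_def llp_def)
    then have "retract_of C f i" using retract_argument[OF A ir(3)] ir(4) by simp
    moreover have "retract_closed C (llp C Fib')"
      unfolding Fib'_def by (rule llp_retract_closed[OF inj_class_Arr])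
    ultimately show "f \<in> llp C Fib'" using ir(1) by (auto simp: retract_closed_def)
  qed
qed

theorem enlarged_model_category: "model_category C \<Theta> W Cof' Fib'"
proof unfold_locales
  have K: "insert (j \<cdot> i1) J \<subseteq> Arr C" using J_Arr by simp
  show "wide_subcategory C Fib'" "retract_closed C Fib'"
    unfolding Fib'_def by (rule inj_class_wide_subcategory[OF K], rule inj_class_retract_closed[OF K])
  show "retract_closed C Cof'" unfolding Cof'_def by (rule llp_retract_closed[OF inj_class_Arr])
  show "has_lift C i r" if "i \<in> Cof'" "r \<in> Fib' \<inter> W" for i r
    using that unfolding trivial_Fib'_eq Cof'_def llp_def by blast
  show "has_lift C i r" if "i \<in> Cof' \<inter> W" "r \<in> Fib'" for i r
    using that unfolding trivial_Cof'_eq llp_def by blast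
  show "\<exists>i\<in>Cof' \<inter> W. \<exists>r\<in>Fib'. Cod C i = Dom C r \<and> f = r \<cdot> i" if "f \<in> Arr C" for f
    unfolding trivial_Cof'_eq by (rule factor_Fib'[OF that])
qed (use locally_small complete cocomplete W_subcategory W_retract two_of_three Cof'_subcategory factor_Cof' in auto)

text \<open>A resolving functor moves the push-out square to the given structure.\<close>

lemma left_proper_enlarged:
  assumes "left_proper C W Cof"
  shows "left_proper C W Cof'"
  unfolding left_proper_def
proof (intro ballI allI impI)
  fix w i i' w' assume w: "w \<in> W" and i: "i \<in> Cof'" and po: "is_pushout C w i i' w'"
  obtain Fo Fa where F: "resolving_functor C Fo Fa \<Theta> W Cof Fib U" using resolution by blast
  interpret F: resolving_functor C Fo Fa \<Theta> W Cof Fib U by fact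
  have "is_pushout C (Fa w) (Fa i) (Fa i') (Fa w')" by (rule F.preserves_pushout[OF po])
  moreover have "Fa w \<in> W" using F.Fa_W w W_Arr by blast
  moreover have "Fa i \<in> Cof" by (rule resolving_Cof'[OF F i])
  ultimately have "Fa w' \<in> W" using assms unfolding left_proper_def by blast
  then show "w' \<in> W" using F.Fa_W is_pushoutD[OF po] by blast
qed

end

section \<open>Tensor products\<close>

context monoidal_category
begin

lemma Tobj_closed [simp]: "A \<in> Obj M \<Longrightarrow> B \<in> Obj M \<Longrightarrow> A \<odot> B \<in> Obj M"
  by (rule Tobj_Obj)

lemma Unit_closed [simp]: "Unit M \<in> Obj M"
  by (rule Unit_Obj)

lemma Tarr_typing [simp]:
  assumes "f \<in> Arr M" "g \<in> Arr M"
  shows "f \<otimes> g \<in> Arr M" "Dom M (f \<otimes> g) = Dom M f \<odot> Dom M g" "Cod M (f \<otimes> g) = Cod M f \<odot> Cod M g"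
  using Tarr_hom[of f "Dom M f" "Cod M f" g "Dom M g" "Cod M g"] assms by (auto simp: hom_iff)

lemma interchange:
  assumes "f \<in> Arr M" "g \<in> Arr M" "Cod M f = Dom M g" "f' \<in> Arr M" "g' \<in> Arr M" "Cod M f' = Dom M g'"
  shows "(g \<otimes> g') \<cdot> (f \<otimes> f') = (g \<cdot> f) \<otimes> (g' \<cdot> f')"
  using Tarr_Cmp[of f "Dom M f" "Cod M f" g "Cod M g" f' "Dom M f'" "Cod M f'" g' "Cod M g'"] assms
  by (auto simp: hom_iff)

lemma interchange_left_right:
  assumes "f \<in> Arr M" "g \<in> Arr M"
  shows "(f \<otimes> Ident M (Cod M g)) \<cdot> (Ident M (Dom M f) \<otimes> g) = f \<otimes> g"
    "(Ident M (Cod M f) \<otimes> g) \<cdot> (f \<otimes> Ident M (Dom M g)) = f \<otimes> g"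
  using assms by (simp_all add: interchange)

lemma Assoc_typing [simp]:
  assumes "A \<in> Obj M" "B \<in> Obj M" "D \<in> Obj M"
  shows "Assoc M A B D \<in> Arr M" "Dom M (Assoc M A B D) = (A \<odot> B) \<odot> D"
    "Cod M (Assoc M A B D) = A \<odot> (B \<odot> D)"
  using Assoc_hom[OF assms] by (auto simp: hom_iff)

lemma Lunit_typing [simp]:
  "A \<in> Obj M \<Longrightarrow> Lunit M A \<in> Arr M" "A \<in> Obj M \<Longrightarrow> Dom M (Lunit M A) = Unit M \<odot> A"
  "A \<in> Obj M \<Longrightarrow> Cod M (Lunit M A) = A"
  using Lunit_hom by (auto simp: hom_iff)

lemma Runit_typing [simp]:
  "A \<in> Obj M \<Longrightarrow> Runit M A \<in> Arr M" "A \<in> Obj M \<Longrightarrow> Dom M (Runit M A) = A \<odot> Unit M"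
  "A \<in> Obj M \<Longrightarrow> Cod M (Runit M A) = A"
  using Runit_hom by (auto simp: hom_iff)

text \<open>Both sides are isomorphic by the unit isomorphisms.\<close>

lemma tensor_Unit_retract:
  assumes "f \<in> Arr M"
  shows "retract_of M (Ident M (Unit M) \<otimes> f) f" "retract_of M f (Ident M (Unit M) \<otimes> f)"
    "retract_of M (f \<otimes> Ident M (Unit M)) f" "retract_of M f (f \<otimes> Ident M (Unit M))"
proof -
  note L = retract_of_iso_square[of "Ident M (Unit M) \<otimes> f" f "Lunit M (Dom M f)" "Lunit M (Cod M f)"]
  have "f \<cdot> Lunit M (Dom M f) = Lunit M (Cod M f) \<cdot> (Ident M (Unit M) \<otimes> f)"
    using Lunit_natural[of f "Dom M f" "Cod M f"] assms by (simp add: hom_iff)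
  then show "retract_of M (Ident M (Unit M) \<otimes> f) f" "retract_of M f (Ident M (Unit M) \<otimes> f)"
    using L assms Lunit_iso by (simp_all add: hom_iff)
  note R = retract_of_iso_square[of "f \<otimes> Ident M (Unit M)" f "Runit M (Dom M f)" "Runit M (Cod M f)"]
  have "f \<cdot> Runit M (Dom M f) = Runit M (Cod M f) \<cdot> (f \<otimes> Ident M (Unit M))"
    using Runit_natural[of f "Dom M f" "Cod M f"] assms by (simp add: hom_iff)
  then show "retract_of M (f \<otimes> Ident M (Unit M)) f" "retract_of M f (f \<otimes> Ident M (Unit M))"
    using R assms Runit_iso by (simp_all add: hom_iff)
qed

end

abbreviation pushout_product_lift ::
  "('o, 'm, 'x) premoncat_scheme \<Rightarrow> 'm \<Rightarrow> 'm \<Rightarrow> 'm \<Rightarrow> bool"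
where
  "pushout_product_lift M f g r \<equiv>
     corner_lift M (Ident M (Dom M f) \<otimes>\<^bsub>M\<^esub> g) (f \<otimes>\<^bsub>M\<^esub> Ident M (Dom M g))
       (f \<otimes>\<^bsub>M\<^esub> Ident M (Cod M g)) (Ident M (Cod M f) \<otimes>\<^bsub>M\<^esub> g) r"

context closed_monoidal_category
begin

lemma tensor_left_adjoint:
  assumes "A \<in> Obj M"
  shows "left_adjoint M (\<lambda>B. A \<odot> B) (\<lambda>f. Ident M A \<otimes> f)"
proof unfold_locales
  show "is_functor M M (\<lambda>B. A \<odot> B) (\<lambda>f. Ident M A \<otimes> f)"
    using assms unfolding is_functor_def by (auto simp: hom_iff Tarr_Ident interchange)
qed (rule closed_right[OF assms])

lemma tensor_right_adjoint:
  assumes "A \<in> Obj M"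
  shows "left_adjoint M (\<lambda>B. B \<odot> A) (\<lambda>f. f \<otimes> Ident M A)"
proof unfold_locales
  show "is_functor M M (\<lambda>B. B \<odot> A) (\<lambda>f. f \<otimes> Ident M A)"
    using assms unfolding is_functor_def by (auto simp: hom_iff Tarr_Ident interchange)
qed (rule closed_left[OF assms])

lemma pushout_product_lift_iff:
  assumes h: "is_pushout_product M f g h" and t: "f \<in> Arr M" "g \<in> Arr M" "r \<in> Arr M"
  shows "pushout_product_lift M f g r \<longleftrightarrow> has_lift M h r"
proof -
  obtain k l where kl: "is_pushout M (Ident M (Dom M f) \<otimes> g) (f \<otimes> Ident M (Dom M g)) k l"
    "h \<in> hom M (Cod M k) (Cod M f \<odot> Cod M g)" "h \<cdot> k = f \<otimes> Ident M (Cod M g)"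
    "h \<cdot> l = Ident M (Cod M f) \<otimes> g"
    using h unfolding is_pushout_product_def by blast
  show ?thesis
    unfolding kl(3,4)[symmetric] by (rule corner_lift_iff[OF kl(1)]) (use kl(2) t in \<open>auto simp: hom_iff\<close>)
qed

lemma pushout_product_exists:
  fixes \<Theta> :: "'u rel"
  assumes "universe \<Theta>" "cocomplete \<Theta> M" "f \<in> Arr M" "g \<in> Arr M"
  obtains h where "is_pushout_product M f g h"
proof -
  let ?f = "Ident M (Dom M f) \<otimes> g" and ?g = "f \<otimes> Ident M (Dom M g)"
  obtain k l where kl: "is_pushout M ?f ?g k l"
    using pushout_exists[OF assms(1,2), of ?f ?g] assms by auto
  have "\<exists>h. h \<in> hom M (Cod M l) (Cod M f \<odot> Cod M g) \<and> h \<cdot> k = f \<otimes> Ident M (Cod M g) \<and>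
      h \<cdot> l = Ident M (Cod M f) \<otimes> g"
    by (rule pushout_induced[OF kl]) (use assms in \<open>auto simp: hom_iff interchange\<close>)
  then show thesis
    using that kl is_pushoutD(8)[OF kl] unfolding is_pushout_product_def by metis
qed

lemma pushout_product_lift_sym:
  assumes "f \<in> Arr M" "g \<in> Arr M"
  shows "pushout_product_lift M f g r \<longleftrightarrow>
    corner_lift M (f \<otimes> Ident M (Dom M g)) (Ident M (Dom M f) \<otimes> g)
      (Ident M (Cod M f) \<otimes> g) (f \<otimes> Ident M (Cod M g)) r"
  using assms by (intro iffI; elim corner_lift_sym) simp_all

text \<open>The push-out product with \<open>\<emptyset> \<rightarrow> A\<close> is tensoring with \<open>A\<close>.\<close>

lemma pushout_product_lift_initial_left:
  assumes "is_initial M (Dom M f)" "f \<in> Arr M" "g \<in> Arr M" "r \<in> Arr M"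
  shows "pushout_product_lift M f g r \<longleftrightarrow> has_lift M (Ident M (Cod M f) \<otimes> g) r"
  by (rule corner_lift_initial)
    (use assms left_adjoint.preserves_initial[OF tensor_right_adjoint assms(1)] in simp_all)

lemma pushout_product_lift_initial_right:
  assumes "is_initial M (Dom M g)" "f \<in> Arr M" "g \<in> Arr M" "r \<in> Arr M"
  shows "pushout_product_lift M f g r \<longleftrightarrow> has_lift M (f \<otimes> Ident M (Cod M g)) r"
  unfolding pushout_product_lift_sym[OF assms(2,3)]
  by (rule corner_lift_initial)
    (use assms left_adjoint.preserves_initial[OF tensor_left_adjoint assms(1)] in simp_all)

text \<open>The adjunction between push-out products and pull-back powers, in each variable.\<close>

lemma pushout_product_transpose_left:
  fixes \<Theta> :: "'u rel"
  assumes "universe \<Theta>" "complete \<Theta> M" "g \<in> Arr M" "r \<in> Arr M"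
  shows "\<exists>r' \<in> Arr M. \<forall>f \<in> Arr M.
    pushout_product_lift M f g r \<longleftrightarrow> has_lift M f r'"
proof -
  interpret F: left_adjoint M "\<lambda>B. B \<odot> Dom M g" "\<lambda>f. f \<otimes> Ident M (Dom M g)"
    by (rule tensor_right_adjoint) (use assms in simp)
  interpret G: left_adjoint M "\<lambda>B. B \<odot> Cod M g" "\<lambda>f. f \<otimes> Ident M (Cod M g)"
    by (rule tensor_right_adjoint) (use assms in simp)
  interpret adjoint_transformation M "\<lambda>B. B \<odot> Dom M g" "\<lambda>f. f \<otimes> Ident M (Dom M g)"
    "\<lambda>B. B \<odot> Cod M g" "\<lambda>f. f \<otimes> Ident M (Cod M g)" "\<lambda>A. Ident M A \<otimes> g"
    by unfold_locales (use assms in \<open>auto simp: hom_iff interchange\<close>)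
  show ?thesis by (rule corner_lift_transpose[OF assms(1,2,4)])
qed

lemma pushout_product_transpose_right:
  fixes \<Theta> :: "'u rel"
  assumes "universe \<Theta>" "complete \<Theta> M" "f \<in> Arr M" "r \<in> Arr M"
  shows "\<exists>r' \<in> Arr M. \<forall>g \<in> Arr M.
    pushout_product_lift M f g r \<longleftrightarrow> has_lift M g r'"
proof -
  interpret F: left_adjoint M "\<lambda>B. Dom M f \<odot> B" "\<lambda>g. Ident M (Dom M f) \<otimes> g"
    by (rule tensor_left_adjoint) (use assms in simp)
  interpret G: left_adjoint M "\<lambda>B. Cod M f \<odot> B" "\<lambda>g. Ident M (Cod M f) \<otimes> g"
    by (rule tensor_left_adjoint) (use assms in simp)
  interpret adjoint_transformation M "\<lambda>B. Dom M f \<odot> B" "\<lambda>g. Ident M (Dom M f) \<otimes> g"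
    "\<lambda>B. Cod M f \<odot> B" "\<lambda>g. Ident M (Cod M f) \<otimes> g" "\<lambda>B. f \<otimes> Ident M B"
    by unfold_locales (use assms in \<open>auto simp: hom_iff interchange\<close>)
  show ?thesis
    using corner_lift_transpose[OF assms(1,2,4)] pushout_product_lift_sym[OF assms(3)] by auto
qed

end

context monoidal_model_category
begin

lemma cofibrant_initial:
  assumes "cofibrant M Cof A"
  obtains E e where "is_initial M E" "E \<in> Obj M" "e \<in> Cof" "e \<in> Arr M" "Dom M e = E" "Cod M e = A"
  using assms by (auto simp: cofibrant_def hom_iff is_initial_def)

lemma cofibrant_retract:
  assumes "cofibrant M Cof A" "x \<in> hom M A B" "iso_arr M x"
  shows "cofibrant M Cof B"
proof (rule cofibrant_initial[OF assms(1)])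
  fix E e assume E: "is_initial M E" "E \<in> Obj M" "e \<in> Cof" "e \<in> Arr M" "Dom M e = E" "Cod M e = A"
  note t = E assms(2)[unfolded hom_iff]
  have "retract_of M (x \<cdot> e) e"
    by (rule retract_of_iso_square(2)[of _ _ "Ident M E" x])
      (use t assms(3) iso_arr_Ident in \<open>simp_all add: hom_iff\<close>)
  then have "x \<cdot> e \<in> Cof" using E(3) Cof_retract by (auto simp: retract_closed_def)
  moreover have "x \<cdot> e \<in> hom M E B" "B \<in> Obj M" using t by (auto simp: hom_iff)
  ultimately show ?thesis using E(1) unfolding cofibrant_def by blast
qed

lemma Cof_pushout_product_lift:
  assumes "universe \<Theta>" "f \<in> Cof" "g \<in> Cof" "r \<in> Fib \<inter> W"
  shows "pushout_product_lift M f g r"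
proof -
  have A: "f \<in> Arr M" "g \<in> Arr M" "r \<in> Arr M" using assms Cof_Arr Fib_Arr by auto
  obtain h where h: "is_pushout_product M f g h"
    by (rule pushout_product_exists[OF assms(1) cocomplete A(1,2)])
  then have "has_lift M h r" using pushout_product assms lift_Cof by blast
  then show ?thesis using pushout_product_lift_iff[OF h A] by blast
qed

lemma tensor_left_Cof:
  assumes "universe \<Theta>" "cofibrant M Cof A" "g \<in> Cof"
  shows "Ident M A \<otimes> g \<in> Cof"
proof (rule cofibrant_initial[OF assms(2)])
  fix E e assume E: "is_initial M E" "E \<in> Obj M" "e \<in> Cof" "e \<in> Arr M" "Dom M e = E" "Cod M e = A"
  have g: "g \<in> Arr M" using assms(3) Cof_Arr by auto
  have A: "A \<in> Obj M" using E(4,6) Dom_Cod_Obj(2) by blast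
  have "has_lift M (Ident M A \<otimes> g) r" if r: "r \<in> Fib \<inter> W" for r
    using pushout_product_lift_initial_left[of e g r] Cof_pushout_product_lift[OF assms(1) E(3) assms(3) r]
      E g r Fib_Arr by auto
  then show ?thesis unfolding Cof_eq_llp using g A by (simp add: llp_def)
qed

lemma tensor_right_Cof:
  assumes "universe \<Theta>" "cofibrant M Cof A" "f \<in> Cof"
  shows "f \<otimes> Ident M A \<in> Cof"
proof (rule cofibrant_initial[OF assms(2)])
  fix E e assume E: "is_initial M E" "E \<in> Obj M" "e \<in> Cof" "e \<in> Arr M" "Dom M e = E" "Cod M e = A"
  have f: "f \<in> Arr M" using assms(3) Cof_Arr by auto
  have A: "A \<in> Obj M" using E(4,6) Dom_Cod_Obj(2) by blast
  have "has_lift M (f \<otimes> Ident M A) r" if r: "r \<in> Fib \<inter> W" for r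
    using pushout_product_lift_initial_right[of e f r] Cof_pushout_product_lift[OF assms(1,3) E(3) r]
      E f r Fib_Arr by auto
  then show ?thesis unfolding Cof_eq_llp using f A by (simp add: llp_def)
qed

lemma W_retract_iff:
  assumes "retract_of M f g" "retract_of M g f"
  shows "f \<in> W \<longleftrightarrow> g \<in> W"
  using assms W_retract by (auto simp: retract_closed_def)

text \<open>The arrow \<open>q \<otimes> f\<close> is the composite of \<open>T \<otimes> f\<close> with a weak equivalence, and also of a weak
  equivalence with \<open>1 \<otimes> f\<close>, which is isomorphic to \<open>f\<close>.\<close>

lemma tensor_left_W:
  assumes "very_strong_unit_axiom M W Cof q" "f \<in> Arr M"
  shows "Ident M (Dom M q) \<otimes> f \<in> W \<longleftrightarrow> f \<in> W"
proof -
  have q: "q \<in> Arr M" "Cod M q = Unit M" and qX: "\<And>X. X \<in> Obj M \<Longrightarrow> q \<otimes> Ident M X \<in> W"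
    using assms(1) W_Arr by (auto simp: very_strong_unit_axiom_def unit_resolution_def)
  have 1: "(q \<otimes> Ident M (Cod M f)) \<cdot> (Ident M (Dom M q) \<otimes> f) = q \<otimes> f"
    and 2: "(Ident M (Unit M) \<otimes> f) \<cdot> (q \<otimes> Ident M (Dom M f)) = q \<otimes> f"
    using interchange_left_right[OF q(1) assms(2)] q(2) by simp_all
  have "Ident M (Dom M q) \<otimes> f \<in> W \<longleftrightarrow> q \<otimes> f \<in> W"
    using W_Cmp[of "Ident M (Dom M q) \<otimes> f" "q \<otimes> Ident M (Cod M f)"]
      W_cancel_left[of "Ident M (Dom M q) \<otimes> f" "q \<otimes> Ident M (Cod M f)"] 1 qX q assms(2) by auto
  also have "\<dots> \<longleftrightarrow> Ident M (Unit M) \<otimes> f \<in> W"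
    using W_Cmp[of "q \<otimes> Ident M (Dom M f)" "Ident M (Unit M) \<otimes> f"]
      W_cancel_right[of "q \<otimes> Ident M (Dom M f)" "Ident M (Unit M) \<otimes> f"] 2 qX q assms(2) by auto
  also have "\<dots> \<longleftrightarrow> f \<in> W" by (intro W_retract_iff tensor_Unit_retract assms(2))
  finally show ?thesis .
qed

lemma tensor_right_W:
  assumes "very_strong_unit_axiom M W Cof q" "f \<in> Arr M"
  shows "f \<otimes> Ident M (Dom M q) \<in> W \<longleftrightarrow> f \<in> W"
proof -
  have q: "q \<in> Arr M" "Cod M q = Unit M" and qX: "\<And>X. X \<in> Obj M \<Longrightarrow> Ident M X \<otimes> q \<in> W"
    using assms(1) W_Arr by (auto simp: very_strong_unit_axiom_def unit_resolution_def)
  have 1: "(Ident M (Cod M f) \<otimes> q) \<cdot> (f \<otimes> Ident M (Dom M q)) = f \<otimes> q"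
    and 2: "(f \<otimes> Ident M (Unit M)) \<cdot> (Ident M (Dom M f) \<otimes> q) = f \<otimes> q"
    using interchange_left_right[OF assms(2) q(1)] q(2) by simp_all
  have "f \<otimes> Ident M (Dom M q) \<in> W \<longleftrightarrow> f \<otimes> q \<in> W"
    using W_Cmp[of "f \<otimes> Ident M (Dom M q)" "Ident M (Cod M f) \<otimes> q"]
      W_cancel_left[of "f \<otimes> Ident M (Dom M q)" "Ident M (Cod M f) \<otimes> q"] 1 qX q assms(2) by auto
  also have "\<dots> \<longleftrightarrow> f \<otimes> Ident M (Unit M) \<in> W"
    using W_Cmp[of "Ident M (Dom M f) \<otimes> q" "f \<otimes> Ident M (Unit M)"]
      W_cancel_right[of "Ident M (Dom M f) \<otimes> q" "f \<otimes> Ident M (Unit M)"] 2 qX q assms(2) by auto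
  also have "\<dots> \<longleftrightarrow> f \<in> W" by (intro W_retract_iff tensor_Unit_retract assms(2))
  finally show ?thesis .
qed

lemma tensor_left_resolving:
  assumes "universe \<Theta>" and vs: "very_strong_unit_axiom M W Cof q"
  shows "resolving_functor M (\<lambda>B. Dom M q \<odot> B) (\<lambda>f. Ident M (Dom M q) \<otimes> f) \<Theta> W Cof Fib (Unit M)"
proof -
  have T: "cofibrant M Cof (Dom M q)" "Dom M q \<in> Obj M"
    using vs by (auto simp: very_strong_unit_axiom_def unit_resolution_def cofibrant_def)
  interpret left_adjoint M "\<lambda>B. Dom M q \<odot> B" "\<lambda>f. Ident M (Dom M q) \<otimes> f"
    by (rule tensor_left_adjoint[OF T(2)])
  obtain x where x: "Runit M (Dom M q) \<in> Arr M" "x \<in> Arr M" "Dom M x = Cod M (Runit M (Dom M q))"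
      "Cod M x = Dom M (Runit M (Dom M q))" "x \<cdot> Runit M (Dom M q) = Ident M (Dom M (Runit M (Dom M q)))"
      "Runit M (Dom M q) \<cdot> x = Ident M (Cod M (Runit M (Dom M q)))"
    by (rule iso_arrE[OF Runit_iso[OF T(2)]])
  then have "iso_arr M x" by (intro iso_arrI[of x "Runit M (Dom M q)"]) simp_all
  then have "cofibrant M Cof (Dom M q \<odot> Unit M)"
    using cofibrant_retract[OF T(1), of x] x T by (simp add: hom_iff)
  then show ?thesis
    by unfold_locales (use tensor_left_Cof[OF assms(1) T(1)] tensor_left_W[OF vs] in auto)
qed

lemma tensor_right_resolving:
  assumes "universe \<Theta>" and vs: "very_strong_unit_axiom M W Cof q"
  shows "resolving_functor M (\<lambda>B. B \<odot> Dom M q) (\<lambda>f. f \<otimes> Ident M (Dom M q)) \<Theta> W Cof Fib (Unit M)"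
proof -
  have T: "cofibrant M Cof (Dom M q)" "Dom M q \<in> Obj M"
    using vs by (auto simp: very_strong_unit_axiom_def unit_resolution_def cofibrant_def)
  interpret left_adjoint M "\<lambda>B. B \<odot> Dom M q" "\<lambda>f. f \<otimes> Ident M (Dom M q)"
    by (rule tensor_right_adjoint[OF T(2)])
  obtain x where x: "Lunit M (Dom M q) \<in> Arr M" "x \<in> Arr M" "Dom M x = Cod M (Lunit M (Dom M q))"
      "Cod M x = Dom M (Lunit M (Dom M q))" "x \<cdot> Lunit M (Dom M q) = Ident M (Dom M (Lunit M (Dom M q)))"
      "Lunit M (Dom M q) \<cdot> x = Ident M (Cod M (Lunit M (Dom M q)))"
    by (rule iso_arrE[OF Lunit_iso[OF T(2)]])
  then have "iso_arr M x" by (intro iso_arrI[of x "Lunit M (Dom M q)"]) simp_all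
  then have "cofibrant M Cof (Unit M \<odot> Dom M q)"
    using cofibrant_retract[OF T(1), of x] x T by (simp add: hom_iff)
  then show ?thesis
    by unfold_locales (use tensor_right_Cof[OF assms(1) T(1)] tensor_right_W[OF vs] in auto)
qed

end

context closed_monoidal_category
begin

text \<open>The two-sided associativity isomorphism \<open>(T \<otimes> A) \<otimes> (B \<otimes> T) \<rightarrow> (T \<otimes> (A \<otimes> B)) \<otimes> T\<close>.\<close>

lemma two_sided_associator:
  assumes T: "T \<in> Obj M"
  obtains \<alpha> where
    "\<And>A B. A \<in> Obj M \<Longrightarrow> B \<in> Obj M \<Longrightarrow>
       \<alpha> A B \<in> hom M ((T \<odot> A) \<odot> (B \<odot> T)) ((T \<odot> (A \<odot> B)) \<odot> T) \<and> iso_arr M (\<alpha> A B)"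
    "\<And>f g. f \<in> Arr M \<Longrightarrow> g \<in> Arr M \<Longrightarrow>
       \<alpha> (Cod M f) (Cod M g) \<cdot> ((Ident M T \<otimes> f) \<otimes> (g \<otimes> Ident M T)) =
       ((Ident M T \<otimes> (f \<otimes> g)) \<otimes> Ident M T) \<cdot> \<alpha> (Dom M f) (Dom M g)"
proof -
  define P where "P A B b \<longleftrightarrow> b \<in> Arr M \<and> Dom M b = (T \<odot> A) \<odot> (B \<odot> T) \<and>
      Cod M b = ((T \<odot> A) \<odot> B) \<odot> T \<and> b \<cdot> Assoc M (T \<odot> A) B T = Ident M (((T \<odot> A) \<odot> B) \<odot> T) \<and>
      Assoc M (T \<odot> A) B T \<cdot> b = Ident M ((T \<odot> A) \<odot> (B \<odot> T))" for A B b
  define b where "b A B = (SOME b. P A B b)" for A B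
  have "P A B (b A B)" if AB: "A \<in> Obj M" "B \<in> Obj M" for A B
  proof -
    have "iso_arr M (Assoc M (T \<odot> A) B T)" using AB T by (intro Assoc_iso) auto
    then have "\<exists>b. P A B b" using AB T by (elim iso_arrE) (auto simp: P_def)
    then show ?thesis unfolding b_def by (rule someI_ex)
  qed
  then have b: "b A B \<in> Arr M" "Dom M (b A B) = (T \<odot> A) \<odot> (B \<odot> T)"
      "Cod M (b A B) = ((T \<odot> A) \<odot> B) \<odot> T" "b A B \<cdot> Assoc M (T \<odot> A) B T = Ident M (((T \<odot> A) \<odot> B) \<odot> T)"
      "Assoc M (T \<odot> A) B T \<cdot> b A B = Ident M ((T \<odot> A) \<odot> (B \<odot> T))"
    if "A \<in> Obj M" "B \<in> Obj M" for A B using that by (simp_all add: P_def)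
  define c where "c A B = Assoc M T A B \<otimes> Ident M T" for A B
  have c: "c A B \<in> Arr M" "Dom M (c A B) = ((T \<odot> A) \<odot> B) \<odot> T" "Cod M (c A B) = (T \<odot> (A \<odot> B)) \<odot> T"
    if "A \<in> Obj M" "B \<in> Obj M" for A B using that T by (auto simp: c_def)
  show thesis
  proof (rule that[of "\<lambda>A B. c A B \<cdot> b A B"])
    fix A B assume AB: "A \<in> Obj M" "B \<in> Obj M"
    have "iso_arr M (c A B)"
      unfolding c_def using AB T
      by (intro left_adjoint.iso_arr_Fa[OF tensor_right_adjoint[OF T]] Assoc_iso)
    moreover have "iso_arr M (b A B)"
      by (rule iso_arrI[of _ "Assoc M (T \<odot> A) B T"]) (use b[OF AB] AB T in simp_all)
    ultimately show "c A B \<cdot> b A B \<in> hom M ((T \<odot> A) \<odot> (B \<odot> T)) ((T \<odot> (A \<odot> B)) \<odot> T) \<and>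
        iso_arr M (c A B \<cdot> b A B)"
      using b[OF AB] c[OF AB] iso_arr_Cmp by (auto simp: hom_iff)
  next
    fix f g assume fg: "f \<in> Arr M" "g \<in> Arr M"
    define X Y U V where "X = Dom M f" and "Y = Cod M f" and "U = Dom M g" and "V = Cod M g"
    have O: "X \<in> Obj M" "Y \<in> Obj M" "U \<in> Obj M" "V \<in> Obj M" using fg by (auto simp: X_def Y_def U_def V_def)
    have D: "Dom M f = X" "Cod M f = Y" "Dom M g = U" "Cod M g = V" by (auto simp: X_def Y_def U_def V_def)
    define m where "m = ((Ident M T \<otimes> f) \<otimes> g) \<otimes> Ident M T"
    define n where "n = (Ident M T \<otimes> f) \<otimes> (g \<otimes> Ident M T)"
    have mn: "m \<in> Arr M" "Dom M m = ((T \<odot> X) \<odot> U) \<odot> T" "Cod M m = ((T \<odot> Y) \<odot> V) \<odot> T"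
      "n \<in> Arr M" "Dom M n = (T \<odot> X) \<odot> (U \<odot> T)" "Cod M n = (T \<odot> Y) \<odot> (V \<odot> T)"
      using fg T D by (auto simp: m_def n_def)
    have nat: "Assoc M (T \<odot> Y) V T \<cdot> m = n \<cdot> Assoc M (T \<odot> X) U T"
      unfolding m_def n_def
      using Assoc_natural[of "Ident M T \<otimes> f" "T \<odot> X" "T \<odot> Y" g U V "Ident M T" T T] fg T D
      by (simp add: hom_iff)
    have "b Y V \<cdot> n = b Y V \<cdot> (n \<cdot> (Assoc M (T \<odot> X) U T \<cdot> b X U))"
      using b(5)[OF O(1,3)] mn by simp
    also have "n \<cdot> (Assoc M (T \<odot> X) U T \<cdot> b X U) = Assoc M (T \<odot> Y) V T \<cdot> (m \<cdot> b X U)"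
      by (rule Cmp_eq_extend[OF nat[symmetric]]) (use mn b[OF O(1,3)] O T in simp_all)
    also have "b Y V \<cdot> \<dots> = Ident M (((T \<odot> Y) \<odot> V) \<odot> T) \<cdot> (m \<cdot> b X U)"
      by (rule Cmp_eq_collapse[OF b(4)[OF O(2,4)]]) (use mn b[OF O(1,3)] b[OF O(2,4)] O T in simp_all)
    also have "\<dots> = m \<cdot> b X U" using mn b[OF O(1,3)] by simp
    finally have bn: "b Y V \<cdot> n = m \<cdot> b X U" .
    have "Assoc M T Y V \<cdot> ((Ident M T \<otimes> f) \<otimes> g) = (Ident M T \<otimes> (f \<otimes> g)) \<cdot> Assoc M T X U"
      using Assoc_natural[of "Ident M T" T T f X Y g U V] fg T D by (simp add: hom_iff)
    then have cm: "c Y V \<cdot> m = ((Ident M T \<otimes> (f \<otimes> g)) \<otimes> Ident M T) \<cdot> c X U"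
      unfolding c_def m_def using fg T D O by (simp add: interchange)
    have "(c Y V \<cdot> b Y V) \<cdot> n = c Y V \<cdot> (m \<cdot> b X U)"
      using bn mn b[OF O(2,4)] c[OF O(2,4)] by simp
    also have "\<dots> = ((Ident M T \<otimes> (f \<otimes> g)) \<otimes> Ident M T) \<cdot> (c X U \<cdot> b X U)"
      by (rule Cmp_eq_extend[OF cm]) (use mn b[OF O(1,3)] c[OF O(1,3)] c[OF O(2,4)] fg T D in simp_all)
    finally show "(c (Cod M f) (Cod M g) \<cdot> b (Cod M f) (Cod M g)) \<cdot> ((Ident M T \<otimes> f) \<otimes> (g \<otimes> Ident M T)) =
       ((Ident M T \<otimes> (f \<otimes> g)) \<otimes> Ident M T) \<cdot> (c (Dom M f) (Dom M g) \<cdot> b (Dom M f) (Dom M g))"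
      unfolding D n_def .
  qed
qed

text \<open>The functor \<open>T \<otimes> - \<otimes> T\<close> preserves push-outs, and associativity distributes the two copies
  of \<open>T\<close> over the factors. Applied to the push-out product of \<open>f\<close> and \<open>g\<close> it therefore yields, up to
  isomorphism, the push-out product of \<open>T \<otimes> f\<close> and \<open>g \<otimes> T\<close>. Two copies of \<open>T\<close> are used in order
  to improve both factors at the same time.\<close>

lemma tensor_pushout_product:
  assumes T: "T \<in> Obj M" and fg: "f \<in> Arr M" "g \<in> Arr M" and pp: "is_pushout_product M f g h"
  obtains h' where "is_pushout_product M (Ident M T \<otimes> f) (g \<otimes> Ident M T) h'"
    "retract_of M ((Ident M T \<otimes> h) \<otimes> Ident M T) h'"
proof (rule two_sided_associator[OF T])
  fix \<alpha>
  assume \<alpha>: "\<And>A B. A \<in> Obj M \<Longrightarrow> B \<in> Obj M \<Longrightarrow>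
       \<alpha> A B \<in> hom M ((T \<odot> A) \<odot> (B \<odot> T)) ((T \<odot> (A \<odot> B)) \<odot> T) \<and> iso_arr M (\<alpha> A B)"
    and nat: "\<And>f g. f \<in> Arr M \<Longrightarrow> g \<in> Arr M \<Longrightarrow>
       \<alpha> (Cod M f) (Cod M g) \<cdot> ((Ident M T \<otimes> f) \<otimes> (g \<otimes> Ident M T)) =
       ((Ident M T \<otimes> (f \<otimes> g)) \<otimes> Ident M T) \<cdot> \<alpha> (Dom M f) (Dom M g)"
  define X Y U V where "X = Dom M f" and "Y = Cod M f" and "U = Dom M g" and "V = Cod M g"
  have O: "X \<in> Obj M" "Y \<in> Obj M" "U \<in> Obj M" "V \<in> Obj M" using fg by (auto simp: X_def Y_def U_def V_def)
  have D: "Dom M f = X" "Cod M f = Y" "Dom M g = U" "Cod M g = V" by (auto simp: X_def Y_def U_def V_def)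
  have \<alpha>t: "\<alpha> A B \<in> Arr M" "Dom M (\<alpha> A B) = (T \<odot> A) \<odot> (B \<odot> T)" "Cod M (\<alpha> A B) = (T \<odot> (A \<odot> B)) \<odot> T"
    "iso_arr M (\<alpha> A B)" if "A \<in> Obj M" "B \<in> Obj M" for A B
    using \<alpha>[OF that] by (auto simp: hom_iff)
  obtain k l where kl: "is_pushout M (Ident M X \<otimes> g) (f \<otimes> Ident M U) k l"
    "h \<in> hom M (Cod M k) (Y \<odot> V)" "h \<cdot> k = f \<otimes> Ident M V" "h \<cdot> l = Ident M Y \<otimes> g"
    using pp unfolding is_pushout_product_def D by blast
  note klD = is_pushoutD[OF kl(1)] and hD = kl(2)[unfolded hom_iff]
  interpret L: left_adjoint M "\<lambda>B. T \<odot> B" "\<lambda>f. Ident M T \<otimes> f" by (rule tensor_left_adjoint[OF T])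
  interpret R: left_adjoint M "\<lambda>B. B \<odot> T" "\<lambda>f. f \<otimes> Ident M T" by (rule tensor_right_adjoint[OF T])
  define F where "F m = (Ident M T \<otimes> m) \<otimes> Ident M T" for m
  have F: "F m \<in> Arr M" "Dom M (F m) = (T \<odot> Dom M m) \<odot> T" "Cod M (F m) = (T \<odot> Cod M m) \<odot> T"
    if "m \<in> Arr M" for m using that T by (auto simp: F_def)
  have F_Cmp: "F (m \<cdot> n) = F m \<cdot> F n" if "m \<in> Arr M" "n \<in> Arr M" "Cod M n = Dom M m" for m n
    using that T by (simp add: F_def interchange)
  have klt: "Dom M k = X \<odot> V" "Dom M l = Y \<odot> U" "Cod M l = Cod M k" using klD fg O D by auto
  have po: "is_pushout M (F (Ident M X \<otimes> g)) (F (f \<otimes> Ident M U)) (F k) (F l)"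
    unfolding F_def by (intro R.preserves_pushout L.preserves_pushout kl(1))
  have nat': "F (Ident M X \<otimes> g) \<cdot> \<alpha> X U = \<alpha> X V \<cdot> (Ident M (T \<odot> X) \<otimes> (g \<otimes> Ident M T))"
    "F (f \<otimes> Ident M U) \<cdot> \<alpha> X U = \<alpha> Y U \<cdot> ((Ident M T \<otimes> f) \<otimes> Ident M (U \<odot> T))"
    "F (Ident M Y \<otimes> g) \<cdot> \<alpha> Y U = \<alpha> Y V \<cdot> (Ident M (T \<odot> Y) \<otimes> (g \<otimes> Ident M T))"
    "F (f \<otimes> Ident M V) \<cdot> \<alpha> X V = \<alpha> Y V \<cdot> ((Ident M T \<otimes> f) \<otimes> Ident M (V \<odot> T))"
    using nat[of "Ident M X" g] nat[of f "Ident M U"] nat[of "Ident M Y" g] nat[of f "Ident M V"]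
      fg O D T Tarr_Ident by (simp_all add: F_def)
  have po': "is_pushout M (Ident M (T \<odot> X) \<otimes> (g \<otimes> Ident M T)) ((Ident M T \<otimes> f) \<otimes> Ident M (U \<odot> T))
      (F k \<cdot> \<alpha> X V) (F l \<cdot> \<alpha> Y U)"
    by (rule is_pushout_iso[OF po, of "\<alpha> X U" "\<alpha> X V" "\<alpha> Y U"])
      (use \<alpha>t F fg O D T nat' in \<open>simp_all add: hom_iff\<close>)
  obtain a where a: "a \<in> Arr M" "Dom M a = (T \<odot> (Y \<odot> V)) \<odot> T" "Cod M a = (T \<odot> Y) \<odot> (V \<odot> T)"
      "a \<cdot> \<alpha> Y V = Ident M ((T \<odot> Y) \<odot> (V \<odot> T))" "\<alpha> Y V \<cdot> a = Ident M ((T \<odot> (Y \<odot> V)) \<odot> T)"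
    using \<alpha>t[OF O(2,4)] by (elim iso_arrE) auto
  have Fh: "F h \<cdot> F k = F (f \<otimes> Ident M V)" "F h \<cdot> F l = F (Ident M Y \<otimes> g)"
    using F_Cmp[of h k] F_Cmp[of h l] kl(3,4) klD hD by simp_all
  note t = F[of h] F[of k] F[of l] F[of "f \<otimes> Ident M V"] F[of "Ident M Y \<otimes> g"] klt hD klD(3,4) a(1-3) O T fg D
    \<alpha>t[OF O(2,4)] \<alpha>t[OF O(1,4)] \<alpha>t[OF O(2,3)]
  have 1: "(a \<cdot> F h) \<cdot> (F k \<cdot> \<alpha> X V) = (Ident M T \<otimes> f) \<otimes> Ident M (V \<odot> T)"
  proof -
    have "(a \<cdot> F h) \<cdot> (F k \<cdot> \<alpha> X V) = a \<cdot> (F h \<cdot> (F k \<cdot> \<alpha> X V))" using t by simp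
    also have "F h \<cdot> (F k \<cdot> \<alpha> X V) = F (f \<otimes> Ident M V) \<cdot> \<alpha> X V"
      by (rule Cmp_eq_collapse[OF Fh(1)]) (use t in simp_all)
    also have "a \<cdot> \<dots> = Ident M ((T \<odot> Y) \<odot> (V \<odot> T)) \<cdot> ((Ident M T \<otimes> f) \<otimes> Ident M (V \<odot> T))"
      unfolding nat' by (rule Cmp_eq_collapse[OF a(4)]) (use t in simp_all)
    finally show ?thesis using t by simp
  qed
  have 2: "(a \<cdot> F h) \<cdot> (F l \<cdot> \<alpha> Y U) = Ident M (T \<odot> Y) \<otimes> (g \<otimes> Ident M T)"
  proof -
    have "(a \<cdot> F h) \<cdot> (F l \<cdot> \<alpha> Y U) = a \<cdot> (F h \<cdot> (F l \<cdot> \<alpha> Y U))" using t by simp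
    also have "F h \<cdot> (F l \<cdot> \<alpha> Y U) = F (Ident M Y \<otimes> g) \<cdot> \<alpha> Y U"
      by (rule Cmp_eq_collapse[OF Fh(2)]) (use t in simp_all)
    also have "a \<cdot> \<dots> = Ident M ((T \<odot> Y) \<odot> (V \<odot> T)) \<cdot> (Ident M (T \<odot> Y) \<otimes> (g \<otimes> Ident M T))"
      unfolding nat' by (rule Cmp_eq_collapse[OF a(4)]) (use t in simp_all)
    finally show ?thesis using t by simp
  qed
  have "is_pushout_product M (Ident M T \<otimes> f) (g \<otimes> Ident M T) (a \<cdot> F h)"
    unfolding is_pushout_product_def using po' 1 2 t
    by (intro exI[of _ "F k \<cdot> \<alpha> X V"] exI[of _ "F l \<cdot> \<alpha> Y U"]) (simp add: hom_iff)
  moreover have "retract_of M (F h) (a \<cdot> F h)"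
  proof (rule retract_of_iso_square(2)[of _ _ "Ident M (Dom M (F h))" "\<alpha> Y V"])
    have "\<alpha> Y V \<cdot> (a \<cdot> F h) = Ident M ((T \<odot> (Y \<odot> V)) \<odot> T) \<cdot> F h"
      by (rule Cmp_eq_collapse[OF a(5)]) (use t in simp_all)
    then show "F h \<cdot> Ident M (Dom M (F h)) = \<alpha> Y V \<cdot> (a \<cdot> F h)" using t by simp
    show "iso_arr M (Ident M (Dom M (F h)))" by (rule iso_arr_Ident) (use t in simp)
  qed (use t in \<open>simp_all add: hom_iff\<close>)
  ultimately show thesis using that by (simp add: F_def)
qed

end

section \<open>The enlarged monoidal model structure\<close>

locale monoidal_enlargement =
  monoidal_model_category M \<Theta> W Cof Fib +
  enlargement M \<Theta> W Cof Fib I J q j p i1 i2 e S E "Unit M"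
  for M :: "('o, 'm, 'x) premoncat_scheme" (structure)
    and \<Theta> :: "'u rel" and W Cof Fib I J :: "'m set" and q j p i1 i2 e :: 'm and S E :: 'o +
  assumes very_strong: "very_strong_unit_axiom M W Cof q"
begin

lemma Dom_q [simp]: "Dom M q \<in> Obj M"
  by simp

lemmas left_Cof' = resolving_Cof'[OF tensor_left_resolving[OF universe very_strong]]
lemmas right_Cof' = resolving_Cof'[OF tensor_right_resolving[OF universe very_strong]]
lemmas left_W = tensor_left_W[OF very_strong]
lemmas right_W = tensor_right_W[OF very_strong]

lemma Cof'_Arr: "f \<in> Cof' \<Longrightarrow> f \<in> Arr M"
  by (simp add: Cof'_def llp_def)

lemma Cof'_lift: "f \<in> Cof' \<Longrightarrow> r \<in> inj_class M (insert e I) \<Longrightarrow> has_lift M f r"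
  by (simp add: Cof'_def llp_def)

text \<open>By adjunction, \<open>Cof'\<close> may be replaced with \<open>Cof \<union> {e}\<close> first in one variable and then in the
  other. Between these arrows there are only the push-out products of cofibrations and those with
  \<open>e\<close>, and the latter do nothing since \<open>1 \<otimes> g\<close> is isomorphic to \<open>g\<close>.\<close>

lemma Cof'_pushout_product_lift:
  assumes f: "f \<in> Cof'" and g: "g \<in> Cof'" and r: "r \<in> inj_class M (insert e I)"
  shows "pushout_product_lift M f g r"
proof -
  have rA: "r \<in> Arr M" using r by (simp add: inj_class_def)
  have rF: "r \<in> Fib \<inter> W" using r inj_class_insert_e by blast
  have gen: "f \<in> insert e Cof" "f \<in> Arr M" if "f \<in> insert e I" for f
    using that generators_Cof I_Arr by auto
  have 1: "pushout_product_lift M f g r" if fg: "f \<in> insert e Cof" "g \<in> insert e Cof" for f g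
  proof -
    have fgL: "f \<in> Cof'" "g \<in> Cof'" using fg Cof_subset e_Cof' by auto
    then have L: "has_lift M f r" "has_lift M g r" using Cof'_lift r by blast+
    consider "f \<in> Cof" "g \<in> Cof" | "f = e" | "g = e" using fg by blast
    then show ?thesis
    proof cases
      case 1 then show ?thesis by (rule Cof_pushout_product_lift[OF universe _ _ rF])
    next
      case 2
      have "has_lift M (Ident M (Unit M) \<otimes> g) r"
        by (rule has_lift_retract_left[OF tensor_Unit_retract(1)[OF Cof'_Arr[OF fgL(2)]] L(2) rA])
      then show ?thesis
        using pushout_product_lift_initial_left[of e g r] E_initial Cof'_Arr[OF fgL(2)] rA 2 by simp
    next
      case 3
      have "has_lift M (f \<otimes> Ident M (Unit M)) r"
        by (rule has_lift_retract_left[OF tensor_Unit_retract(3)[OF Cof'_Arr[OF fgL(1)]] L(1) rA])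
      then show ?thesis
        using pushout_product_lift_initial_right[of e f r] E_initial Cof'_Arr[OF fgL(1)] rA 3 by simp
    qed
  qed
  have 2: "pushout_product_lift M f g r" if f: "f \<in> Cof'" and g: "g \<in> insert e Cof" for f g
  proof -
    have "g \<in> Arr M" using g Cof_Arr by auto
    then obtain r' where r': "r' \<in> Arr M" "\<forall>f \<in> Arr M. pushout_product_lift M f g r \<longleftrightarrow> has_lift M f r'"
      using pushout_product_transpose_left[OF universe complete _ rA] by blast
    have "r' \<in> inj_class M (insert e I)"
      unfolding inj_class_def using r' 1[OF gen(1) g] gen(2) by blast
    then show ?thesis using r'(2) Cof'_lift[OF f] Cof'_Arr[OF f] by blast
  qed
  obtain r' where r': "r' \<in> Arr M" "\<forall>g \<in> Arr M. pushout_product_lift M f g r \<longleftrightarrow> has_lift M g r'"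
    using pushout_product_transpose_right[OF universe complete Cof'_Arr[OF f] rA] by blast
  have "r' \<in> inj_class M (insert e I)"
    unfolding inj_class_def using r' 2[OF f gen(1)] gen(2) by blast
  then show ?thesis using r'(2) Cof'_lift[OF g] Cof'_Arr[OF g] by blast
qed

lemma Cof'_pushout_product:
  assumes f: "f \<in> Cof'" and g: "g \<in> Cof'" and h: "is_pushout_product M f g h"
  shows "h \<in> Cof'"
proof -
  have "has_lift M h r" if r: "r \<in> inj_class M (insert e I)" for r
  proof -
    have "r \<in> Arr M" using r by (simp add: inj_class_def)
    then show ?thesis
      using pushout_product_lift_iff[OF h Cof'_Arr[OF f] Cof'_Arr[OF g]] Cof'_pushout_product_lift[OF f g r] by blast
  qed
  moreover have "h \<in> Arr M" using h by (auto simp: is_pushout_product_def hom_iff)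
  ultimately show ?thesis by (simp add: Cof'_def llp_def)
qed

text \<open>Tensoring with \<open>T\<close> on both sides turns \<open>f\<close> and \<open>g\<close> into cofibrations of the given structure, one
  of them trivial, and detects whether \<open>h\<close> is a weak equivalence.\<close>

lemma trivial_Cof'_pushout_product:
  assumes f: "f \<in> Cof'" and g: "g \<in> Cof'" and h: "is_pushout_product M f g h" and W: "f \<in> W \<or> g \<in> W"
  shows "h \<in> W"
proof -
  let ?T = "Dom M q"
  have A: "f \<in> Arr M" "g \<in> Arr M" "h \<in> Arr M"
    using Cof'_Arr f g h by (auto simp: is_pushout_product_def hom_iff)
  obtain h' where h': "is_pushout_product M (Ident M ?T \<otimes> f) (g \<otimes> Ident M ?T) h'"
      "retract_of M ((Ident M ?T \<otimes> h) \<otimes> Ident M ?T) h'"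
    by (rule tensor_pushout_product[OF Dom_q A(1,2) h])
  have "Ident M ?T \<otimes> f \<in> W \<or> g \<otimes> Ident M ?T \<in> W" using W left_W right_W A by blast
  then have "h' \<in> W" using pushout_product[OF left_Cof'[OF f] right_Cof'[OF g] h'(1)] by blast
  then have "(Ident M ?T \<otimes> h) \<otimes> Ident M ?T \<in> W"
    using h'(2) W_retract by (auto simp: retract_closed_def)
  then show ?thesis using left_W[OF A(3)] right_W[of "Ident M ?T \<otimes> h"] A(3) by simp
qed

theorem enlarged_monoidal_model_category: "monoidal_model_category M \<Theta> W Cof' Fib'"
proof -
  interpret N: model_category M \<Theta> W Cof' Fib' by (rule enlarged_model_category)
  have q: "unit_resolution M W Cof' q"
    using very_strong Cof_subset unfolding very_strong_unit_axiom_def unit_resolution_def cofibrant_def by blast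
  show ?thesis
  proof unfold_locales
    show "h \<in> Cof' \<and> (f \<in> W \<or> g \<in> W \<longrightarrow> h \<in> W)"
      if "f \<in> Cof'" "g \<in> Cof'" "is_pushout_product M f g h" for f g h
      using Cof'_pushout_product[OF that] trivial_Cof'_pushout_product[OF that] by blast
    show "\<exists>q. unit_resolution M W Cof' q \<and>
        (\<forall>X. cofibrant M Cof' X \<longrightarrow> q \<otimes> Ident M X \<in> W \<and> Ident M X \<otimes> q \<in> W)"
      using q very_strong unfolding very_strong_unit_axiom_def cofibrant_def by blast
  qed
qed

text \<open>Tensoring with \<open>T\<close> takes a cell complex built from arrows \<open>f \<otimes> X\<close> to one built from arrows
  \<open>T \<otimes> (f \<otimes> X)\<close>, and these are isomorphic to \<open>(T \<otimes> f) \<otimes> X\<close> with \<open>T \<otimes> f\<close> a trivial cofibration of the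
  given structure.\<close>

lemma monoid_axiom_enlarged:
  assumes "monoid_axiom \<Theta> M W Cof"
  shows "monoid_axiom \<Theta> M W Cof'"
  unfolding monoid_axiom_def
proof
  let ?T = "Dom M q"
  let ?K = "{f \<otimes> Ident M X | f X. f \<in> Cof \<inter> W \<and> X \<in> Obj M}"
  interpret L: left_adjoint M "\<lambda>B. ?T \<odot> B" "\<lambda>f. Ident M ?T \<otimes> f" by (rule tensor_left_adjoint[OF Dom_q])
  fix t assume t: "t \<in> cell \<Theta> M {f \<otimes> Ident M X | f X. f \<in> Cof' \<inter> W \<and> X \<in> Obj M}"
  have "Ident M ?T \<otimes> s \<in> pushouts_of M ?K"
    if s: "s \<in> pushouts_of M {f \<otimes> Ident M X | f X. f \<in> Cof' \<inter> W \<and> X \<in> Obj M}" for s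
  proof -
    obtain f X g g' where f: "f \<in> Cof' \<inter> W" and X: "X \<in> Obj M" and po: "is_pushout M (f \<otimes> Ident M X) g g' s"
      using s unfolding pushouts_of_def by blast
    have fA: "f \<in> Arr M" using f Cof'_Arr by blast
    note D = is_pushoutD[OF po]
    let ?f = "(Ident M ?T \<otimes> f) \<otimes> Ident M X"
    let ?x = "Assoc M ?T (Dom M f) X" and ?y = "Assoc M ?T (Cod M f) X"
    have "is_pushout M ?f ((Ident M ?T \<otimes> g) \<cdot> ?x) ((Ident M ?T \<otimes> g') \<cdot> ?y)
        ((Ident M ?T \<otimes> s) \<cdot> Ident M (?T \<odot> Cod M g))"
    proof (rule is_pushout_iso[OF L.preserves_pushout[OF po]])
      show "(Ident M ?T \<otimes> (f \<otimes> Ident M X)) \<cdot> ?x = ?y \<cdot> ?f"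
        using Assoc_natural[of "Ident M ?T" ?T ?T f "Dom M f" "Cod M f" "Ident M X" X X] fA X
        by (simp add: hom_iff)
    qed (use fA X D Assoc_iso iso_arr_Ident in \<open>simp_all add: hom_iff\<close>)
    then have "is_pushout M ?f ((Ident M ?T \<otimes> g) \<cdot> ?x) ((Ident M ?T \<otimes> g') \<cdot> ?y) (Ident M ?T \<otimes> s)"
      using D by simp
    moreover have "Ident M ?T \<otimes> f \<in> Cof \<inter> W" using f left_Cof' left_W[OF fA] by blast
    then have "?f \<in> ?K" using X by blast
    ultimately show ?thesis unfolding pushouts_of_def by blast
  qed
  then have "Ident M ?T \<otimes> t \<in> cell \<Theta> M ?K"
    using L.preserves_transfinite_compositions t unfolding cell_def by blast
  then have "Ident M ?T \<otimes> t \<in> W" using assms unfolding monoid_axiom_def by blast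
  moreover have "t \<in> Arr M"
  proof -
    obtain r :: "'u rel" and X \<phi> Z \<iota> a where "is_colimit (order_category r) M X \<phi> Z \<iota>" "least_elem r a" "t = \<iota> a"
      using t unfolding cell_def transfinite_compositions_def by blast
    then show ?thesis by (auto simp: is_colimit_def is_cocone_def order_category_def least_elem_def hom_iff)
  qed
  ultimately show "t \<in> W" using left_W by blast
qed

end

theorem theorem3:
  fixes M :: "('o, 'm, 'x) premoncat_scheme"
    and \<Theta> :: "'u rel"
    and W Cof Fib I J :: "'m set"
    and q j p i1 i2 e :: 'm
    and S E :: 'o
  defines "I' \<equiv> insert e I"
    and "J' \<equiv> insert (j \<cdot>\<^bsub>M\<^esub> i1) J"
  assumes "universe \<Theta>"
    and "monoidal_model_category M \<Theta> W Cof Fib"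
    and "cofibrantly_generated \<Theta> M W Cof Fib I J"
    and "very_strong_unit_axiom M W Cof q"
    and "is_coproduct M (Dom M q) (Unit M) S i1 i2"
    and "j \<in> Cof" and "Dom M j = S"
    and "p \<in> W" and "Dom M p = Cod M j" and "Cod M p = Unit M"
    and "p \<cdot>\<^bsub>M\<^esub> j \<cdot>\<^bsub>M\<^esub> i1 = q" and "p \<cdot>\<^bsub>M\<^esub> j \<cdot>\<^bsub>M\<^esub> i2 = Ident M (Unit M)"
    and "is_initial M E" and "e \<in> hom M E (Unit M)"
    and "\<forall>f \<in> I. small_relative \<Theta> M (Dom M f) (cell \<Theta> M I')"
    and "small_relative \<Theta> M (Dom M q) (cell \<Theta> M J')"
    and "\<forall>f \<in> J. small_relative \<Theta> M (Dom M f) (cell \<Theta> M J')"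
  shows "\<exists>Cof' Fib'.
      monoidal_model_category M \<Theta> W Cof' Fib' \<and>
      cofibrantly_generated \<Theta> M W Cof' Fib' I' J' \<and>
      (right_proper M W Fib \<longrightarrow> right_proper M W Fib') \<and>
      (left_proper M W Cof \<longrightarrow> left_proper M W Cof') \<and>
      (\<forall>\<sigma>. symmetric_monoidal_category M \<sigma> \<longrightarrow>
        monoid_axiom \<Theta> M W Cof \<longrightarrow> monoid_axiom \<Theta> M W Cof')"
proof -
  interpret monoidal_model_category M \<Theta> W Cof Fib by fact
  have sm: "small \<Theta> I" "small \<Theta> J" using assms(5) by (auto simp: cofibrantly_generated_def)
  interpret monoidal_enlargement M \<Theta> W Cof Fib I J q j p i1 i2 e S E
  proof unfold_locales
    show "\<exists>Fo Fa. resolving_functor M Fo Fa \<Theta> W Cof Fib (Unit M)"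
      using tensor_left_resolving[OF assms(3,6)] by blast
  qed (use assms in \<open>auto simp: cofibrantly_generated_def very_strong_unit_axiom_def unit_resolution_def\<close>)
  have "small \<Theta> I'" "small \<Theta> J'"
    unfolding I'_def J'_def using sm small_Un[OF universe small_finite[OF universe]]
    by (metis finite.emptyI finite.insertI insert_is_Un)+
  moreover have "small_relative \<Theta> M (Dom M f) (cell \<Theta> M I')" if "f \<in> I'" for f
    using that assms(17) initial_small_relative[OF universe E_initial] unfolding I'_def by auto
  moreover have "small_relative \<Theta> M (Dom M f) (cell \<Theta> M J')" if "f \<in> J'" for f
    using that assms(18,19) unfolding J'_def by auto
  ultimately have "cofibrantly_generated \<Theta> M W Cof' Fib' I' J'"
    unfolding cofibrantly_generated_def
    using I_Arr J_Arr trivial_Fib'_eq by (simp add: I'_def J'_def Fib'_def)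
  moreover have "right_proper M W Fib \<longrightarrow> right_proper M W Fib'"
    using Fib'_subset unfolding right_proper_def by blast
  ultimately show ?thesis
    using enlarged_monoidal_model_category left_proper_enlarged monoid_axiom_enlarged by blast
qed

end
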